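(* Let $\Omega=[0,1]^3$, $T>0$, $\alpha>3$, and let $\boldsymbol m_e:\Omega\times[0,T]\to\mathbb R^3$ be a solution of the Landau–Lifshitz problem $$\partial_t\boldsymbol m=-\boldsymbol m\times\Delta\boldsymbol m+\alpha\Delta\boldsymbol m+\alpha|\nabla\boldsymbol m|^2\boldsymbol m\ \text{ in }\Omega\times(0,T],\qquad \partial_{\mathbf n}\boldsymbol m=0\ \text{ on }\partial\Omega,\qquad \boldsymbol m(\cdot,0)=\boldsymbol m_0,$$ with $|\boldsymbol m_e|\equiv1$, having the regularity $\boldsymbol m_e\in C^3([0,T];[C^0(\bar\Omega)]^3)\cap C^2([0,T];[C^2(\bar\Omega)]^3)\cap L^\infty(0,T;[C^4(\bar\Omega)]^3)$. Let $\boldsymbol m_h^n,\tilde{\boldsymbol m}_h^n$ be generated by the scheme described in the context (Algorithm 2.2), with starting values $\boldsymbol m_h^0,\boldsymbol m_h^1$ satisfying $$\|\mathcal P_h\boldsymbol m_e(\cdot,t_p)-\boldsymbol m_h^p\|_2+\|\nabla_h(\mathcal P_h\boldsymbol m_e(\cdot,t_p)-\boldsymbol m_h^p)\|_2=\mathcal O(k^2+h^2),\quad p=0,1.$$ Assume $\mathcal C_1h\le k\le\mathcal C_2h$ for fixed positive constants $\mathcal C_1,\mathcal C_2$. Then there is a constant $\mathcal C>0$ independent of $k$ and $h$ such that, for all sufficiently small $k,h$ and all $2\le n\le\lfloor T/k\rfloor$, $$\|\mathcal P_h\boldsymbol m_e(\cdot,t_n)-\boldsymbol m_h^n\|_2+\Big(k\sum_{p=1}^n\|\nabla_h(\mathcal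 P_h\boldsymbol m_e(\cdot,t_p)-\tilde{\boldsymbol m}_h^p)\|_2^2\Big)^{1/2}\le\mathcal C(k^2+h^2).$$
   Context: Grid: $h=1/N$, cell-centered points $(\hat x_i,\hat y_j,\hat z_\ell)=((i-\tfrac12)h,(j-\tfrac12)h,(\ell-\tfrac12)h)$, $0\le i,j,\ell\le N+1$; interior points $\Omega_h^0$ are those with $1\le i,j,\ell\le N$, the others are ghost points. $\boldsymbol X$ is the space of $\mathbb R^3$-valued grid functions on all these points satisfying the discrete homogeneous Neumann condition $\boldsymbol m_{0,j,\ell}=\boldsymbol m_{1,j,\ell}$, $\boldsymbol m_{N+1,j,\ell}=\boldsymbol m_{N,j,\ell}$, and analogously in $j$ and $\ell$. $\mathcal P_h$ is pointwise interpolation at interior points (extended to ghost points by the Neumann condition). $\Delta_h=\delta_x^2+\delta_y^2+\delta_z^2$ with $\delta_x^2\boldsymbol m_{i,j,\ell}=(\boldsymbol m_{i+1,j,\ell}-2\boldsymbol m_{i,j,\ell}+\boldsymbol m_{i-1,j,\ell})/h^2$ etc. Forward differences $D_xf_{i,j,\ell}=(f_{i+1,j,\ell}-f_{i,j,\ell})/h$ (similarly $D_y,D_z$), and $\nabla_h\boldsymbol m$ is the $3\times3$ matrix of forward differences of the components. For $\boldsymbol m=(u,v,w)$: $\mathcal A_h\boldsymbol m=(\mathcal A_xu,\mathcal A_yv,\mathcal A_zw)$ with $\mathcal A_xu_{i,j,\ell}=(u_{i,j,\ell}+u_{i-1,j,\ell})/2$, etc., and $\mathcal A_h\nabla_h\boldsymbol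 m:=\nabla_h\mathcal A_h\boldsymbol m$. Norms: $\langle\boldsymbol f,\boldsymbol g\rangle=h^3\sum_{\Omega_h^0}\boldsymbol f\cdot\boldsymbol g$, $\|\boldsymbol f\|_2=\langle\boldsymbol f,\boldsymbol f\rangle^{1/2}$, and $\|\nabla_h\boldsymbol f\|_2$ the analogous discrete norm of all difference quotients. Time step $k$, $t_n=nk$. Scheme (Algorithm 2.2): given $\boldsymbol m_h^n,\boldsymbol m_h^{n+1}\in\boldsymbol X$, set $\hat{\boldsymbol m}_h^{n+2}=2\boldsymbol m_h^{n+1}-\boldsymbol m_h^n$, find $\tilde{\boldsymbol m}_h^{n+2}\in\boldsymbol X$ with, at every interior point, $$\frac{\tfrac32\tilde{\boldsymbol m}_h^{n+2}-2\boldsymbol m_h^{n+1}+\tfrac12\boldsymbol m_h^n}{k}=-\hat{\boldsymbol m}_h^{n+2}\times\Delta_h\hat{\boldsymbol m}_h^{n+2}+\alpha\Delta_h\tilde{\boldsymbol m}_h^{n+2}+\alpha|\mathcal A_h\nabla_h\hat{\boldsymbol m}_h^{n+2}|^2\hat{\boldsymbol m}_h^{n+2},$$ then set $\boldsymbol m_h^{n+2}=\tilde{\boldsymbol m}_h^{n+2}/|\tilde{\boldsymbol m}_h^{n+2}|$ pointwise. *)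

theory Defs
  imports "HOL-Analysis.Analysis"
begin

unbundle no cross3_syntax

definition cube :: "(real^3) set" where
  "cube = {x. \<forall>i. 0 \<le> x$i \<and> x$i \<le> 1}"

definition mord :: "(3 \<Rightarrow> nat) \<Rightarrow> nat" where
  "mord a = a 1 + a 2 + a 3"

definition munit :: "3 \<Rightarrow> (3 \<Rightarrow> nat)" where
  "munit i = (\<lambda>j. if j = i then 1 else 0)"

definition minc :: "(3 \<Rightarrow> nat) \<Rightarrow> 3 \<Rightarrow> (3 \<Rightarrow> nat)" where
  "minc a i = a(i := a i + 1)"

text \<open>g is the partial derivative of f in coordinate direction i on the closed cube
  (one-sided at the boundary, i.e. derivative up to the boundary).\<close>
definition spatial_deriv :: "(real^3 \<Rightarrow> real^3) \<Rightarrow> 3 \<Rightarrow> (real^3 \<Rightarrow> real^3) \<Rightarrow> bool" where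
  "spatial_deriv f i g \<longleftrightarrow>
     (\<forall>x\<in>cube. ((\<lambda>s. f (x + s *\<^sub>R axis i 1)) has_vector_derivative g x)
                  (at 0 within {s. x + s *\<^sub>R axis i 1 \<in> cube}))"

text \<open>Index set (alpha, j) of derivatives d_x^alpha d_t^j that are jointly continuous on
  cube x [0,T]: from C^3([0,T];C^0) (|alpha| = 0, j <= 3) and C^2([0,T];C^2) (|alpha| <= 2, j <= 2).\<close>
definition contidx :: "((3 \<Rightarrow> nat) \<times> nat) set" where
  "contidx = {(a, j). (mord a = 0 \<and> j \<le> 3) \<or> (mord a \<le> 2 \<and> j \<le> 2)}"

text \<open>D a j is the derivative d_x^a d_t^j of me.  Regularity
  me in C^3([0,T];C^0(cl Omega)) \<inter> C^2([0,T];C^2(cl Omega)) \<inter> L^inf(0,T;C^4(cl Omega)).\<close>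
definition regular_family :: "real \<Rightarrow> (real^3 \<Rightarrow> real \<Rightarrow> real^3)
        \<Rightarrow> ((3 \<Rightarrow> nat) \<Rightarrow> nat \<Rightarrow> real^3 \<Rightarrow> real \<Rightarrow> real^3) \<Rightarrow> bool" where
  "regular_family T me D \<longleftrightarrow>
     (\<forall>x\<in>cube. \<forall>t\<in>{0..T}. D (\<lambda>_. 0) 0 x t = me x t) \<and>
     (\<forall>a j. (a, j) \<in> contidx \<longrightarrow>
        continuous_on {(x, t). x \<in> cube \<and> t \<in> {0..T}} (\<lambda>(x, t). D a j x t)) \<and>
     (\<forall>a j i. (a, j) \<in> contidx \<and> (minc a i, j) \<in> contidx \<longrightarrow>
        (\<forall>t\<in>{0..T}. spatial_deriv (\<lambda>x. D a j x t) i (\<lambda>x. D (minc a i) j x t))) \<and>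
     (\<forall>a j. (a, j) \<in> contidx \<and> (a, Suc j) \<in> contidx \<longrightarrow>
        (\<forall>x\<in>cube. \<forall>t\<in>{0..T}.
           ((\<lambda>s. D a j x s) has_vector_derivative D a (Suc j) x t) (at t within {0..T}))) \<and>
     (\<exists>B. AE t in lborel. t \<in> {0..T} \<longrightarrow>
        (\<forall>a. mord a \<le> 4 \<longrightarrow>
            continuous_on cube (\<lambda>x. D a 0 x t) \<and> (\<forall>x\<in>cube. norm (D a 0 x t) \<le> B)) \<and>
        (\<forall>a i. mord a < 4 \<longrightarrow> spatial_deriv (\<lambda>x. D a 0 x t) i (\<lambda>x. D (minc a i) 0 x t)))"

text \<open>me is a solution of the Landau--Lifshitz problem on cube x (0,T] with homogeneous
  Neumann condition, |me| = 1, and the stated regularity.  (The initial value m_0 is just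
  me(.,0).)\<close>
definition LL_exact :: "real \<Rightarrow> real \<Rightarrow> (real^3 \<Rightarrow> real \<Rightarrow> real^3) \<Rightarrow> bool" where
  "LL_exact \<alpha> T me \<longleftrightarrow> (\<exists>D. regular_family T me D \<and>
     (\<forall>x\<in>cube. \<forall>t\<in>{0..T}. norm (me x t) = 1) \<and>
     (\<forall>x\<in>cube. \<forall>t\<in>{0<..T}.
        (let lap = (\<Sum>i\<in>UNIV. D (minc (munit i) i) 0 x t);
             gsq = (\<Sum>i\<in>UNIV. (norm (D (munit i) 0 x t))\<^sup>2)
         in D (\<lambda>_. 0) 1 x t = - cross3 (me x t) lap + \<alpha> *\<^sub>R lap + (\<alpha> * gsq) *\<^sub>R me x t)) \<and>
     (\<forall>x\<in>cube. \<forall>t\<in>{0<..T}. \<forall>i. (x$i = 0 \<or> x$i = 1) \<longrightarrow> D (munit i) 0 x t = 0))"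

type_synonym grid = "nat \<times> nat \<times> nat \<Rightarrow> real^3"

definition all_pts :: "nat \<Rightarrow> (nat \<times> nat \<times> nat) set" where
  "all_pts N = {(i, j, l). i \<le> N + 1 \<and> j \<le> N + 1 \<and> l \<le> N + 1}"

definition inner_pts :: "nat \<Rightarrow> (nat \<times> nat \<times> nat) set" where
  "inner_pts N = {(i, j, l). 1 \<le> i \<and> i \<le> N \<and> 1 \<le> j \<and> j \<le> N \<and> 1 \<le> l \<and> l \<le> N}"

text \<open>The space X: discrete homogeneous Neumann condition.\<close>
definition inX :: "nat \<Rightarrow> grid \<Rightarrow> bool" where
  "inX N m \<longleftrightarrow> (\<forall>a b. a \<le> N + 1 \<and> b \<le> N + 1 \<longrightarrow>
      m (0, a, b) = m (1, a, b) \<and> m (N + 1, a, b) = m (N, a, b) \<and>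
      m (a, 0, b) = m (a, 1, b) \<and> m (a, N + 1, b) = m (a, N, b) \<and>
      m (a, b, 0) = m (a, b, 1) \<and> m (a, b, N + 1) = m (a, b, N))"

definition gpt :: "nat \<Rightarrow> nat \<times> nat \<times> nat \<Rightarrow> real^3" where
  "gpt N p = (case p of (i, j, l) \<Rightarrow>
     vector [(real i - 1/2) / real N, (real j - 1/2) / real N, (real l - 1/2) / real N])"

definition clamp :: "nat \<Rightarrow> nat \<Rightarrow> nat" where
  "clamp N i = max 1 (min N i)"

text \<open>P_h: interpolation at interior points, extended to ghost points by Neumann.\<close>
definition interp :: "nat \<Rightarrow> (real^3 \<Rightarrow> real^3) \<Rightarrow> grid" where
  "interp N f p = (case p of (i, j, l) \<Rightarrow> f (gpt N (clamp N i, clamp N j, clamp N l)))"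

definition lap_h :: "nat \<Rightarrow> grid \<Rightarrow> grid" where
  "lap_h N m p = (case p of (i, j, l) \<Rightarrow> (real N)\<^sup>2 *\<^sub>R
     ((m (i + 1, j, l) - 2 *\<^sub>R m (i, j, l) + m (i - 1, j, l)) +
      (m (i, j + 1, l) - 2 *\<^sub>R m (i, j, l) + m (i, j - 1, l)) +
      (m (i, j, l + 1) - 2 *\<^sub>R m (i, j, l) + m (i, j, l - 1))))"

definition Dx :: "nat \<Rightarrow> grid \<Rightarrow> grid" where
  "Dx N f p = (case p of (i, j, l) \<Rightarrow> real N *\<^sub>R (f (i + 1, j, l) - f (i, j, l)))"
definition Dy :: "nat \<Rightarrow> grid \<Rightarrow> grid" where
  "Dy N f p = (case p of (i, j, l) \<Rightarrow> real N *\<^sub>R (f (i, j + 1, l) - f (i, j, l)))"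
definition Dz :: "nat \<Rightarrow> grid \<Rightarrow> grid" where
  "Dz N f p = (case p of (i, j, l) \<Rightarrow> real N *\<^sub>R (f (i, j, l + 1) - f (i, j, l)))"

definition gradsq :: "nat \<Rightarrow> grid \<Rightarrow> nat \<times> nat \<times> nat \<Rightarrow> real" where
  "gradsq N f p = (norm (Dx N f p))\<^sup>2 + (norm (Dy N f p))\<^sup>2 + (norm (Dz N f p))\<^sup>2"

definition avgA :: "grid \<Rightarrow> grid" where
  "avgA m p = (case p of (i, j, l) \<Rightarrow>
     vector [(m (i, j, l) $ 1 + m (i - 1, j, l) $ 1) / 2,
             (m (i, j, l) $ 2 + m (i, j - 1, l) $ 2) / 2,
             (m (i, j, l) $ 3 + m (i, j, l - 1) $ 3) / 2])"

definition l2norm :: "nat \<Rightarrow> grid \<Rightarrow> real" where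
  "l2norm N f = sqrt ((1 / real N) ^ 3 * (\<Sum>p\<in>inner_pts N. (norm (f p))\<^sup>2))"

definition h1semi :: "nat \<Rightarrow> grid \<Rightarrow> real" where
  "h1semi N f = sqrt ((1 / real N) ^ 3 * (\<Sum>p\<in>inner_pts N. gradsq N f p))"

text \<open>Algorithm 2.2: m n = m_h^n, mt n = tilde m_h^n (n >= 2); by convention tilde m_h^1 = m_h^1.\<close>
definition scheme :: "real \<Rightarrow> nat \<Rightarrow> real \<Rightarrow> (nat \<Rightarrow> grid) \<Rightarrow> (nat \<Rightarrow> grid) \<Rightarrow> bool" where
  "scheme \<alpha> N k m mt \<longleftrightarrow>
     (\<forall>n. inX N (m n)) \<and> mt 1 = m 1 \<and>
     (\<forall>n\<ge>2. inX N (mt n) \<and>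
        (let mh = (\<lambda>q. 2 *\<^sub>R m (n - 1) q - m (n - 2) q) in
         \<forall>p\<in>inner_pts N.
           (1 / k) *\<^sub>R ((3/2) *\<^sub>R mt n p - 2 *\<^sub>R m (n - 1) p + (1/2) *\<^sub>R m (n - 2) p)
           = - cross3 (mh p) (lap_h N mh p) + \<alpha> *\<^sub>R lap_h N (mt n) p
             + (\<alpha> * gradsq N (avgA mh) p) *\<^sub>R mh p) \<and>
        (\<forall>p\<in>all_pts N. m n p = (1 / norm (mt n p)) *\<^sub>R mt n p))"

end

theory Submission
  imports Defs
begin

text \<open>
  Besides second-order terms, the truncation error contains one term of first order in h, because
  \<open>\<A>\<^sub>h\<nabla>\<^sub>h\<close> averages only one component per direction.  That term is parallel to \<open>m\<^sub>e\<close>, so it is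
  removed by the normalisation: the unnormalised solution is compared with \<open>(1 + \<gamma>) m\<^sub>e\<close>, where
  \<open>\<gamma> = 2/3 \<alpha> k (|\<A>\<^sub>h\<nabla>\<^sub>h m\<^sub>e|\<^sup>2 - |\<nabla> m\<^sub>e|\<^sup>2) = O(k h)\<close> also has difference quotients of size \<open>O(k h)\<close>.
  All other consistency errors are written as discrete divergences of fluxes of size \<open>O(h\<^sup>2)\<close> that
  vanish on the walls, or are pointwise \<open>O(h\<^sup>2)\<close>.

  Testing the error equation with the new unnormalised error and using the BDF2 identity, the
  explicit term \<open>m \<times> \<Delta>\<^sub>h m\<close> (a divergence of \<open>m \<times> \<nabla>\<^sub>h m\<close>) costs the weights 3/2 + 1 + 1/2 = 3 of squared
  gradients, which is where \<open>\<alpha> > 3\<close> enters.  The quadratic gradient term is absorbed by the maximum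
  norm of the error.  That norm is \<open>o(h\<^sup>1\<^sup>/\<^sup>2)\<close> by a one-dimensional Agmon inequality along grid lines; for the new
  time level a crude version of the same energy estimate supplies it first.  Normalising changes
  the BDF2 energy by at most a factor \<open>1 + O(k)\<close>, and Gronwall's inequality closes the induction with
  a constant independent of the a priori bound.
\<close>

section \<open>Discrete calculus on the grid\<close>

text \<open>In the crude step the new error is not yet known to be small. Old errors that are
  o(h^(1/2)) pointwise have squared difference quotients o(1/h), and the factor k, comparable to h,
  makes the quadratic gradient term absorbable. This enlarges the a priori constant, so it serves
  only to make the new error small pointwise; the sharp step then restores the constant.

  The starting values need not have unit length. Hence the energies before and after normalisation
  are compared only from time level 3 on; level 2 is covered by the crude step, and the recursion
  starts from a floor \<open>K1 * h ^ 4\<close>.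

  Fourth spatial derivatives of the exact solution are controlled only for almost every time. They
  are used through Lipschitz and second-difference bounds on second derivatives, which pass to every
  time by continuity. Cell-centred ghost points are mirror images of interior points, so ghost
  values sample the even reflection; it keeps the Lipschitz bounds because normal derivatives vanish
  on the walls.\<close>

definition fw :: "3 \<Rightarrow> nat \<times> nat \<times> nat \<Rightarrow> nat \<times> nat \<times> nat" where
  "fw d p = (case p of (i, j, l) \<Rightarrow> if d = 1 then (i + 1, j, l) else if d = 2 then (i, j + 1, l) else (i, j, l + 1))"

definition bw :: "3 \<Rightarrow> nat \<times> nat \<times> nat \<Rightarrow> nat \<times> nat \<times> nat" where
  "bw d p = (case p of (i, j, l) \<Rightarrow> if d = 1 then (i - 1, j, l) else if d = 2 then (i, j - 1, l) else (i, j, l - 1))"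

definition coord :: "3 \<Rightarrow> nat \<times> nat \<times> nat \<Rightarrow> nat" where
  "coord d p = (case p of (i, j, l) \<Rightarrow> if d = 1 then i else if d = 2 then j else l)"

definition dd :: "nat \<Rightarrow> 3 \<Rightarrow> (nat \<times> nat \<times> nat \<Rightarrow> 'a::real_vector) \<Rightarrow> nat \<times> nat \<times> nat \<Rightarrow> 'a" where
  "dd N d f p = real N *\<^sub>R (f (fw d p) - f p)"

text \<open>The condition \<open>inX\<close> with the three directions treated alike:
  \<open>p\<close> and \<open>fw d p\<close> lie on the two sides of a wall exactly when
  \<open>coord d p\<close> is 0 or \<open>N\<close>. The value type is free because scalar factors
  and pairs of grid functions are also used.\<close>

definition neumann :: "nat \<Rightarrow> (nat \<times> nat \<times> nat \<Rightarrow> 'a) \<Rightarrow> bool" where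
  "neumann N f \<longleftrightarrow> (\<forall>d. \<forall>p\<in>all_pts N. coord d p = 0 \<or> coord d p = N \<longrightarrow> f (fw d p) = f p)"

definition gmean :: "nat \<Rightarrow> (nat \<times> nat \<times> nat \<Rightarrow> real) \<Rightarrow> real" where
  "gmean N F = (1 / real N) ^ 3 * (\<Sum>p\<in>inner_pts N. F p)"

lemma inner_pts_prod: "inner_pts N = {1..N} \<times> {1..N} \<times> {1..N}"
  by (auto simp: inner_pts_def)

lemma finite_inner_pts [simp]: "finite (inner_pts N)"
  by (simp add: inner_pts_prod)

lemma inX_imp_neu: assumes "inX N f" shows "neumann N f"
  unfolding neumann_def
proof (intro allI ballI impI)
  fix d :: 3 and p :: "nat \<times> nat \<times> nat"
  assume p: "p \<in> all_pts N" and w: "coord d p = 0 \<or> coord d p = N"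
  obtain i j l where q: "p = (i, j, l)" by (cases p)
  show "f (fw d p) = f p"
    using assms p w exhaust_3[of d] unfolding inX_def q fw_def coord_def all_pts_def
    by (auto split: if_splits)
qed

lemma neumann_comp2: "neumann N f \<Longrightarrow> neumann N g \<Longrightarrow> neumann N (\<lambda>p. F (f p) (g p))"
  by (simp add: neumann_def)

lemma fw_bw [simp]: "p \<in> inner_pts N \<Longrightarrow> fw d (bw d p) = p"
  by (cases p) (auto simp: fw_def bw_def inner_pts_def)

lemma fw_bw_commute: "p \<in> inner_pts N \<Longrightarrow> bw c (fw d p) = fw d (bw c p)"
  by (cases p) (auto simp: fw_def bw_def inner_pts_def)

lemma bw_fw [simp]: "bw d (fw d p) = p"
  by (cases p) (auto simp: fw_def bw_def)

lemma bw_all: "p \<in> inner_pts N \<Longrightarrow> bw d p \<in> all_pts N"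
  by (cases p) (auto simp: bw_def inner_pts_def all_pts_def)

lemma fw_all: "p \<in> inner_pts N \<Longrightarrow> fw d p \<in> all_pts N"
  by (cases p) (auto simp: fw_def inner_pts_def all_pts_def)

lemma inner_all: "p \<in> inner_pts N \<Longrightarrow> p \<in> all_pts N"
  by (cases p) (auto simp: inner_pts_def all_pts_def)

lemma gradsq_dd: "gradsq N f p = (\<Sum>d\<in>UNIV. (norm (dd N d f p))\<^sup>2)"
  by (cases p) (simp add: gradsq_def sum_3 Dx_def Dy_def Dz_def dd_def fw_def)

lemma lap_h_dd:
  assumes "p \<in> inner_pts N"
  shows "lap_h N f p = (\<Sum>d\<in>UNIV. real N *\<^sub>R (dd N d f p - dd N d f (bw d p)))"
proof -
  obtain i j l where q: "p = (i, j, l)" by (cases p)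
  have e: "real N *\<^sub>R (dd N d f p - dd N d f (bw d p)) = (real N)\<^sup>2 *\<^sub>R (f (fw d p) - 2 *\<^sub>R f p + f (bw d p))" for d
    using assms by (simp add: dd_def power2_eq_square algebra_simps scaleR_2)
  show ?thesis
    unfolding sum_3 e by (simp add: lap_h_def q fw_def bw_def vec_eq_iff algebra_simps)
qed

text \<open>The backward shift trades the layer \<open>coord d = N\<close> for the layer
  \<open>coord d = 0\<close>; on both \<open>H\<close> vanishes, and elsewhere \<open>fw d\<close>
  inverts the shift.\<close>

lemma sum_bw_shift:
  fixes H :: "nat \<times> nat \<times> nat \<Rightarrow> real"
  assumes z: "\<And>p. p \<in> all_pts N \<Longrightarrow> coord d p = 0 \<or> coord d p = N \<Longrightarrow> H p = 0"
  shows "(\<Sum>p\<in>inner_pts N. H (bw d p)) = (\<Sum>p\<in>inner_pts N. H p)"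
proof (rule sum.reindex_bij_witness_not_neutral[where i="fw d" and j="bw d"
      and S'="{p\<in>inner_pts N. coord d p = 1}" and T'="{p\<in>inner_pts N. coord d p = N}"], goal_cases)
  case (3 a)
  then show ?case by auto
next
  case (4 a)
  then show ?case using exhaust_3[of d] by (cases a) (auto simp: bw_def coord_def inner_pts_def)
next
  case (6 b)
  then show ?case using exhaust_3[of d] by (cases b) (auto simp: fw_def coord_def inner_pts_def)
next
  case (7 a)
  have "coord d (bw d a) = 0" using 7 exhaust_3[of d] by (cases a) (auto simp: bw_def coord_def)
  then show ?case using z[of "bw d a"] 7 bw_all[of a N d] by auto
next
  case (8 b)
  then show ?case using z[of b] inner_all[of b N] by auto
qed auto

text \<open>\<open>J d p\<close> is read as a flux through the face between \<open>p\<close> and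
  \<open>fw d p\<close>; the faces with coordinate 0 or \<open>N\<close> are the walls, so the
  hypothesis removes all boundary terms.\<close>

lemma summation_by_parts:
  fixes J :: "3 \<Rightarrow> nat \<times> nat \<times> nat \<Rightarrow> 'a::real_inner"
  assumes z: "\<And>d p. p \<in> all_pts N \<Longrightarrow> coord d p = 0 \<or> coord d p = N \<Longrightarrow> J d p = 0"
  shows "gmean N (\<lambda>p. (\<Sum>d\<in>UNIV. real N *\<^sub>R (J d p - J d (bw d p))) \<bullet> g p)
       = - gmean N (\<lambda>p. \<Sum>d\<in>UNIV. J d p \<bullet> dd N d g p)"
proof -
  have s: "(\<Sum>p\<in>inner_pts N. J d (bw d p) \<bullet> g p) = (\<Sum>p\<in>inner_pts N. J d p \<bullet> g (fw d p))" for d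
  proof -
    have "(\<Sum>p\<in>inner_pts N. J d (bw d p) \<bullet> g p) = (\<Sum>p\<in>inner_pts N. J d (bw d p) \<bullet> g (fw d (bw d p)))"
      by (intro sum.cong) auto
    also have "\<dots> = (\<Sum>p\<in>inner_pts N. J d p \<bullet> g (fw d p))"
      by (rule sum_bw_shift[of N d "\<lambda>p. J d p \<bullet> g (fw d p)"]) (simp add: z)
    finally show ?thesis .
  qed
  have "(\<Sum>p\<in>inner_pts N. (\<Sum>d\<in>UNIV. real N *\<^sub>R (J d p - J d (bw d p))) \<bullet> g p)
      = (\<Sum>d\<in>UNIV. \<Sum>p\<in>inner_pts N. (real N *\<^sub>R (J d p - J d (bw d p))) \<bullet> g p)"
    by (subst sum.swap) (simp add: inner_sum_left)
  also have "\<dots> = (\<Sum>d\<in>UNIV. real N * ((\<Sum>p\<in>inner_pts N. J d p \<bullet> g p) - (\<Sum>p\<in>inner_pts N. J d (bw d p) \<bullet> g p)))"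
    by (simp add: inner_diff_left sum_subtractf sum_distrib_left algebra_simps)
  also have "\<dots> = - (\<Sum>d\<in>UNIV. \<Sum>p\<in>inner_pts N. J d p \<bullet> dd N d g p)"
    unfolding s by (simp add: dd_def inner_diff_right sum_subtractf sum_distrib_left algebra_simps sum_negf)
  also have "\<dots> = - (\<Sum>p\<in>inner_pts N. \<Sum>d\<in>UNIV. J d p \<bullet> dd N d g p)"
    by (subst sum.swap) simp
  finally show ?thesis by (simp add: gmean_def)
qed

lemma gmean_mono: "(\<And>p. p \<in> inner_pts N \<Longrightarrow> F p \<le> G p) \<Longrightarrow> gmean N F \<le> gmean N G"
  unfolding gmean_def by (intro mult_left_mono sum_mono) auto

lemma gmean_cong: "(\<And>p. p \<in> inner_pts N \<Longrightarrow> F p = G p) \<Longrightarrow> gmean N F = gmean N G"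
  unfolding gmean_def by (auto intro: sum.cong)

lemma gmean_nonneg: "(\<And>p. p \<in> inner_pts N \<Longrightarrow> 0 \<le> F p) \<Longrightarrow> 0 \<le> gmean N F"
  unfolding gmean_def by (intro mult_nonneg_nonneg sum_nonneg) auto

lemma gmean_add: "gmean N (\<lambda>p. F p + G p) = gmean N F + gmean N G"
  by (simp add: gmean_def sum.distrib algebra_simps)

lemma gmean_diff: "gmean N (\<lambda>p. F p - G p) = gmean N F - gmean N G"
  by (simp add: gmean_def sum_subtractf algebra_simps)

lemma gmean_cmult: "gmean N (\<lambda>p. c * F p) = c * gmean N F"
  by (simp add: gmean_def sum_distrib_left algebra_simps)

lemma gmean_const: "N > 0 \<Longrightarrow> gmean N (\<lambda>p. c) = c"
  by (simp add: gmean_def inner_pts_prod power3_eq_cube field_simps)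

section \<open>Squared discrete norms and the Neumann extension by clamping\<close>

definition l2sq :: "nat \<Rightarrow> grid \<Rightarrow> real" where "l2sq N f = gmean N (\<lambda>p. (norm (f p))\<^sup>2)"
definition h1sq :: "nat \<Rightarrow> grid \<Rightarrow> real" where "h1sq N f = gmean N (\<lambda>p. gradsq N f p)"

lemma l2norm_AA: "l2norm N f = sqrt (l2sq N f)"
  by (simp add: l2norm_def l2sq_def gmean_def)

lemma h1semi_BB: "h1semi N f = sqrt (h1sq N f)"
  by (simp add: h1semi_def h1sq_def gmean_def)

lemma gradsq_nonneg: "0 \<le> gradsq N f p"
  by (simp add: gradsq_def)

lemma l2sq_nonneg: "0 \<le> l2sq N f" and h1sq_nonneg: "0 \<le> h1sq N f"
  by (auto simp: l2sq_def h1sq_def intro!: gmean_nonneg gradsq_nonneg)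

definition clamp_pt :: "nat \<Rightarrow> nat \<times> nat \<times> nat \<Rightarrow> nat \<times> nat \<times> nat" where
  "clamp_pt N p = (case p of (i, j, l) \<Rightarrow> (clamp N i, clamp N j, clamp N l))"

lemma clamp_pt_inner: "N > 0 \<Longrightarrow> clamp_pt N p \<in> inner_pts N"
  by (cases p) (auto simp: clamp_pt_def inner_pts_def clamp_def)

lemma clamp_pt_id: "p \<in> inner_pts N \<Longrightarrow> clamp_pt N p = p"
  by (cases p) (auto simp: clamp_pt_def inner_pts_def clamp_def)

lemma interp_cl: "interp N f p = f (gpt N (clamp_pt N p))"
  by (cases p) (simp add: interp_def clamp_pt_def)

lemma neumann_interp_cl: assumes "N > 0" shows "neumann N (\<lambda>p. F (clamp_pt N p))"
  unfolding neumann_def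
proof (intro allI ballI impI)
  fix d :: 3 and p assume p: "p \<in> all_pts N" and w: "coord d p = 0 \<or> coord d p = N"
  have "clamp_pt N (fw d p) = clamp_pt N p"
    using w exhaust_3[of d] assms by (cases p) (auto simp: clamp_pt_def clamp_def fw_def coord_def)
  then show "F (clamp_pt N (fw d p)) = F (clamp_pt N p)" by simp
qed

text \<open>An edge or corner ghost point is brought inside by clamping one coordinate at a time,
  each step staying in \<open>all_pts\<close>, where the Neumann condition still applies.\<close>

lemma neumann_cl:
  assumes f: "neumann N f" and N: "N > 0" and p: "p \<in> all_pts N"
  shows "f p = f (clamp_pt N p)"
proof -
  have s: "f (i, j, l) = f (clamp N i, j, l)" "f (i, j, l) = f (i, clamp N j, l)" "f (i, j, l) = f (i, j, clamp N l)"
    if q: "(i, j, l) \<in> all_pts N" for i j l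
  proof -
    have A: "i \<le> N + 1" "j \<le> N + 1" "l \<le> N + 1" using q by (auto simp: all_pts_def)
    have n: "\<And>d q. q \<in> all_pts N \<Longrightarrow> coord d q = 0 \<or> coord d q = N \<Longrightarrow> f (fw d q) = f q"
      using f by (auto simp: neumann_def)
    have c: "clamp N a = (if a = 0 then 1 else if a = N + 1 then N else a)" if "a \<le> N + 1" for a
      using that N by (auto simp: clamp_def)
    have "f (1, j, l) = f (0, j, l)" "f (N + 1, j, l) = f (N, j, l)"
      "f (i, 1, l) = f (i, 0, l)" "f (i, N + 1, l) = f (i, N, l)"
      "f (i, j, 1) = f (i, j, 0)" "f (i, j, N + 1) = f (i, j, N)"
      using n[of "(0,j,l)" 1] n[of "(N,j,l)" 1] n[of "(i,0,l)" 2] n[of "(i,N,l)" 2]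
        n[of "(i,j,0)" 3] n[of "(i,j,N)" 3] A
      by (simp_all add: coord_def fw_def all_pts_def)
    then show "f (i, j, l) = f (clamp N i, j, l)" "f (i, j, l) = f (i, clamp N j, l)" "f (i, j, l) = f (i, j, clamp N l)"
      unfolding c[OF A(1)] c[OF A(2)] c[OF A(3)] by presburger+
  qed
  obtain i j l where q: "p = (i, j, l)" by (cases p)
  have c: "clamp N a \<le> N + 1" for a using N by (auto simp: clamp_def)
  have "f (i, j, l) = f (clamp N i, j, l)" by (rule s(1)) (use p q in simp)
  also have "\<dots> = f (clamp N i, clamp N j, l)" by (rule s(2)) (use p q c in \<open>simp add: all_pts_def\<close>)
  also have "\<dots> = f (clamp N i, clamp N j, clamp N l)" by (rule s(3)) (use p q c in \<open>simp add: all_pts_def\<close>)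
  finally show ?thesis by (simp add: q clamp_pt_def)
qed

lemma neumann_bound_all:
  assumes "neumann N f" "N > 0" "\<And>p. p \<in> inner_pts N \<Longrightarrow> P (f p)" "p \<in> all_pts N"
  shows "P (f p)"
  using assms neumann_cl[of N f p] clamp_pt_inner[of N p] by metis

section \<open>Agmon inequality along grid lines\<close>

text \<open>Compare \<open>u i\<close> with every \<open>u a\<close> by telescoping the squares,
  then average over \<open>a\<close>. Each increment of the square is split by Young's inequality
  with weight \<tau>, so the gradient part carries an arbitrarily small factor.\<close>

lemma agmon_line:
  fixes u :: "nat \<Rightarrow> 'a::real_normed_vector"
  assumes i: "i \<in> {1..N}" and tau: "\<tau> > 0"
  shows "(norm (u i))\<^sup>2 \<le> (1 + 1/\<tau>) * ((1 / real N) * (\<Sum>s\<in>{1..N}. (norm (u s))\<^sup>2))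
      + \<tau> * ((1 / real N) * (\<Sum>s\<in>{1..N}. (norm (real N *\<^sub>R (u (s + 1) - u s)))\<^sup>2))"
proof -
  have N: "N > 0" using i by auto
  define w where "w s = (norm (u (s + 1)))\<^sup>2 - (norm (u s))\<^sup>2" for s
  define z where "z s = (1 / real N) * ((\<tau>) * (norm (real N *\<^sub>R (u (s + 1) - u s)))\<^sup>2
     + 1/(2*\<tau>) * ((norm (u s))\<^sup>2 + (norm (u (s+1)))\<^sup>2))" for s
  have w: "\<bar>w s\<bar> \<le> z s" for s
  proof -
    define D where "D = norm (u (s + 1) - u s)"
    define A where "A = norm (u (s+1))" define B where "B = norm (u s)"
    have 0: "A \<ge> 0" "B \<ge> 0" "D \<ge> 0" by (auto simp: A_def B_def D_def)
    have 1: "\<bar>A - B\<bar> \<le> D" unfolding A_def B_def D_def by (rule norm_triangle_ineq3)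
    have "\<bar>w s\<bar> = \<bar>A - B\<bar> * (A + B)"
    proof -
      have "w s = (A - B) * (A + B)" by (simp add: w_def A_def B_def power2_eq_square algebra_simps)
      then show ?thesis using 0 by (simp add: abs_mult)
    qed
    also have "\<dots> \<le> D * (A + B)" using 0 1 by (intro mult_right_mono) auto
    also have "\<dots> \<le> z s"
    proof -
      \<comment> \<open>The first square is Young's inequality for \<open>D * (A + B)\<close>; the
        second replaces the square of \<open>A + B\<close> by twice the sum of squares.\<close>
      have "0 \<le> (real N * \<tau> * D * 2 - (A + B))\<^sup>2 + (A - B)\<^sup>2" by simp
      then have "real N * \<tau> * 4 * (D * (A + B)) \<le> 4 * \<tau>\<^sup>2 * (real N * D)\<^sup>2 + 2 * (A\<^sup>2 + B\<^sup>2)"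
        by (simp add: power2_eq_square algebra_simps)
      then have "D * (A + B) \<le> (4 * \<tau>\<^sup>2 * (real N * D)\<^sup>2 + 2 * (A\<^sup>2 + B\<^sup>2)) / (real N * \<tau> * 4)"
        using N tau by (simp add: pos_le_divide_eq mult.commute)
      also have "\<dots> = z s"
        using N tau unfolding z_def A_def[symmetric] B_def[symmetric] norm_scaleR D_def[symmetric]
        by (simp add: field_simps power2_eq_square)
      finally show ?thesis .
    qed
    finally show ?thesis .
  qed
  have z0: "z s \<ge> 0" for s using tau N by (simp add: z_def)
  have tel: "\<bar>(norm (u b))\<^sup>2 - (norm (u a))\<^sup>2\<bar> \<le> (\<Sum>s\<in>{1..<N}. z s)" if "1 \<le> a" "a \<le> b" "b \<le> N" for a b
  proof -
    have "(norm (u b))\<^sup>2 - (norm (u a))\<^sup>2 = (\<Sum>s\<in>{a..<b}. w s)"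
      using sum_Suc_diff'[of a b "\<lambda>s. (norm (u s))\<^sup>2"] that by (simp add: w_def)
    then have "\<bar>(norm (u b))\<^sup>2 - (norm (u a))\<^sup>2\<bar> \<le> (\<Sum>s\<in>{a..<b}. z s)"
      using order_trans[OF sum_abs sum_mono[of "{a..<b}" "\<lambda>s. \<bar>w s\<bar>" z]] w by auto
    also have "\<dots> \<le> (\<Sum>s\<in>{1..<N}. z s)"
      using that z0 by (intro sum_mono2) auto
    finally show ?thesis .
  qed
  have one: "(norm (u i))\<^sup>2 \<le> (norm (u a))\<^sup>2 + (\<Sum>s\<in>{1..<N}. z s)" if "a \<in> {1..N}" for a
    using tel[of a i] tel[of i a] that i by (cases "a \<le> i") auto
  have "real N * (norm (u i))\<^sup>2 = (\<Sum>a\<in>{1..N}. (norm (u i))\<^sup>2)" by simp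
  also have "\<dots> \<le> (\<Sum>a\<in>{1..N}. (norm (u a))\<^sup>2 + (\<Sum>s\<in>{1..<N}. z s))" by (intro sum_mono one)
  also have "\<dots> = (\<Sum>a\<in>{1..N}. (norm (u a))\<^sup>2) + real N * (\<Sum>s\<in>{1..<N}. z s)"
    by (simp add: sum.distrib)
  finally have 1: "(norm (u i))\<^sup>2 \<le> (1 / real N) * (\<Sum>a\<in>{1..N}. (norm (u a))\<^sup>2) + (\<Sum>s\<in>{1..<N}. z s)"
    using N by (simp add: field_simps)
  have "(\<Sum>s\<in>{1..<N}. (norm (u (s+1)))\<^sup>2) = (\<Sum>s\<in>{2..<N+1}. (norm (u s))\<^sup>2)"
    using sum.shift_bounds_Suc_ivl[of "\<lambda>s. (norm (u s))\<^sup>2" 1 N] by (simp add: numeral_2_eq_2)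
  also have "\<dots> \<le> (\<Sum>s\<in>{1..N}. (norm (u s))\<^sup>2)" by (intro sum_mono2) auto
  finally have 2: "(\<Sum>s\<in>{1..<N}. (norm (u (s+1)))\<^sup>2) \<le> (\<Sum>s\<in>{1..N}. (norm (u s))\<^sup>2)" .
  have 3: "(\<Sum>s\<in>{1..<N}. (norm (u s))\<^sup>2) \<le> (\<Sum>s\<in>{1..N}. (norm (u s))\<^sup>2)" by (intro sum_mono2) auto
  have 4: "(\<Sum>s\<in>{1..<N}. (norm (real N *\<^sub>R (u (s + 1) - u s)))\<^sup>2) \<le> (\<Sum>s\<in>{1..N}. (norm (real N *\<^sub>R (u (s + 1) - u s)))\<^sup>2)"
    by (intro sum_mono2) auto
  have "(\<Sum>s\<in>{1..<N}. z s) = (1 / real N) * (\<tau> * (\<Sum>s\<in>{1..<N}. (norm (real N *\<^sub>R (u (s + 1) - u s)))\<^sup>2)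
     + 1/(2*\<tau>) * ((\<Sum>s\<in>{1..<N}. (norm (u s))\<^sup>2) + (\<Sum>s\<in>{1..<N}. (norm (u (s+1)))\<^sup>2)))"
    unfolding z_def sum.distrib sum_distrib_left[symmetric] by simp
  also have "\<dots> \<le> (1 / real N) * (\<tau> * (\<Sum>s\<in>{1..N}. (norm (real N *\<^sub>R (u (s + 1) - u s)))\<^sup>2)
     + 1/(2*\<tau>) * ((\<Sum>s\<in>{1..N}. (norm (u s))\<^sup>2) + (\<Sum>s\<in>{1..N}. (norm (u s))\<^sup>2)))"
    using 2 3 4 tau by (intro mult_left_mono add_mono) auto
  finally show ?thesis using 1 by (simp add: algebra_simps add_divide_distrib)
qed

text \<open>One grid line is part of the whole grid, and the one-dimensional mean weighs it by h
  instead of h^3; hence the factor \<open>(real N)\<^sup>2\<close>. The parameter \<tau> stays free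
  for \<open>agmon_small\<close>.\<close>

lemma agmon:
  fixes f :: grid
  assumes p: "p \<in> inner_pts N" and tau: "\<tau> > 0"
  shows "(norm (f p))\<^sup>2 \<le> (real N)\<^sup>2 * ((1 + 1/\<tau>) * l2sq N f + \<tau> * h1sq N f)"
proof -
  obtain i j l where q: "p = (i, j, l)" by (cases p)
  have r: "i \<in> {1..N}" "j \<in> {1..N}" "l \<in> {1..N}" and N: "N > 0" using p by (auto simp: q inner_pts_def)
  have slice: "(1 / real N) * (\<Sum>s\<in>{1..N}. F (s, j, l)) \<le> (real N)\<^sup>2 * gmean N F" if F: "\<And>p. F p \<ge> 0" for F
  proof -
    have "(\<Sum>s\<in>{1..N}. F (s, j, l)) = (\<Sum>p\<in>(\<lambda>s. (s, j, l)) ` {1..N}. F p)"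
      by (subst sum.reindex) (auto simp: inj_on_def)
    also have "\<dots> \<le> (\<Sum>p\<in>inner_pts N. F p)" using r F by (intro sum_mono2 finite_inner_pts) (auto simp: inner_pts_def)
    finally show ?thesis using N by (simp add: gmean_def power2_eq_square power3_eq_cube field_simps)
  qed
  have d: "real N *\<^sub>R (f (s + 1, j, l) - f (s, j, l)) = dd N 1 f (s, j, l)" for s
    by (simp add: dd_def fw_def)
  have 0: "(norm (f p))\<^sup>2 \<le> (1 + 1/\<tau>) * ((1 / real N) * (\<Sum>s\<in>{1..N}. (norm (f (s,j,l)))\<^sup>2))
      + \<tau> * ((1 / real N) * (\<Sum>s\<in>{1..N}. (norm (dd N 1 f (s, j, l)))\<^sup>2))"
    using agmon_line[OF r(1) tau, of "\<lambda>s. f (s, j, l)"] unfolding d by (simp add: q)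
  have 1: "(1 / real N) * (\<Sum>s\<in>{1..N}. (norm (f (s,j,l)))\<^sup>2) \<le> (real N)\<^sup>2 * l2sq N f"
    unfolding l2sq_def by (rule slice) simp
  have 2: "(1 / real N) * (\<Sum>s\<in>{1..N}. (norm (dd N 1 f (s, j, l)))\<^sup>2) \<le> (real N)\<^sup>2 * gmean N (\<lambda>p. (norm (dd N 1 f p))\<^sup>2)"
    by (rule slice) simp
  also have "\<dots> \<le> (real N)\<^sup>2 * h1sq N f"
    unfolding h1sq_def gradsq_dd sum_3 by (intro mult_left_mono gmean_mono) auto
  finally have "\<tau> * ((1 / real N) * (\<Sum>s\<in>{1..N}. (norm (dd N 1 f (s, j, l)))\<^sup>2)) \<le> \<tau> * ((real N)\<^sup>2 * h1sq N f)"
    using tau by (intro mult_left_mono) auto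
  moreover have "(1 + 1/\<tau>) * ((1 / real N) * (\<Sum>s\<in>{1..N}. (norm (f (s,j,l)))\<^sup>2)) \<le> (1 + 1/\<tau>) * ((real N)\<^sup>2 * l2sq N f)"
    using 1 tau by (intro mult_left_mono) auto
  ultimately show ?thesis using 0 by (simp add: algebra_simps)
qed

section \<open>The gradient of the averaged field\<close>

lemma norm3_eq: "(norm (x::real^3))\<^sup>2 = (\<Sum>c\<in>UNIV. (x $ c)\<^sup>2)"
  by (simp add: norm_vec_def L2_set_def sum_nonneg)

lemma avgA_nth: "avgA f p $ c = (f p $ c + f (bw c p) $ c) / 2"
  using exhaust_3[of c] by (cases p) (auto simp: avgA_def bw_def)

lemma dd_avgA_nth:
  assumes "p \<in> inner_pts N"
  shows "dd N d (avgA f) p $ c = (dd N d f p $ c + dd N d f (bw c p) $ c) / 2"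
  using fw_bw_commute[OF assms, of c d] by (simp add: dd_def avgA_nth field_simps)

lemma dd_linear:
  "dd N d (\<lambda>p. f p + g p) p = dd N d f p + dd N d g p"
  "dd N d (\<lambda>p. f p - g p) p = dd N d f p - dd N d g p"
  "dd N d (\<lambda>p. r *\<^sub>R f p) p = r *\<^sub>R dd N d f p"
  by (simp_all add: dd_def algebra_simps)

lemma avgA_add: "avgA (\<lambda>p. f p + g p) = (\<lambda>p. avgA f p + avgA g p)"
  by (rule ext) (simp add: vec_eq_iff avgA_nth field_simps)

lemma dd_wall: "neumann N f \<Longrightarrow> p \<in> all_pts N \<Longrightarrow> coord d p = 0 \<or> coord d p = N \<Longrightarrow> dd N d f p = 0"
  by (auto simp: neumann_def dd_def)

text \<open>The ghost layer behind the wall copies the first interior layer, so tangential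
  differences are copied and the normal difference is taken between equal values.\<close>

lemma dd_bw_edge:
  assumes f: "neumann N f" and p: "p \<in> inner_pts N" and w: "coord c p = 1"
  shows "dd N d f (bw c p) = (if d = c then 0 else dd N d f p)"
proof -
  have b: "bw c p \<in> all_pts N" "coord c (bw c p) = 0"
    using p w exhaust_3[of c] by (cases p; auto simp: bw_def coord_def inner_pts_def all_pts_def)+
  have 1: "f p = f (bw c p)" using f b p unfolding neumann_def by (metis fw_bw)
  show ?thesis
  proof (cases "d = c")
    case True then show ?thesis using dd_wall[OF f b(1)] b(2) by simp
  next
    case False
    have q: "fw d (bw c p) \<in> all_pts N" "coord c (fw d (bw c p)) = 0" "fw c (fw d (bw c p)) = fw d p"
      using p w False exhaust_3[of c] exhaust_3[of d]
      by (cases p; auto simp: bw_def fw_def coord_def inner_pts_def all_pts_def)+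
    have "f (fw d p) = f (fw d (bw c p))" using f q unfolding neumann_def by metis
    then show ?thesis using False 1 by (simp add: dd_def)
  qed
qed

text \<open>The layer behind the wall is compared with the first interior layer, and the remaining
  layers form a shift inside the grid. Each part costs at most the full sum, hence the factor
  2.\<close>

lemma sum_bw_le:
  fixes H :: "nat \<times> nat \<times> nat \<Rightarrow> real"
  assumes H: "\<And>p. H p \<ge> 0" and w: "\<And>p. p \<in> inner_pts N \<Longrightarrow> coord c p = 1 \<Longrightarrow> H (bw c p) \<le> H p"
  shows "(\<Sum>p\<in>inner_pts N. H (bw c p)) \<le> 2 * (\<Sum>p\<in>inner_pts N. H p)"
proof -
  let ?I = "inner_pts N" let ?E = "{p\<in>?I. coord c p = 1}" let ?R = "{p\<in>?I. coord c p \<noteq> 1}"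
  have "(\<Sum>p\<in>?I. H (bw c p)) = (\<Sum>p\<in>?E. H (bw c p)) + (\<Sum>p\<in>?R. H (bw c p))"
    by (subst sum.union_disjoint[symmetric]) (auto intro: sum.cong)
  also have "(\<Sum>p\<in>?E. H (bw c p)) \<le> (\<Sum>p\<in>?E. H p)" by (intro sum_mono) (auto intro: w)
  also have "(\<Sum>p\<in>?E. H p) \<le> (\<Sum>p\<in>?I. H p)" by (intro sum_mono2) (auto simp: H)
  also have "(\<Sum>p\<in>?R. H (bw c p)) = (\<Sum>q\<in>bw c ` ?R. H q)"
    by (subst sum.reindex) (auto intro!: inj_on_inverseI[where g="fw c"])
  also have "\<dots> \<le> (\<Sum>p\<in>?I. H p)"
  proof (intro sum_mono2 finite_inner_pts)
    show "bw c ` ?R \<subseteq> ?I" using exhaust_3[of c] by (auto simp: bw_def coord_def inner_pts_def)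
  qed (auto simp: H)
  finally show ?thesis by simp
qed

lemma gmean_gradsq_avgA:
  assumes "neumann N f"
  shows "gmean N (gradsq N (avgA f)) \<le> 2 * h1sq N f"
proof -
  let ?I = "inner_pts N"
  have 1: "(\<Sum>p\<in>?I. (dd N d f (bw c p) $ c)\<^sup>2) \<le> 2 * (\<Sum>p\<in>?I. (dd N d f p $ c)\<^sup>2)" for d c
    by (rule sum_bw_le) (auto simp: dd_bw_edge[OF assms])
  have "(\<Sum>p\<in>?I. gradsq N (avgA f) p) = (\<Sum>p\<in>?I. \<Sum>d\<in>UNIV. \<Sum>c\<in>UNIV. ((dd N d f p $ c + dd N d f (bw c p) $ c) / 2)\<^sup>2)"
    by (simp add: gradsq_dd norm3_eq dd_avgA_nth)
  also have "\<dots> \<le> (\<Sum>p\<in>?I. \<Sum>d\<in>UNIV. \<Sum>c\<in>UNIV. ((dd N d f p $ c)\<^sup>2 + (dd N d f (bw c p) $ c)\<^sup>2) / 2)"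
  proof (intro sum_mono)
    fix p d c
    have "0 \<le> (dd N d f p $ c - dd N d f (bw c p) $ c)\<^sup>2" by simp
    then show "((dd N d f p $ c + dd N d f (bw c p) $ c) / 2)\<^sup>2 \<le> ((dd N d f p $ c)\<^sup>2 + (dd N d f (bw c p) $ c)\<^sup>2) / 2"
      by (simp add: power2_eq_square field_simps)
  qed
  also have "\<dots> = (\<Sum>d\<in>UNIV. \<Sum>c\<in>UNIV. ((\<Sum>p\<in>?I. (dd N d f p $ c)\<^sup>2) + (\<Sum>p\<in>?I. (dd N d f (bw c p) $ c)\<^sup>2)) / 2)"
    by (subst sum.swap, rule sum.cong[OF refl], subst sum.swap) (simp add: sum.distrib sum_divide_distrib[symmetric])
  also have "\<dots> \<le> (\<Sum>d\<in>UNIV. \<Sum>c\<in>UNIV. 2 * (\<Sum>p\<in>?I. (dd N d f p $ c)\<^sup>2))"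
  proof (intro sum_mono)
    fix d c :: 3
    have "0 \<le> (\<Sum>p\<in>?I. (dd N d f p $ c)\<^sup>2)" by (simp add: sum_nonneg)
    then show "((\<Sum>p\<in>?I. (dd N d f p $ c)\<^sup>2) + (\<Sum>p\<in>?I. (dd N d f (bw c p) $ c)\<^sup>2)) / 2 \<le> 2 * (\<Sum>p\<in>?I. (dd N d f p $ c)\<^sup>2)"
      using 1[where d=d and c=c] by simp
  qed
  also have "\<dots> = 2 * (\<Sum>p\<in>?I. gradsq N f p)"
    unfolding gradsq_dd norm3_eq sum_distrib_left
    by (rule sym, subst sum.swap, rule sum.cong[OF refl], subst sum.swap) simp
  finally have s: "(\<Sum>p\<in>?I. gradsq N (avgA f) p) \<le> 2 * (\<Sum>p\<in>?I. gradsq N f p)" .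
  have "(1 / real N) ^ 3 * (\<Sum>p\<in>?I. gradsq N (avgA f) p) \<le> (1 / real N) ^ 3 * (2 * (\<Sum>p\<in>?I. gradsq N f p))"
    by (intro mult_left_mono s) auto
  then show ?thesis by (simp add: h1sq_def gmean_def)
qed

text \<open>An inverse estimate: the averaged gradient has nine entries, each at most
  \<open>2 * s * real N\<close>, and 36 = 9 * 4.\<close>

lemma gradsq_avgA_sup:
  assumes f: "neumann N f" and N: "N > 0" and s: "\<And>p. p \<in> inner_pts N \<Longrightarrow> norm (f p) \<le> s"
    and p: "p \<in> inner_pts N"
  shows "gradsq N (avgA f) p \<le> 36 * (real N)\<^sup>2 * s\<^sup>2"
proof -
  have a: "norm (f q) \<le> s" if "q \<in> all_pts N" for q
    using neumann_bound_all[OF f N, of "\<lambda>v. norm v \<le> s"] s that by blast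
  have "\<bar>dd N d (avgA f) p $ c\<bar> \<le> real N * (2 * s)" for d c
  proof -
    have 1: "\<bar>f q $ c\<bar> \<le> s" if "q \<in> all_pts N" for q
      using a[OF that] component_le_norm_cart[of "f q" c] by linarith
    have 2: "bw c (fw d p) \<in> all_pts N"
      using p by (cases p) (auto simp: fw_def bw_def inner_pts_def all_pts_def)
    have "\<bar>(f (fw d p) $ c + f (bw c (fw d p)) $ c) / 2 - (f p $ c + f (bw c p) $ c) / 2\<bar> \<le> 2 * s"
      using 1[OF fw_all[OF p, of d]] 1[OF 2] 1[OF inner_all[OF p]] 1[OF bw_all[OF p, of c]]
      unfolding abs_le_iff by (auto simp: field_simps)
    then show ?thesis
      using N by (simp add: dd_def avgA_nth abs_mult)
  qed
  then have "(dd N d (avgA f) p $ c)\<^sup>2 \<le> (real N * (2 * s))\<^sup>2" for d c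
    by (metis power2_abs power_mono abs_ge_zero)
  then have "gradsq N (avgA f) p \<le> (\<Sum>d\<in>(UNIV::3 set). \<Sum>c\<in>(UNIV::3 set). (real N * (2 * s))\<^sup>2)"
    unfolding gradsq_dd norm3_eq by (intro sum_mono)
  then show ?thesis by (simp add: power_mult_distrib)
qed

section \<open>The exchange term in flux form and its energy cost\<close>

text \<open>A vector has zero cross product with itself, so in the flux through the backward face
  the factor \<open>f (bw d p)\<close> may be replaced by \<open>f p\<close>. The divergence form
  permits summation by parts.\<close>

lemma cross_lap_flux:
  assumes p: "p \<in> inner_pts N"
  shows "cross3 (f p) (lap_h N f p)
    = (\<Sum>d\<in>UNIV. real N *\<^sub>R (cross3 (f p) (dd N d f p) - cross3 (f (bw d p)) (dd N d f (bw d p))))"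
proof -
  have "cross3 (f (bw d p)) (dd N d f (bw d p)) = cross3 (f p) (dd N d f (bw d p))" for d
    using p by (simp add: dd_def cross3_simps)
  then show ?thesis
    by (simp only: lap_h_dd[OF p] sum_3 cross_add_right cross_mult_right Cross3.right_diff_distrib)
qed

lemma norm_cross_le: "norm (cross3 x y) \<le> norm x * norm y"
proof -
  have "(norm (cross3 x y))\<^sup>2 \<le> (norm x * norm y)\<^sup>2" by (simp add: norm_cross power_mult_distrib)
  then show ?thesis by (rule power2_le_imp_le) simp
qed

text \<open>The G-stability identity of BDF2. The first four squares telescope in time, and the last
  one is dissipation.\<close>

lemma bdf2_identity:
  fixes a b c :: "'a::real_inner"
  shows "4 * (((3/2) *\<^sub>R a - 2 *\<^sub>R b + (1/2) *\<^sub>R c) \<bullet> a)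
    = (norm a)\<^sup>2 + (norm (2 *\<^sub>R a - b))\<^sup>2 - (norm b)\<^sup>2 - (norm (2 *\<^sub>R b - c))\<^sup>2 + (norm (a - 2 *\<^sub>R b + c))\<^sup>2"
  by (simp add: power2_norm_eq_inner inner_simps inner_commute algebra_simps)

lemma young: assumes "(e::real) > 0" shows "x * y \<le> e * x\<^sup>2 + y\<^sup>2 / (4 * e)"
proof -
  have "0 \<le> (2 * e * x - y)\<^sup>2" by simp
  then have "4 * e * (x * y) \<le> 4 * e * (e * x\<^sup>2) + y\<^sup>2" by (simp add: power2_eq_square algebra_simps)
  then show ?thesis using assms by (simp add: field_simps)
qed

lemma norm_triangle3: "norm (2 *\<^sub>R b - c + w) \<le> 2 * norm b + norm c + norm (w::'a::real_normed_vector)"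
  using norm_triangle_ineq[of "2 *\<^sub>R b - c" w] norm_triangle_ineq4[of "2 *\<^sub>R b" c] by simp

lemma norm_three_sq: "(norm (2 *\<^sub>R b - c + w))\<^sup>2 \<le> 12 * (norm b)\<^sup>2 + 3 * (norm c)\<^sup>2 + 3 * (norm (w::'a::real_inner))\<^sup>2"
proof -
  have "norm (2 *\<^sub>R b - c + w) \<le> 2 * norm b + norm c + norm w"
    by (rule norm_triangle3)
  then have "(norm (2 *\<^sub>R b - c + w))\<^sup>2 \<le> (2 * norm b + norm c + norm w)\<^sup>2"
    by (rule power_mono) simp
  also have "\<dots> \<le> 3 * ((2 * norm b)\<^sup>2 + (norm c)\<^sup>2 + (norm w)\<^sup>2)"
    using sum_squares_ge_zero[of "2 * norm b - norm c" "2 * norm b - norm w"] zero_le_power2[of "norm c - norm w"]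
    by (simp add: power2_eq_square algebra_simps)
  finally show ?thesis by (simp add: power_mult_distrib)
qed

text \<open>The weights 3/2, 1 and 1/2 add up to the threshold 3 for the damping parameter.\<close>
lemma exchange_edge:
  fixes M d DM Da Db Dc Dw b c w :: "real^3"
  assumes e: "0 < \<eta>" "\<eta> \<le> 1" and M: "norm M \<le> 1" and DM: "norm DM \<le> L" and d: "norm d \<le> \<eta>"
    and d_eq: "d = 2 *\<^sub>R b - c + w" and w: "norm w \<le> \<rho>" and Dw: "norm Dw \<le> \<rho>"
  defines "Dd \<equiv> 2 *\<^sub>R Db - Dc + Dw"
  shows "(cross3 (M + d) (DM + Dd) - cross3 M DM) \<bullet> Da
    \<le> (3/2 + 7/2 * \<eta>) * (norm Da)\<^sup>2 + (1 + \<eta>) * (norm Db)\<^sup>2 + (1/2 + \<eta>/2) * (norm Dc)\<^sup>2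
      + (\<rho>\<^sup>2 / \<eta> + L\<^sup>2 / (4 * \<eta>) * (12 * (norm b)\<^sup>2 + 3 * (norm c)\<^sup>2 + 3 * \<rho>\<^sup>2))"
proof -
  have L0: "L \<ge> 0" and r0: "\<rho> \<ge> 0" using DM w norm_ge_zero order_trans by blast+
  \<comment> \<open>Separates the part linear in the undifferentiated error \<open>d\<close>, which
    costs little gradient after Young's inequality, from the part with \<open>Dd\<close>, which
    consumes the damping.\<close>
  have "cross3 (M + d) (DM + Dd) - cross3 M DM = cross3 d DM + cross3 (M + d) Dd"
    by (simp add: cross_add_left cross_add_right)
  then have "(cross3 (M + d) (DM + Dd) - cross3 M DM) \<bullet> Da \<le> norm (cross3 d DM + cross3 (M + d) Dd) * norm Da"
    by (simp add: norm_cauchy_schwarz)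
  also have "\<dots> \<le> (L * norm d + (1 + \<eta>) * norm Dd) * norm Da"
  proof (intro mult_right_mono)
    have "norm (cross3 d DM) \<le> L * norm d"
      using norm_cross_le[of d DM] mult_left_mono[OF DM norm_ge_zero[of d]] by (simp add: mult.commute)
    moreover have "norm (M + d) \<le> 1 + \<eta>" using norm_triangle_ineq[of M d] M d by linarith
    then have "norm (cross3 (M + d) Dd) \<le> (1 + \<eta>) * norm Dd"
      using norm_cross_le[of "M + d" Dd] mult_right_mono[OF _ norm_ge_zero[of Dd]] order_trans by blast
    ultimately show "norm (cross3 d DM + cross3 (M + d) Dd) \<le> L * norm d + (1 + \<eta>) * norm Dd"
      using norm_triangle_ineq[of "cross3 d DM" "cross3 (M + d) Dd"] by linarith
  qed simp
  also have "\<dots> \<le> (L * norm d + (1 + \<eta>) * (2 * norm Db + norm Dc + \<rho>)) * norm Da"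
  proof (intro mult_right_mono add_left_mono mult_left_mono)
    show "norm Dd \<le> 2 * norm Db + norm Dc + \<rho>"
      unfolding Dd_def using Dw norm_triangle3[of Db Dc Dw] by linarith
  qed (use e in auto)
  also have "\<dots> = norm Da * (L * norm d) + (1 + \<eta>) * ((2 * norm Db + norm Dc) * norm Da) + norm Da * ((1 + \<eta>) * \<rho>)"
    by (simp add: algebra_simps)
  also have "norm Da * (L * norm d) \<le> \<eta> * (norm Da)\<^sup>2 + (L * norm d)\<^sup>2 / (4 * \<eta>)" by (rule young) (rule e)
  also have "(L * norm d)\<^sup>2 / (4 * \<eta>) \<le> L\<^sup>2 / (4 * \<eta>) * (12 * (norm b)\<^sup>2 + 3 * (norm c)\<^sup>2 + 3 * \<rho>\<^sup>2)"
  proof -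
    have "(norm w)\<^sup>2 \<le> \<rho>\<^sup>2" using w by (rule power_mono) simp
    then have "(norm d)\<^sup>2 \<le> 12 * (norm b)\<^sup>2 + 3 * (norm c)\<^sup>2 + 3 * \<rho>\<^sup>2"
      unfolding d_eq using norm_three_sq[of b c w] by linarith
    then have "L\<^sup>2 / (4 * \<eta>) * (norm d)\<^sup>2 \<le> L\<^sup>2 / (4 * \<eta>) * (12 * (norm b)\<^sup>2 + 3 * (norm c)\<^sup>2 + 3 * \<rho>\<^sup>2)"
      using e by (intro mult_left_mono) auto
    then show ?thesis by (simp add: power_mult_distrib)
  qed
  also have "norm Da * ((1 + \<eta>) * \<rho>) \<le> \<eta> * (norm Da)\<^sup>2 + ((1 + \<eta>) * \<rho>)\<^sup>2 / (4 * \<eta>)" by (rule young) (rule e)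
  also have "((1 + \<eta>) * \<rho>)\<^sup>2 / (4 * \<eta>) \<le> \<rho>\<^sup>2 / \<eta>"
  proof -
    have "((1 + \<eta>) * \<rho>)\<^sup>2 \<le> (2 * \<rho>)\<^sup>2" using e r0 by (intro power_mono mult_right_mono) auto
    then show ?thesis using e by (simp add: field_simps power_mult_distrib)
  qed
  also have "(1 + \<eta>) * ((2 * norm Db + norm Dc) * norm Da)
     \<le> (1 + \<eta>) * (3/2 * (norm Da)\<^sup>2 + (norm Db)\<^sup>2 + 1/2 * (norm Dc)\<^sup>2)"
  proof (intro mult_left_mono)
    \<comment> \<open>\<open>2 * norm Db * norm Da\<close> costs one unit of each square and
      \<open>norm Dc * norm Da\<close> half a unit of each, so the square of \<open>norm Da\<close>
      collects 3/2.\<close>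
    show "(2 * norm Db + norm Dc) * norm Da \<le> 3/2 * (norm Da)\<^sup>2 + (norm Db)\<^sup>2 + 1/2 * (norm Dc)\<^sup>2"
      using zero_le_power2[of "norm Da - norm Db"] zero_le_power2[of "norm Da - norm Dc"]
      by (simp add: power2_eq_square algebra_simps)
  qed (use e in auto)
  finally show ?thesis by (simp add: algebra_simps add_divide_distrib)
qed

section \<open>Energy estimate for one step\<close>

lemma mult_le_squares: "(x::real) * y \<le> x\<^sup>2 + y\<^sup>2"
  using zero_le_power2[of "x + y"] zero_le_power2[of "x - y"] sum_power2_ge_zero[of x y]
  by (simp add: power2_eq_square algebra_simps)

text \<open>The difference splits into the change of the squared gradient, multiplied by the bounded
  vector \<open>M + d\<close>, and the old squared gradient times \<open>d\<close>. The genuinely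
  quadratic part is left to the hypothesis \<open>Q\<close>: \<theta> = 0 is possible once
  \<open>a\<close> is small, while \<theta> > 0 trades that smallness for a bound on
  \<open>Y\<close>.\<close>

lemma gradient_term:
  fixes M d a :: "real^3" and X Y :: "3 \<Rightarrow> real^3"
  assumes e: "0 < \<eta>" and M: "norm M \<le> 1" and d: "norm d \<le> 1" and X: "\<And>e. norm (X e) \<le> L"
    and Q: "2 * norm a * (\<Sum>e\<in>UNIV. (norm (Y e))\<^sup>2) \<le> \<eta> * (\<Sum>e\<in>UNIV. (norm (Y e))\<^sup>2) + \<theta> * (norm a)\<^sup>2"
  shows "((\<Sum>e\<in>UNIV. (norm (X e + Y e))\<^sup>2) *\<^sub>R (M + d) - (\<Sum>e\<in>UNIV. (norm (X e))\<^sup>2) *\<^sub>R M) \<bullet> a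
     \<le> 2 * \<eta> * (\<Sum>e\<in>UNIV. (norm (Y e))\<^sup>2) + (\<theta> + 12 * L\<^sup>2 / \<eta> + 3 * L\<^sup>2) * (norm a)\<^sup>2 + 3 * L\<^sup>2 * (norm d)\<^sup>2"
proof -
  define gX where "gX = (\<Sum>e\<in>UNIV. (norm (X e))\<^sup>2)"
  define gY where "gY = (\<Sum>e\<in>UNIV. (norm (Y e))\<^sup>2)"
  define gS where "gS = (\<Sum>e\<in>UNIV. (norm (X e + Y e))\<^sup>2)"
  have L0: "L \<ge> 0" using X[of 1] norm_ge_zero order_trans by blast
  have 1: "\<bar>(norm (X e + Y e))\<^sup>2 - (norm (X e))\<^sup>2\<bar> \<le> 2 * L * norm (Y e) + (norm (Y e))\<^sup>2" for e
  proof -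
    have "(norm (X e + Y e))\<^sup>2 - (norm (X e))\<^sup>2 = 2 * (X e \<bullet> Y e) + (norm (Y e))\<^sup>2"
      by (simp add: power2_norm_eq_inner inner_add_left inner_add_right inner_commute[of "Y e" "X e"])
    moreover have "\<bar>X e \<bullet> Y e\<bar> \<le> L * norm (Y e)"
      using Cauchy_Schwarz_ineq2[of "X e" "Y e"] mult_right_mono[OF X[of e] norm_ge_zero[of "Y e"]] by linarith
    ultimately show ?thesis using zero_le_power2[of "norm (Y e)"] by linarith
  qed
  have gSX: "gS - gX = (\<Sum>e\<in>UNIV. (norm (X e + Y e))\<^sup>2 - (norm (X e))\<^sup>2)"
    by (simp add: gS_def gX_def sum_subtractf)
  have "\<bar>gS - gX\<bar> \<le> (\<Sum>e\<in>UNIV. 2 * L * norm (Y e) + (norm (Y e))\<^sup>2)"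
    unfolding gSX by (rule order_trans[OF sum_abs]) (intro sum_mono 1)
  then have 2: "\<bar>gS - gX\<bar> \<le> 2 * L * (\<Sum>e\<in>UNIV. norm (Y e)) + gY"
    by (simp add: gY_def sum.distrib sum_distrib_left)
  have Md: "\<bar>(M + d) \<bullet> a\<bar> \<le> 2 * norm a"
    using Cauchy_Schwarz_ineq2[of "M + d" a] mult_right_mono[of "norm (M + d)" 2 "norm a"] norm_triangle_ineq[of M d] M d by auto
  have gX0: "0 \<le> gX" "gX \<le> 3 * L\<^sup>2"
  proof -
    show "0 \<le> gX" by (simp add: gX_def sum_nonneg)
    have "gX \<le> (\<Sum>e\<in>(UNIV::3 set). L\<^sup>2)" unfolding gX_def by (intro sum_mono power_mono X) auto
    then show "gX \<le> 3 * L\<^sup>2" by simp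
  qed
  have "(gS *\<^sub>R (M + d) - gX *\<^sub>R M) \<bullet> a = (gS - gX) * ((M + d) \<bullet> a) + gX * (d \<bullet> a)"
    by (simp add: algebra_simps inner_simps)
  also have "(gS - gX) * ((M + d) \<bullet> a) \<le> \<bar>gS - gX\<bar> * \<bar>(M + d) \<bullet> a\<bar>" by (metis abs_ge_self abs_mult)
  also have "\<dots> \<le> (2 * L * (\<Sum>e\<in>UNIV. norm (Y e)) + gY) * (2 * norm a)"
    by (intro mult_mono 2 Md) (use 2 in linarith, simp)
  also have "\<dots> = (\<Sum>e\<in>UNIV. norm (Y e) * (4 * L * norm a)) + 2 * norm a * gY"
    by (simp add: algebra_simps sum_distrib_left)
  also have "(\<Sum>e\<in>UNIV. norm (Y e) * (4 * L * norm a)) \<le> (\<Sum>e\<in>(UNIV::3 set). \<eta> * (norm (Y e))\<^sup>2 + (4 * L * norm a)\<^sup>2 / (4 * \<eta>))"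
    by (intro sum_mono young e)
  also have "\<dots> = \<eta> * gY + 12 * L\<^sup>2 / \<eta> * (norm a)\<^sup>2"
    using e by (simp add: sum.distrib gY_def power_mult_distrib flip: sum_distrib_left)
  also have "gX * (d \<bullet> a) \<le> 3 * L\<^sup>2 * (norm d)\<^sup>2 + 3 * L\<^sup>2 * (norm a)\<^sup>2"
  proof -
    have "d \<bullet> a \<le> (norm d)\<^sup>2 + (norm a)\<^sup>2"
      using norm_cauchy_schwarz[of d a] mult_le_squares[of "norm d" "norm a"] by linarith
    then have "gX * (d \<bullet> a) \<le> gX * ((norm d)\<^sup>2 + (norm a)\<^sup>2)" using gX0 by (intro mult_left_mono)
    also have "\<dots> \<le> 3 * L\<^sup>2 * ((norm d)\<^sup>2 + (norm a)\<^sup>2)" using gX0 by (intro mult_right_mono) auto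
    finally show ?thesis by (simp add: algebra_simps)
  qed
  finally show ?thesis using Q unfolding gX_def[symmetric] gY_def[symmetric] gS_def[symmetric]
    by (simp add: algebra_simps)
qed

text \<open>\<open>F\<close> is the flux defect inside the cross product with \<open>M\<close>. Once
  the difference has been moved onto the product of \<open>a\<close> and \<open>M\<close>, the
  product rule produces the two cross terms; \<open>H\<close> is tested with the difference of
  \<open>a\<close> directly.\<close>

lemma flux_terms:
  fixes F H a Da M' DM :: "real^3"
  assumes e: "0 < \<eta>" and F: "norm F \<le> \<rho>" and H: "norm H \<le> \<rho>" and M': "norm M' \<le> 1" and DM: "norm DM \<le> L"
  shows "F \<bullet> (cross3 Da M' + cross3 a DM) - H \<bullet> Da
     \<le> 2 * \<eta> * (norm Da)\<^sup>2 + L * (norm a)\<^sup>2 + (1 / (2 * \<eta>) + L) * \<rho>\<^sup>2"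
proof -
  have r: "\<rho> \<ge> 0" and L: "L \<ge> 0" using F DM norm_ge_zero order_trans by blast+
  have "F \<bullet> (cross3 Da M' + cross3 a DM) \<le> norm F * norm (cross3 Da M' + cross3 a DM)"
    by (rule norm_cauchy_schwarz)
  also have "\<dots> \<le> \<rho> * (norm Da + L * norm a)"
  proof (intro mult_mono F)
    have "norm (cross3 Da M') \<le> norm Da"
      using norm_cross_le[of Da M'] mult_left_mono[OF M' norm_ge_zero[of Da]] by simp
    moreover have "norm (cross3 a DM) \<le> L * norm a"
      using norm_cross_le[of a DM] mult_left_mono[OF DM norm_ge_zero[of a]] by (simp add: mult.commute)
    ultimately show "norm (cross3 Da M' + cross3 a DM) \<le> norm Da + L * norm a"
      using norm_triangle_ineq[of "cross3 Da M'" "cross3 a DM"] by linarith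
  qed (use r in auto)
  finally have 1: "F \<bullet> (cross3 Da M' + cross3 a DM) \<le> norm Da * \<rho> + L * (\<rho> * norm a)" by (simp add: algebra_simps)
  have "- (H \<bullet> Da) \<le> norm H * norm Da" using norm_cauchy_schwarz[of "-H" Da] by simp
  also have "\<dots> \<le> norm Da * \<rho>" using mult_right_mono[OF H norm_ge_zero[of Da]] by (simp add: mult.commute)
  finally have 2: "- (H \<bullet> Da) \<le> norm Da * \<rho>" .
  have 3: "norm Da * \<rho> \<le> \<eta> * (norm Da)\<^sup>2 + \<rho>\<^sup>2 / (4 * \<eta>)" by (rule young[OF e])
  have "\<rho> * norm a \<le> \<rho>\<^sup>2 + (norm a)\<^sup>2"
    by (rule mult_le_squares)
  then have 4: "L * (\<rho> * norm a) \<le> L * (\<rho>\<^sup>2 + (norm a)\<^sup>2)" by (rule mult_left_mono[OF _ L])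
  have "F \<bullet> (cross3 Da M' + cross3 a DM) - H \<bullet> Da \<le> 2 * (\<eta> * (norm Da)\<^sup>2 + \<rho>\<^sup>2 / (4 * \<eta>)) + L * (\<rho>\<^sup>2 + (norm a)\<^sup>2)"
    using 1 2 4 add_mono[OF 3 3]
    by (simp add: mult.commute[of \<rho>])
  also have "\<dots> = 2 * \<eta> * (norm Da)\<^sup>2 + L * (norm a)\<^sup>2 + (1 / (2 * \<eta>) + L) * \<rho>\<^sup>2"
    by (simp add: algebra_simps)
  finally show ?thesis .
qed

lemma h1sq_three:
  assumes N: "N > 0" and w: "\<And>p e. p \<in> inner_pts N \<Longrightarrow> norm (dd N e w p) \<le> \<rho>"
  shows "h1sq N (\<lambda>p. 2 *\<^sub>R b p - c p + w p) \<le> 12 * h1sq N b + 3 * h1sq N c + 9 * \<rho>\<^sup>2"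
proof -
  have "h1sq N (\<lambda>p. 2 *\<^sub>R b p - c p + w p) \<le> gmean N (\<lambda>p. 12 * gradsq N b p + 3 * gradsq N c p + 9 * \<rho>\<^sup>2)"
    unfolding h1sq_def
  proof (rule gmean_mono)
    fix p assume p: "p \<in> inner_pts N"
    have "(norm (dd N e (\<lambda>p. 2 *\<^sub>R b p - c p + w p) p))\<^sup>2
       \<le> 12 * (norm (dd N e b p))\<^sup>2 + 3 * (norm (dd N e c p))\<^sup>2 + 3 * \<rho>\<^sup>2" for e
    proof -
      have "dd N e (\<lambda>p. 2 *\<^sub>R b p - c p + w p) p = 2 *\<^sub>R dd N e b p - dd N e c p + dd N e w p"
        by (simp only: dd_linear)
      moreover have "(norm (dd N e w p))\<^sup>2 \<le> \<rho>\<^sup>2" using w[OF p] by (rule power_mono) simp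
      ultimately show ?thesis using norm_three_sq[of "dd N e b p" "dd N e c p" "dd N e w p"] by simp
    qed
    from this[of 1] this[of 2] this[of 3]
    show "gradsq N (\<lambda>p. 2 *\<^sub>R b p - c p + w p) p \<le> 12 * gradsq N b p + 3 * gradsq N c p + 9 * \<rho>\<^sup>2"
      unfolding gradsq_dd sum_3 by simp
  qed
  also have "\<dots> = 12 * h1sq N b + 3 * h1sq N c + 9 * \<rho>\<^sup>2"
    using N by (simp add: gmean_add gmean_cmult gmean_const h1sq_def)
  finally show ?thesis .
qed

text \<open>A deliberately generous constant dominating the three coefficient sums of
  \<open>energy_const_bounds\<close>; for fixed \<eta> it does not depend on the mesh.\<close>

definition energy_const :: "real \<Rightarrow> real \<Rightarrow> real \<Rightarrow> real" where
  "energy_const \<alpha> L \<eta> = 100 * (1 + \<alpha>) * (1 + L)\<^sup>2 / \<eta>"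

lemma energy_const_bounds:
  assumes "\<alpha> \<ge> 0" "L \<ge> 0" "0 < \<eta>" "\<eta> \<le> 1"
  shows "\<alpha> * (12 * L\<^sup>2 / \<eta> + 3 * L\<^sup>2) + 3 * L + 1 \<le> energy_const \<alpha> L \<eta>"
    "9 * L\<^sup>2 / \<eta> + 36 * \<alpha> * L\<^sup>2 \<le> energy_const \<alpha> L \<eta>"
    "3 / \<eta> + 9 * L\<^sup>2 / (4 * \<eta>) + 9 * \<alpha> * L\<^sup>2 + 36 * \<alpha> * \<eta> + 3 * (1 / (2 * \<eta>) + L) + 1 \<le> energy_const \<alpha> L \<eta>"
proof -
  define u where "u = 1 / \<eta>"
  have u: "u \<ge> 1" using assms by (simp add: u_def)
  \<comment> \<open>Every summand of the three sums is a number times a product bounded by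
    \<open>q\<close>; these numbers add up to 19, 45 and 55.75, all below 100.\<close>
  define q where "q = (1 + \<alpha>) * (1 + L)\<^sup>2 * u"
  have C: "energy_const \<alpha> L \<eta> = 100 * q" by (simp add: energy_const_def q_def u_def)
  have m: "x \<le> q" if "x = y * z * v" "0 \<le> y" "y \<le> 1 + \<alpha>" "0 \<le> z" "z \<le> (1 + L)\<^sup>2" "0 \<le> v" "v \<le> u" for x y z v
    unfolding q_def that(1) using that assms by (intro mult_mono) auto
  have L2: "L\<^sup>2 \<le> (1 + L)\<^sup>2" "L \<le> (1 + L)\<^sup>2" "1 \<le> (1 + L)\<^sup>2" using assms by (simp_all add: power2_eq_square algebra_simps)
  have 1: "\<alpha> * L\<^sup>2 * u \<le> q" "\<alpha> * L\<^sup>2 \<le> q" "L \<le> q" "1 \<le> q" "L\<^sup>2 * u \<le> q" "u \<le> q" "\<alpha> * \<eta> \<le> q"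
    using m[of _ \<alpha> "L\<^sup>2" u] m[of _ \<alpha> "L\<^sup>2" 1] m[of _ 1 L 1] m[of _ 1 1 1] m[of _ 1 "L\<^sup>2" u] m[of _ 1 1 u] m[of _ \<alpha> 1 \<eta>]
      assms u L2 by auto
  show "\<alpha> * (12 * L\<^sup>2 / \<eta> + 3 * L\<^sup>2) + 3 * L + 1 \<le> energy_const \<alpha> L \<eta>"
  proof -
    have "\<alpha> * (12 * L\<^sup>2 / \<eta> + 3 * L\<^sup>2) + 3 * L + 1 = 12 * (\<alpha> * L\<^sup>2 * u) + 3 * (\<alpha> * L\<^sup>2) + 3 * L + 1"
      by (simp add: u_def algebra_simps)
    then show ?thesis using 1 C by linarith
  qed
  show "9 * L\<^sup>2 / \<eta> + 36 * \<alpha> * L\<^sup>2 \<le> energy_const \<alpha> L \<eta>"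
  proof -
    have "9 * L\<^sup>2 / \<eta> + 36 * \<alpha> * L\<^sup>2 = 9 * (L\<^sup>2 * u) + 36 * (\<alpha> * L\<^sup>2)" by (simp add: u_def)
    then show ?thesis using 1 C by linarith
  qed
  show "3 / \<eta> + 9 * L\<^sup>2 / (4 * \<eta>) + 9 * \<alpha> * L\<^sup>2 + 36 * \<alpha> * \<eta> + 3 * (1 / (2 * \<eta>) + L) + 1 \<le> energy_const \<alpha> L \<eta>"
  proof -
    have "3 / \<eta> + 9 * L\<^sup>2 / (4 * \<eta>) + 9 * \<alpha> * L\<^sup>2 + 36 * \<alpha> * \<eta> + 3 * (1 / (2 * \<eta>) + L) + 1
      = 3 * u + 9/4 * (L\<^sup>2 * u) + 9 * (\<alpha> * L\<^sup>2) + 36 * (\<alpha> * \<eta>) + 3/2 * u + 3 * L + 1" by (simp add: u_def)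
    then show ?thesis using 1 C by linarith
  qed
qed

text \<open>Here \<open>a\<close> is the new error, \<open>b\<close> and \<open>c\<close> are the
  old ones, \<open>w\<close> is the extrapolation error of the exact solution and \<open>d\<close>
  the error of the extrapolated value. Defects that are O(h^2) only before differencing are kept as
  fluxes \<open>F\<close> and \<open>H\<close>, so that summation by parts puts the difference on
  \<open>a\<close>; \<open>r\<close> is small pointwise. \<open>Q\<close> is the hypothesis of
  \<open>gradient_term\<close>, with \<theta> left open to serve both the crude and the sharp
  step.\<close>

lemma energy_step:
  fixes a b c M w r :: grid and F H :: "3 \<Rightarrow> grid"
  assumes N: "N > 0" and k: "k > 0" and al: "\<alpha> > 0" and e: "0 < \<eta>" "\<eta> \<le> 1" and L0: "L \<ge> 0"
    and neumann: "neumann N a" "neumann N b" "neumann N c" "neumann N M" "neumann N w"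
    and Fz: "\<And>d p. p \<in> all_pts N \<Longrightarrow> coord d p = 0 \<or> coord d p = N \<Longrightarrow> F d p = 0 \<and> H d p = 0"
    and F: "\<And>d p. p \<in> inner_pts N \<Longrightarrow> norm (F d p) \<le> \<rho>" and H: "\<And>d p. p \<in> inner_pts N \<Longrightarrow> norm (H d p) \<le> \<rho>"
    and r: "\<And>p. p \<in> inner_pts N \<Longrightarrow> norm (r p) \<le> \<rho>"
    and w: "\<And>p. p \<in> inner_pts N \<Longrightarrow> norm (w p) \<le> \<rho>" and Dw: "\<And>d p. p \<in> inner_pts N \<Longrightarrow> norm (dd N d w p) \<le> \<rho>"
    and M: "\<And>p. p \<in> inner_pts N \<Longrightarrow> norm (M p) \<le> 1" and DM: "\<And>d p. p \<in> inner_pts N \<Longrightarrow> norm (dd N d M p) \<le> L"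
    and AM: "\<And>d p. p \<in> inner_pts N \<Longrightarrow> norm (dd N d (avgA M) p) \<le> L"
  defines "d \<equiv> (\<lambda>p. 2 *\<^sub>R b p - c p + w p)"
  assumes d: "\<And>p. p \<in> inner_pts N \<Longrightarrow> norm (d p) \<le> \<eta>"
    and Q: "\<And>p. p \<in> inner_pts N \<Longrightarrow> 2 * norm (a p) * gradsq N (avgA d) p \<le> \<eta> * gradsq N (avgA d) p + \<theta> * (norm (a p))\<^sup>2"
    and eq: "\<And>p. p \<in> inner_pts N \<Longrightarrow> (3/2) *\<^sub>R a p - 2 *\<^sub>R b p + (1/2) *\<^sub>R c p = k *\<^sub>R
      ( - (cross3 (M p + d p) (lap_h N (\<lambda>p. M p + d p) p) - cross3 (M p) (lap_h N M p)) + \<alpha> *\<^sub>R lap_h N a p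
        + \<alpha> *\<^sub>R (gradsq N (avgA (\<lambda>p. M p + d p)) p *\<^sub>R (M p + d p) - gradsq N (avgA M) p *\<^sub>R M p)
        - cross3 (M p) (\<Sum>d\<in>UNIV. real N *\<^sub>R (F d p - F d (bw d p)))
        + (\<Sum>d\<in>UNIV. real N *\<^sub>R (H d p - H d (bw d p))) + r p)"
  shows "l2sq N a + l2sq N (\<lambda>p. 2 *\<^sub>R a p - b p) \<le> l2sq N b + l2sq N (\<lambda>p. 2 *\<^sub>R b p - c p)
    + 4 * k * ((3/2 + 6 * \<eta> - \<alpha>) * h1sq N a + (1 + (1 + 48 * \<alpha>) * \<eta>) * h1sq N b + (1/2 + (1 + 12 * \<alpha>) * \<eta>) * h1sq N c
        + energy_const \<alpha> L \<eta> * (l2sq N a + l2sq N b + l2sq N c + \<rho>\<^sup>2) + \<alpha> * \<theta> * l2sq N a)"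
proof -
  let ?I = "inner_pts N"
  have nd: "neumann N d" unfolding d_def using neumann by (simp add: neumann_def)
  define m where "m = (\<lambda>p. M p + d p)"
  have nm: "neumann N m" unfolding m_def using neumann nd by (simp add: neumann_def)
  define J where "J e p = cross3 (m p) (dd N e m p) - cross3 (M p) (dd N e M p)" for e p
  \<comment> \<open>One flux for the exchange error, the diffusion and \<open>H\<close>; each part
    vanishes on the walls, as \<open>s1\<close> requires.\<close>
  define P where "P e p = - J e p + \<alpha> *\<^sub>R dd N e a p + H e p" for e p
  define aM where "aM p = cross3 (a p) (M p)" for p
  define T where "T p = gradsq N (avgA m) p *\<^sub>R (M p + d p) - gradsq N (avgA M) p *\<^sub>R M p" for p
  define dF where "dF p = (\<Sum>d\<in>UNIV. real N *\<^sub>R (F d p - F d (bw d p)))" for p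
  define dP where "dP p = (\<Sum>d\<in>UNIV. real N *\<^sub>R (P d p - P d (bw d p)))" for p
  have eq': "(3/2) *\<^sub>R a p - 2 *\<^sub>R b p + (1/2) *\<^sub>R c p = k *\<^sub>R (dP p - cross3 (M p) (dF p) + \<alpha> *\<^sub>R T p + r p)"
    if p: "p \<in> ?I" for p
  proof -
    have 1: "- (cross3 (m p) (lap_h N m p) - cross3 (M p) (lap_h N M p)) + \<alpha> *\<^sub>R lap_h N a p
      + (\<Sum>d\<in>UNIV. real N *\<^sub>R (H d p - H d (bw d p))) = dP p"
      unfolding cross_lap_flux[OF p] unfolding lap_h_dd[OF p] dP_def P_def J_def sum_3 by (simp add: algebra_simps)
    show ?thesis
      unfolding eq[OF p] m_def[symmetric] T_def dF_def[symmetric] 1[symmetric] by (simp add: m_def algebra_simps)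
  qed
  have s1: "gmean N (\<lambda>p. dP p \<bullet> a p) = - gmean N (\<lambda>p. \<Sum>d\<in>UNIV. P d p \<bullet> dd N d a p)"
    unfolding dP_def
    by (rule summation_by_parts) (use Fz in \<open>auto simp: P_def J_def dd_wall[OF nm] dd_wall[OF neumann(1)] dd_wall[OF neumann(4)]\<close>)
  have s2: "gmean N (\<lambda>p. dF p \<bullet> aM p) = - gmean N (\<lambda>p. \<Sum>d\<in>UNIV. F d p \<bullet> dd N d aM p)"
    unfolding dF_def by (rule summation_by_parts) (use Fz in auto)
  define Z where "Z p = (\<Sum>d\<in>UNIV. F d p \<bullet> dd N d aM p - P d p \<bullet> dd N d a p) + \<alpha> * (T p \<bullet> a p) + r p \<bullet> a p" for p
  \<comment> \<open>The scalar triple product moves the cross product from the divergence to the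
    test function, so that \<open>F\<close> can be summed by parts.\<close>
  have trip: "cross3 (M p) (dF p) \<bullet> a p = dF p \<bullet> aM p" for p
    unfolding aM_def by (simp add: cross3_def inner_vec_def sum_3 vector_3 algebra_simps)
  have "gmean N (\<lambda>p. ((3/2) *\<^sub>R a p - 2 *\<^sub>R b p + (1/2) *\<^sub>R c p) \<bullet> a p)
     = gmean N (\<lambda>p. k * (dP p \<bullet> a p - dF p \<bullet> aM p + \<alpha> * (T p \<bullet> a p) + r p \<bullet> a p))"
    by (rule gmean_cong) (simp add: eq' inner_add_left inner_diff_left trip)
  also have "\<dots> = k * gmean N Z"
    unfolding gmean_cmult Z_def
    by (simp add: gmean_add gmean_diff s1 s2 sum_subtractf)
  finally have E: "gmean N (\<lambda>p. ((3/2) *\<^sub>R a p - 2 *\<^sub>R b p + (1/2) *\<^sub>R c p) \<bullet> a p) = k * gmean N Z" .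
  have "l2sq N a + l2sq N (\<lambda>p. 2 *\<^sub>R a p - b p) - l2sq N b - l2sq N (\<lambda>p. 2 *\<^sub>R b p - c p)
    = gmean N (\<lambda>p. (norm (a p))\<^sup>2 + (norm (2 *\<^sub>R a p - b p))\<^sup>2 - (norm (b p))\<^sup>2 - (norm (2 *\<^sub>R b p - c p))\<^sup>2)"
    by (simp add: l2sq_def gmean_add gmean_diff)
  \<comment> \<open>The dissipation square of \<open>bdf2_identity\<close> is dropped here.\<close>
  also have "\<dots> \<le> gmean N (\<lambda>p. 4 * (((3/2) *\<^sub>R a p - 2 *\<^sub>R b p + (1/2) *\<^sub>R c p) \<bullet> a p))"
    unfolding bdf2_identity by (rule gmean_mono) simp
  also have "\<dots> = 4 * k * gmean N Z" by (simp add: gmean_cmult E)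
  finally have en: "l2sq N a + l2sq N (\<lambda>p. 2 *\<^sub>R a p - b p) - l2sq N b - l2sq N (\<lambda>p. 2 *\<^sub>R b p - c p) \<le> 4 * k * gmean N Z" .
  let ?K1 = "\<rho>\<^sup>2 / \<eta>" and ?K2 = "L\<^sup>2 / (4 * \<eta>)"
  define Y where "Y p = (3/2 + 11/2 * \<eta> - \<alpha>) * gradsq N a p + (1 + \<eta>) * gradsq N b p + (1/2 + \<eta>/2) * gradsq N c p
     + 2 * \<alpha> * \<eta> * gradsq N (avgA d) p
     + (\<alpha> * \<theta> + \<alpha> * (12 * L\<^sup>2 / \<eta> + 3 * L\<^sup>2) + 3 * L + 1) * (norm (a p))\<^sup>2
     + (9 * L\<^sup>2 / \<eta> + 36 * \<alpha> * L\<^sup>2) * (norm (b p))\<^sup>2 + (9 * L\<^sup>2 / (4 * \<eta>) + 9 * \<alpha> * L\<^sup>2) * (norm (c p))\<^sup>2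
     + (3 / \<eta> + 9 * L\<^sup>2 / (4 * \<eta>) + 9 * \<alpha> * L\<^sup>2 + 3 * (1 / (2 * \<eta>) + L) + 1) * \<rho>\<^sup>2" for p
  have ZY: "Z p \<le> Y p" if p: "p \<in> ?I" for p
  proof -
    have M': "norm (M q) \<le> 1" if "q \<in> all_pts N" for q
      using neumann_bound_all[OF neumann(4) N, of "\<lambda>v. norm v \<le> 1"] M that by blast
    have dir: "F e p \<bullet> dd N e aM p - P e p \<bullet> dd N e a p
       \<le> (3/2 + 11/2 * \<eta> - \<alpha>) * (norm (dd N e a p))\<^sup>2 + (1 + \<eta>) * (norm (dd N e b p))\<^sup>2 + (1/2 + \<eta>/2) * (norm (dd N e c p))\<^sup>2
         + (\<rho>\<^sup>2 / \<eta> + L\<^sup>2 / (4 * \<eta>) * (12 * (norm (b p))\<^sup>2 + 3 * (norm (c p))\<^sup>2 + 3 * \<rho>\<^sup>2))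
         + L * (norm (a p))\<^sup>2 + (1 / (2 * \<eta>) + L) * \<rho>\<^sup>2" for e
    proof -
      have Dm: "dd N e m p = dd N e M p + (2 *\<^sub>R dd N e b p - dd N e c p + dd N e w p)"
        unfolding m_def d_def by (simp only: dd_linear)
      have Da: "dd N e aM p = cross3 (dd N e a p) (M (fw e p)) + cross3 (a p) (dd N e M p)"
        unfolding aM_def dd_def by (simp add: cross3_simps)
      have "J e p \<bullet> dd N e a p \<le> (3/2 + 7/2 * \<eta>) * (norm (dd N e a p))\<^sup>2 + (1 + \<eta>) * (norm (dd N e b p))\<^sup>2 + (1/2 + \<eta>/2) * (norm (dd N e c p))\<^sup>2
         + (\<rho>\<^sup>2 / \<eta> + L\<^sup>2 / (4 * \<eta>) * (12 * (norm (b p))\<^sup>2 + 3 * (norm (c p))\<^sup>2 + 3 * \<rho>\<^sup>2))"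
        unfolding J_def Dm unfolding m_def
        by (rule exchange_edge[OF e M[OF p] DM[OF p] d[OF p] _ w[OF p] Dw[OF p]]) (simp add: d_def)
      moreover have "F e p \<bullet> dd N e aM p - H e p \<bullet> dd N e a p
         \<le> 2 * \<eta> * (norm (dd N e a p))\<^sup>2 + L * (norm (a p))\<^sup>2 + (1 / (2 * \<eta>) + L) * \<rho>\<^sup>2"
        unfolding Da by (rule flux_terms[OF e(1) F[OF p] H[OF p] M'[OF fw_all[OF p]] DM[OF p]])
      moreover have "P e p \<bullet> dd N e a p = - (J e p \<bullet> dd N e a p) + \<alpha> * (norm (dd N e a p))\<^sup>2 + H e p \<bullet> dd N e a p"
        by (simp add: P_def inner_add_left power2_norm_eq_inner inner_diff_left)
      ultimately show ?thesis by (simp add: algebra_simps)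
    qed
    have d2: "(norm (d p))\<^sup>2 \<le> 12 * (norm (b p))\<^sup>2 + 3 * (norm (c p))\<^sup>2 + 3 * \<rho>\<^sup>2"
    proof -
      have "(norm (w p))\<^sup>2 \<le> \<rho>\<^sup>2" using w[OF p] by (rule power_mono) simp
      then show ?thesis unfolding d_def using norm_three_sq[of "b p" "c p" "w p"] by linarith
    qed
    have "T p \<bullet> a p \<le> 2 * \<eta> * gradsq N (avgA d) p + (\<theta> + 12 * L\<^sup>2 / \<eta> + 3 * L\<^sup>2) * (norm (a p))\<^sup>2 + 3 * L\<^sup>2 * (norm (d p))\<^sup>2"
    proof -
      have s: "dd N e (avgA m) p = dd N e (avgA M) p + dd N e (avgA d) p" for e
        unfolding m_def avgA_add by (rule dd_linear)
      show ?thesis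
        unfolding T_def gradsq_dd s
        by (rule gradient_term[OF e(1) M[OF p] _ AM[OF p]]) (use d[OF p] e Q[OF p] in \<open>auto simp: gradsq_dd\<close>)
    qed
    also have "3 * L\<^sup>2 * (norm (d p))\<^sup>2 \<le> 3 * L\<^sup>2 * (12 * (norm (b p))\<^sup>2 + 3 * (norm (c p))\<^sup>2 + 3 * \<rho>\<^sup>2)"
      using d2 by (intro mult_left_mono) auto
    finally have T: "\<alpha> * (T p \<bullet> a p) \<le> \<alpha> * (2 * \<eta> * gradsq N (avgA d) p + (\<theta> + 12 * L\<^sup>2 / \<eta> + 3 * L\<^sup>2) * (norm (a p))\<^sup>2
        + 3 * L\<^sup>2 * (12 * (norm (b p))\<^sup>2 + 3 * (norm (c p))\<^sup>2 + 3 * \<rho>\<^sup>2))"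
      using al by (intro mult_left_mono) auto
    have R: "r p \<bullet> a p \<le> \<rho>\<^sup>2 + (norm (a p))\<^sup>2"
    proof -
      have "r p \<bullet> a p \<le> norm (r p) * norm (a p)" by (rule norm_cauchy_schwarz)
      also have "\<dots> \<le> (norm (r p))\<^sup>2 + (norm (a p))\<^sup>2"
        by (rule mult_le_squares)
      also have "(norm (r p))\<^sup>2 \<le> \<rho>\<^sup>2" using r[OF p] by (rule power_mono) simp
      finally show ?thesis by simp
    qed
    have "Z p \<le> (\<Sum>e\<in>UNIV. (3/2 + 11/2 * \<eta> - \<alpha>) * (norm (dd N e a p))\<^sup>2 + (1 + \<eta>) * (norm (dd N e b p))\<^sup>2 + (1/2 + \<eta>/2) * (norm (dd N e c p))\<^sup>2
         + (\<rho>\<^sup>2 / \<eta> + L\<^sup>2 / (4 * \<eta>) * (12 * (norm (b p))\<^sup>2 + 3 * (norm (c p))\<^sup>2 + 3 * \<rho>\<^sup>2))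
         + L * (norm (a p))\<^sup>2 + (1 / (2 * \<eta>) + L) * \<rho>\<^sup>2)
       + \<alpha> * (2 * \<eta> * gradsq N (avgA d) p + (\<theta> + 12 * L\<^sup>2 / \<eta> + 3 * L\<^sup>2) * (norm (a p))\<^sup>2
        + 3 * L\<^sup>2 * (12 * (norm (b p))\<^sup>2 + 3 * (norm (c p))\<^sup>2 + 3 * \<rho>\<^sup>2)) + (\<rho>\<^sup>2 + (norm (a p))\<^sup>2)"
      unfolding Z_def by (intro add_mono sum_mono dir T R)
    also have "\<dots> = Y p"
      unfolding Y_def gradsq_dd[of N a] gradsq_dd[of N b] gradsq_dd[of N c] sum.distrib sum_distrib_left[symmetric]
      using e by (simp add: field_simps)
    finally show ?thesis .
  qed
  have "gmean N Z \<le> gmean N Y" by (rule gmean_mono) (rule ZY)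
  also have "gmean N Y = (3/2 + 11/2 * \<eta> - \<alpha>) * h1sq N a + (1 + \<eta>) * h1sq N b + (1/2 + \<eta>/2) * h1sq N c
     + 2 * \<alpha> * \<eta> * gmean N (gradsq N (avgA d))
     + (\<alpha> * \<theta> + \<alpha> * (12 * L\<^sup>2 / \<eta> + 3 * L\<^sup>2) + 3 * L + 1) * l2sq N a
     + (9 * L\<^sup>2 / \<eta> + 36 * \<alpha> * L\<^sup>2) * l2sq N b + (9 * L\<^sup>2 / (4 * \<eta>) + 9 * \<alpha> * L\<^sup>2) * l2sq N c
     + (3 / \<eta> + 9 * L\<^sup>2 / (4 * \<eta>) + 9 * \<alpha> * L\<^sup>2 + 3 * (1 / (2 * \<eta>) + L) + 1) * \<rho>\<^sup>2"
    unfolding Y_def gmean_add gmean_cmult gmean_const[OF N] l2sq_def h1sq_def ..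
  \<comment> \<open>The averaged gradient of \<open>d\<close> is traded for gradients of
    \<open>b\<close> and \<open>c\<close>; the factors 2 * 2 * 12 and 2 * 2 * 3 are the origin of 48
    \<alpha> and 12 \<alpha>.\<close>
  also have "2 * \<alpha> * \<eta> * gmean N (gradsq N (avgA d)) \<le> 2 * \<alpha> * \<eta> * (2 * (12 * h1sq N b + 3 * h1sq N c + 9 * \<rho>\<^sup>2))"
  proof (intro mult_left_mono)
    have "h1sq N d \<le> 12 * h1sq N b + 3 * h1sq N c + 9 * \<rho>\<^sup>2" unfolding d_def by (rule h1sq_three[OF N Dw])
    then show "gmean N (gradsq N (avgA d)) \<le> 2 * (12 * h1sq N b + 3 * h1sq N c + 9 * \<rho>\<^sup>2)"
      by (intro order_trans[OF gmean_gradsq_avgA[OF nd]] mult_left_mono) auto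
  qed (use al e in auto)
  finally have G: "gmean N Z \<le> (3/2 + 11/2 * \<eta> - \<alpha>) * h1sq N a + (1 + (1 + 48 * \<alpha>) * \<eta>) * h1sq N b + (1/2 + (1/2 + 12 * \<alpha>) * \<eta>) * h1sq N c
     + (\<alpha> * (12 * L\<^sup>2 / \<eta> + 3 * L\<^sup>2) + 3 * L + 1) * l2sq N a + \<alpha> * \<theta> * l2sq N a
     + (9 * L\<^sup>2 / \<eta> + 36 * \<alpha> * L\<^sup>2) * l2sq N b + (9 * L\<^sup>2 / (4 * \<eta>) + 9 * \<alpha> * L\<^sup>2) * l2sq N c
     + (3 / \<eta> + 9 * L\<^sup>2 / (4 * \<eta>) + 9 * \<alpha> * L\<^sup>2 + 36 * \<alpha> * \<eta> + 3 * (1 / (2 * \<eta>) + L) + 1) * \<rho>\<^sup>2"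
    by (simp add: algebra_simps)
  note CB = energy_const_bounds[OF less_imp_le[OF al] L0 e]
  have c3: "9 * L\<^sup>2 / (4 * \<eta>) + 9 * \<alpha> * L\<^sup>2 \<le> energy_const \<alpha> L \<eta>"
  proof -
    have "9 * L\<^sup>2 / (4 * \<eta>) \<le> 9 * L\<^sup>2 / \<eta>" using e by (intro divide_left_mono) auto
    moreover have "9 * \<alpha> * L\<^sup>2 \<le> 36 * \<alpha> * L\<^sup>2" using al by (intro mult_right_mono) auto
    ultimately show ?thesis using CB(2) by linarith
  qed
  have b1: "(3/2 + 11/2 * \<eta> - \<alpha>) * h1sq N a \<le> (3/2 + 6 * \<eta> - \<alpha>) * h1sq N a"
    using e by (intro mult_right_mono h1sq_nonneg) auto
  have b2: "(1/2 + (1/2 + 12 * \<alpha>) * \<eta>) * h1sq N c \<le> (1/2 + (1 + 12 * \<alpha>) * \<eta>) * h1sq N c"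
    using e by (intro mult_right_mono h1sq_nonneg add_left_mono) auto
  have "gmean N Z \<le> (3/2 + 6 * \<eta> - \<alpha>) * h1sq N a + (1 + (1 + 48 * \<alpha>) * \<eta>) * h1sq N b + (1/2 + (1 + 12 * \<alpha>) * \<eta>) * h1sq N c
     + energy_const \<alpha> L \<eta> * l2sq N a + \<alpha> * \<theta> * l2sq N a + energy_const \<alpha> L \<eta> * l2sq N b + energy_const \<alpha> L \<eta> * l2sq N c + energy_const \<alpha> L \<eta> * \<rho>\<^sup>2"
    using G b1 b2 mult_right_mono[OF CB(1) l2sq_nonneg[of N a]] mult_right_mono[OF CB(2) l2sq_nonneg[of N b]]
      mult_right_mono[OF c3 l2sq_nonneg[of N c]] mult_right_mono[OF CB(3) zero_le_power2[of \<rho>]] by linarith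
  then have "4 * k * gmean N Z \<le> 4 * k * ((3/2 + 6 * \<eta> - \<alpha>) * h1sq N a + (1 + (1 + 48 * \<alpha>) * \<eta>) * h1sq N b + (1/2 + (1 + 12 * \<alpha>) * \<eta>) * h1sq N c
        + energy_const \<alpha> L \<eta> * (l2sq N a + l2sq N b + l2sq N c + \<rho>\<^sup>2) + \<alpha> * \<theta> * l2sq N a)"
    using k by (intro mult_left_mono) (auto simp: algebra_simps)
  then show ?thesis using en by linarith
qed

section \<open>Normalisation\<close>

text \<open>The Taylor remainders below are obtained by iterating this bound; at the last stage a
  Lipschitz estimate can take the place of a further derivative.\<close>

lemma vector_mvt_bound:
  fixes \<phi> :: "real \<Rightarrow> 'a::real_normed_vector"
  assumes h: "h \<ge> 0" and d: "\<And>s. s \<in> {0..h} \<Longrightarrow> (\<phi> has_vector_derivative \<phi>' s) (at s within {0..h})"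
    and b: "\<And>s. s \<in> {0..h} \<Longrightarrow> norm (\<phi>' s) \<le> L"
  shows "norm (\<phi> h - \<phi> 0) \<le> L * h"
proof -
  have "norm (\<phi> h - \<phi> 0) \<le> L * norm (h - 0)"
  proof (rule differentiable_bound)
    show "(\<phi> has_derivative (\<lambda>x. x *\<^sub>R \<phi>' s)) (at s within {0..h})" if "s \<in> {0..h}" for s
      using d[OF that] by (simp add: has_vector_derivative_def)
    show "onorm (\<lambda>x. x *\<^sub>R \<phi>' s) \<le> L" if "s \<in> {0..h}" for s
      using b[OF that] by (intro onorm_le) (simp add: mult.commute[of L] mult_left_mono)
  qed (use h in auto)
  then show ?thesis using h by simp
qed

definition unitv :: "'a::real_normed_vector \<Rightarrow> 'a" where "unitv v = (1 / norm v) *\<^sub>R v"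

text \<open>The derivative of \<open>unitv\<close> at \<open>y\<close> in the direction
  \<open>w\<close>: the component of \<open>w\<close> orthogonal to \<open>y\<close>, scaled by
  \<open>1 / norm y\<close>.\<close>

definition dunitv :: "'a::real_inner \<Rightarrow> 'a \<Rightarrow> 'a" where
  "dunitv y w = (1 / norm y) *\<^sub>R (w - (unitv y \<bullet> w) *\<^sub>R unitv y)"

lemma norm_nz: "y \<noteq> 0 \<Longrightarrow> norm (unitv y) = 1"
  by (simp add: unitv_def)

lemma unitv_lipschitz:
  fixes x y :: "'a::real_normed_vector"
  assumes "x \<noteq> 0" "y \<noteq> 0"
  shows "norm (unitv x - unitv y) \<le> 2 * norm (x - y) / norm y"
proof -
  have "unitv x - unitv y = (1 / norm y) *\<^sub>R (x - y) + (1 / norm x - 1 / norm y) *\<^sub>R x"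
    by (simp add: unitv_def algebra_simps)
  then have "norm (unitv x - unitv y) \<le> norm ((1 / norm y) *\<^sub>R (x - y)) + norm ((1 / norm x - 1 / norm y) *\<^sub>R x)"
    by (metis norm_triangle_ineq)
  also have "norm ((1 / norm x - 1 / norm y) *\<^sub>R x) = \<bar>norm y - norm x\<bar> / norm y"
    using assms by (simp add: field_simps abs_mult)
  also have "\<dots> \<le> norm (x - y) / norm y"
    using norm_triangle_ineq3[of y x] by (intro divide_right_mono) (auto simp: norm_minus_commute)
  finally show ?thesis by simp
qed

lemma norm_dnz: "y \<noteq> 0 \<Longrightarrow> norm (dunitv y w) \<le> norm w / norm y"
proof -
  assume y: "y \<noteq> 0"
  have "(norm (w - (unitv y \<bullet> w) *\<^sub>R unitv y))\<^sup>2 = (norm w)\<^sup>2 - (unitv y \<bullet> w)\<^sup>2 * (2 - (norm (unitv y))\<^sup>2)"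
    unfolding power2_norm_eq_inner
    by (simp add: inner_diff_left inner_diff_right inner_commute[of w "unitv y"] power2_eq_square algebra_simps)
  also have "\<dots> \<le> (norm w)\<^sup>2" by (simp add: norm_nz[OF y])
  finally have "norm (w - (unitv y \<bullet> w) *\<^sub>R unitv y) \<le> norm w" by (rule power2_le_imp_le) simp
  then show "norm (dunitv y w) \<le> norm w / norm y" by (simp add: dunitv_def divide_right_mono)
qed

lemma dunitv_diff: "dunitv y (w - v) = dunitv y w - dunitv y v"
  by (simp add: dunitv_def inner_diff_right algebra_simps)

lemma dunitv_lipschitz:
  fixes x y w :: "'a::real_inner"
  assumes x: "norm x \<ge> 1/2" and y: "norm y \<ge> 1/2"
  shows "norm (dunitv x w - dunitv y w) \<le> 24 * norm (x - y) * norm w"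
proof -
  define p where "p = 1 / norm x" define q where "q = 1 / norm y"
  define u where "u = unitv x" define v where "v = unitv y"
  have z: "x \<noteq> 0" "y \<noteq> 0" using x y by auto
  have q: "0 \<le> q" "q \<le> 2" "0 \<le> p" "p \<le> 2" using x y le_imp_inverse_le[OF x] le_imp_inverse_le[OF y]
    by (auto simp: p_def q_def inverse_eq_divide)
  have uv: "norm u = 1" "norm v = 1" using z by (auto simp: u_def v_def norm_nz)
  have pq: "\<bar>p - q\<bar> \<le> 4 * norm (x - y)"
  proof -
    have "p - q = (norm y - norm x) * (p * q)" using z by (simp add: p_def q_def field_simps)
    then have "\<bar>p - q\<bar> = \<bar>norm y - norm x\<bar> * (p * q)" using q by (simp add: abs_mult)
    also have "\<dots> \<le> norm (x - y) * (2 * 2)"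
      using q norm_triangle_ineq3[of y x] by (intro mult_mono) (auto simp: norm_minus_commute)
    finally show ?thesis by simp
  qed
  have duv: "norm (u - v) \<le> 4 * norm (x - y)"
  proof -
    have "norm (u - v) \<le> 2 * norm (x - y) * q" using unitv_lipschitz[OF z] by (simp add: u_def v_def q_def)
    also have "\<dots> \<le> 2 * norm (x - y) * 2" using q by (intro mult_left_mono) auto
    finally show ?thesis by simp
  qed
  \<comment> \<open>The scale changes first and the direction second; with both norms at least 1/2
    the two parts contribute 4 * 2 and 2 * 8, together 24.\<close>
  have "dunitv x w - dunitv y w = (p - q) *\<^sub>R (w - (u \<bullet> w) *\<^sub>R u) - q *\<^sub>R ((u \<bullet> w) *\<^sub>R (u - v) + ((u - v) \<bullet> w) *\<^sub>R v)"
    by (simp add: dunitv_def p_def q_def u_def v_def algebra_simps inner_diff_left)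
  then have "norm (dunitv x w - dunitv y w) \<le> \<bar>p - q\<bar> * norm (w - (u \<bullet> w) *\<^sub>R u) + q * norm ((u \<bullet> w) *\<^sub>R (u - v) + ((u - v) \<bullet> w) *\<^sub>R v)"
    using norm_triangle_ineq4[of "(p - q) *\<^sub>R (w - (u \<bullet> w) *\<^sub>R u)" "q *\<^sub>R ((u \<bullet> w) *\<^sub>R (u - v) + ((u - v) \<bullet> w) *\<^sub>R v)"] q by simp
  also have "\<dots> \<le> (4 * norm (x - y)) * (2 * norm w) + 2 * (norm w * (4 * norm (x - y)) + (4 * norm (x - y)) * norm w)"
  proof (intro add_mono mult_mono pq q)
    have a: "\<bar>u \<bullet> w\<bar> \<le> norm w" using Cauchy_Schwarz_ineq2[of u w] uv by simp
    show "norm (w - (u \<bullet> w) *\<^sub>R u) \<le> 2 * norm w"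
      using norm_triangle_ineq4[of w "(u \<bullet> w) *\<^sub>R u"] a uv by simp
    have b: "\<bar>(u - v) \<bullet> w\<bar> \<le> 4 * norm (x - y) * norm w"
      using Cauchy_Schwarz_ineq2[of "u - v" w] mult_right_mono[OF duv norm_ge_zero[of w]] by linarith
    have c: "\<bar>u \<bullet> w\<bar> * norm (u - v) \<le> norm w * (4 * norm (x - y))" by (intro mult_mono a duv) auto
    show "norm ((u \<bullet> w) *\<^sub>R (u - v) + ((u - v) \<bullet> w) *\<^sub>R v) \<le> norm w * (4 * norm (x - y)) + (4 * norm (x - y)) * norm w"
      using norm_triangle_ineq[of "(u \<bullet> w) *\<^sub>R (u - v)" "((u - v) \<bullet> w) *\<^sub>R v"] b c
      unfolding norm_scaleR uv mult_1_right by linarith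
  qed auto
  finally show ?thesis by (simp add: algebra_simps)
qed

lemma unitv_has_vector_derivative:
  fixes V a :: "'a::real_inner"
  assumes "V + s *\<^sub>R a \<noteq> 0"
  shows "((\<lambda>s. unitv (V + s *\<^sub>R a)) has_vector_derivative dunitv (V + s *\<^sub>R a) a) (at s within S)"
proof -
  let ?y = "V + s *\<^sub>R a"
  have 1: "((\<lambda>s. V + s *\<^sub>R a) has_vector_derivative a) (at s within S)"
    by (auto intro!: derivative_eq_intros)
  have 2: "((\<lambda>s. norm (V + s *\<^sub>R a)) has_real_derivative (?y \<bullet> a) / norm ?y) (at s within S)"
  proof -
    have "((\<lambda>s. norm (V + s *\<^sub>R a)) has_derivative (\<lambda>t. sgn ?y \<bullet> (t *\<^sub>R a))) (at s within S)"
      using has_derivative_compose[OF 1[unfolded has_vector_derivative_def] has_derivative_norm[OF assms]]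
      by (simp add: inner_commute)
    moreover have "(\<lambda>t. sgn ?y \<bullet> (t *\<^sub>R a)) = (*) ((?y \<bullet> a) / norm ?y)"
      by (auto simp: fun_eq_iff sgn_div_norm divide_inverse)
    ultimately show ?thesis by (simp add: has_field_derivative_def)
  qed
  have 3: "((\<lambda>s. 1 / norm (V + s *\<^sub>R a)) has_real_derivative - ((?y \<bullet> a) / norm ?y) / (norm ?y)\<^sup>2) (at s within S)"
    using assms by (auto intro!: derivative_eq_intros 2 simp: power2_eq_square field_simps)
  have "((\<lambda>s. (1 / norm (V + s *\<^sub>R a)) *\<^sub>R (V + s *\<^sub>R a)) has_vector_derivative
     ((1 / norm ?y) *\<^sub>R a + (- ((?y \<bullet> a) / norm ?y) / (norm ?y)\<^sup>2) *\<^sub>R ?y)) (at s within S)"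
    by (rule has_vector_derivative_scaleR[OF 3 1])
  moreover have "(1 / norm ?y) *\<^sub>R a + (- ((?y \<bullet> a) / norm ?y) / (norm ?y)\<^sup>2) *\<^sub>R ?y = dunitv ?y a"
    using assms unfolding dunitv_def unitv_def by (simp add: scaleR_diff_right power2_eq_square)
  ultimately show ?thesis by (simp add: unitv_def)
qed

text \<open>Move from \<open>V\<close> to \<open>V + a\<close> and from \<open>W\<close> to
  \<open>W + b\<close> along straight segments and compare the velocities. The derivative of
  \<open>unitv\<close> is nearly a contraction on \<open>b - a\<close>, and its dependence on the
  base point costs the rest; 28 = 4 + 24. A leading factor close to 1 preserves the gradient
  budget.\<close>

lemma unitv_second_difference:
  fixes V W a b :: "'a::real_inner"
  assumes e: "0 \<le> \<eta>" "\<eta> \<le> 1/8" and V: "norm V \<ge> 1 - \<eta>" and W: "norm W \<ge> 1 - \<eta>" and a: "norm a \<le> \<eta>" and b: "norm b \<le> \<eta>"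
  shows "norm ((unitv (W + b) - unitv W) - (unitv (V + a) - unitv V)) \<le> (1 + 28 * \<eta>) * norm (b - a) + 24 * norm (W - V) * norm a"
proof -
  have n: "norm (X + s *\<^sub>R c) \<ge> 1 - 2 * \<eta>" if "norm X \<ge> 1 - \<eta>" "norm c \<le> \<eta>" "s \<in> {0..1}" for X c :: 'a and s
  proof -
    have "norm (s *\<^sub>R c) \<le> 1 * \<eta>" unfolding norm_scaleR using that e by (intro mult_mono) auto
    then show ?thesis using norm_diff_ineq[of X "s *\<^sub>R c"] that by linarith
  qed
  have h: "1 - 2 * \<eta> \<ge> 1/2" using e by simp
  define \<phi> where "\<phi> s = unitv (W + s *\<^sub>R b) - unitv (V + s *\<^sub>R a)" for s
  have "norm (\<phi> 1 - \<phi> 0) \<le> ((1 + 28 * \<eta>) * norm (b - a) + 24 * norm (W - V) * norm a) * 1"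
  proof (rule vector_mvt_bound)
    fix s :: real assume s: "s \<in> {0..1}"
    let ?y = "W + s *\<^sub>R b" and ?x = "V + s *\<^sub>R a"
    have ny: "norm ?y \<ge> 1 - 2 * \<eta>" "norm ?x \<ge> 1 - 2 * \<eta>" using n[OF W b s] n[OF V a s] by auto
    then have nz0: "?y \<noteq> 0" "?x \<noteq> 0" "norm ?y \<ge> 1/2" "norm ?x \<ge> 1/2" using h by auto
    show "(\<phi> has_vector_derivative dunitv ?y b - dunitv ?x a) (at s within {0..1})"
      unfolding \<phi>_def by (intro has_vector_derivative_diff unitv_has_vector_derivative nz0)
    have "dunitv ?y b - dunitv ?x a = dunitv ?y (b - a) + (dunitv ?y a - dunitv ?x a)" by (simp add: dunitv_diff)
    then have "norm (dunitv ?y b - dunitv ?x a) \<le> norm (dunitv ?y (b - a)) + norm (dunitv ?y a - dunitv ?x a)" by (metis norm_triangle_ineq)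
    also have "norm (dunitv ?y (b - a)) \<le> (1 + 4 * \<eta>) * norm (b - a)"
    proof -
      have "1 / norm ?y \<le> 1 / (1 - 2 * \<eta>)" using ny h by (intro divide_left_mono mult_pos_pos) linarith+
      also have "\<dots> \<le> 1 + 4 * \<eta>"
      proof -
        have "\<eta> * \<eta> \<le> \<eta> * (1/8)" using e by (intro mult_left_mono) auto
        then have "1 \<le> (1 + 4 * \<eta>) * (1 - 2 * \<eta>)" using e by (simp add: algebra_simps)
        then show ?thesis using h by (simp add: divide_le_eq)
      qed
      finally have "1 / norm ?y * norm (b - a) \<le> (1 + 4 * \<eta>) * norm (b - a)" by (rule mult_right_mono) simp
      then show ?thesis using norm_dnz[OF nz0(1), of "b - a"] by simp
    qed
    also have "norm (dunitv ?y a - dunitv ?x a) \<le> 24 * \<eta> * norm (b - a) + 24 * norm (W - V) * norm a"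
    proof -
      have 1: "norm (?y - ?x) \<le> norm (W - V) + norm (b - a)"
      proof -
        have "?y - ?x = (W - V) + s *\<^sub>R (b - a)" by (simp add: algebra_simps)
        then have "norm (?y - ?x) \<le> norm (W - V) + norm (s *\<^sub>R (b - a))" by (metis norm_triangle_ineq)
        also have "norm (s *\<^sub>R (b - a)) \<le> 1 * norm (b - a)" unfolding norm_scaleR using s by (intro mult_right_mono) auto
        finally show ?thesis by simp
      qed
      have "norm (dunitv ?y a - dunitv ?x a) \<le> 24 * norm (?y - ?x) * norm a" by (rule dunitv_lipschitz[OF nz0(3,4)])
      also have "\<dots> \<le> 24 * (norm (W - V) + norm (b - a)) * norm a" using 1 by (intro mult_right_mono) auto
      also have "\<dots> = 24 * norm (b - a) * norm a + 24 * norm (W - V) * norm a" by (simp add: algebra_simps)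
      also have "24 * norm (b - a) * norm a \<le> 24 * norm (b - a) * \<eta>" using a by (intro mult_left_mono) auto
      finally show ?thesis by (simp add: algebra_simps)
    qed
    finally show "norm (dunitv ?y b - dunitv ?x a) \<le> (1 + 28 * \<eta>) * norm (b - a) + 24 * norm (W - V) * norm a"
      by (simp add: algebra_simps)
  qed simp
  then show ?thesis by (simp add: \<phi>_def algebra_simps)
qed

lemma sq_add_le: assumes "0 < \<eta>" "\<eta> \<le> 1" "0 \<le> x" "0 \<le> (y::real)"
  shows "((1 + \<eta>/8) * x + y)\<^sup>2 \<le> (1 + \<eta>) * x\<^sup>2 + (1 + 4/\<eta>) * y\<^sup>2"
proof -
  define z where "z = (1 + \<eta>/8) * x"
  have "2 * (z * y) \<le> \<eta>/4 * z\<^sup>2 + 4/\<eta> * y\<^sup>2"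
    using young[of "\<eta>/8" z y] assms by (simp add: field_simps)
  then have "(z + y)\<^sup>2 \<le> (1 + \<eta>/4) * z\<^sup>2 + (1 + 4/\<eta>) * y\<^sup>2" by (simp add: power2_eq_square algebra_simps)
  also have "(1 + \<eta>/4) * z\<^sup>2 \<le> (1 + \<eta>) * x\<^sup>2"
  proof -
    have e2: "\<eta> * \<eta> \<le> \<eta>" using assms mult_left_mono[of \<eta> 1 \<eta>] by simp
    moreover have "\<eta> * (\<eta> * \<eta>) \<le> \<eta>" using order_trans[OF mult_left_mono[OF e2, of \<eta>] e2] assms by simp
    moreover have ex: "(1 + \<eta>/4) * (1 + \<eta>/8)\<^sup>2 = 1 + \<eta>/2 + 5/64 * (\<eta> * \<eta>) + 1/256 * (\<eta> * (\<eta> * \<eta>))"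
      by (simp add: power2_eq_square field_simps)
    ultimately have "(1 + \<eta>/4) * (1 + \<eta>/8)\<^sup>2 \<le> 1 + \<eta>" using assms ex by linarith
    then have "(1 + \<eta>/4) * (1 + \<eta>/8)\<^sup>2 * x\<^sup>2 \<le> (1 + \<eta>) * x\<^sup>2" by (rule mult_right_mono) simp
    then show ?thesis by (simp add: z_def power_mult_distrib mult.assoc)
  qed
  finally show ?thesis by (simp add: z_def)
qed

text \<open>The radius \<eta>/224 is \<eta>/(28 * 8): it turns the factor
  \<open>1 + 28 * \<eta>\<close> of \<open>unitv_second_difference\<close> into the
  \<open>1 + \<eta>/8\<close> expected by \<open>sq_add_le\<close>. The 1728 is 3 * 24^2, one term
  for each direction.\<close>

lemma projection_estimates:
  fixes mt M V :: grid
  assumes N: "N > 0" and e: "0 < \<eta>" "\<eta> \<le> 1" and neumann: "neumann N mt" "neumann N M" "neumann N V"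
    and V: "\<And>p. p \<in> inner_pts N \<Longrightarrow> unitv (V p) = M p \<and> norm (V p) \<ge> 1 - \<eta>/224"
    and DV: "\<And>d p. p \<in> inner_pts N \<Longrightarrow> norm (dd N d V p) \<le> L"
  defines "a \<equiv> (\<lambda>p. mt p - V p)"
  assumes a: "\<And>p. p \<in> inner_pts N \<Longrightarrow> norm (a p) \<le> \<eta>/224"
  shows "h1sq N (\<lambda>p. unitv (mt p) - M p) \<le> (1 + \<eta>) * h1sq N a + 1728 * L\<^sup>2 * (1 + 4/\<eta>) * l2sq N a"
    and "l2sq N (\<lambda>p. unitv (mt p) - M p) \<le> 16 * l2sq N a"
    and "\<And>p. p \<in> inner_pts N \<Longrightarrow> norm (unitv (mt p) - M p) \<le> 4 * norm (a p)"
    and "\<And>p. p \<in> inner_pts N \<Longrightarrow> mt p \<noteq> 0"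
proof -
  have na: "neumann N a" unfolding a_def using neumann by (simp add: neumann_def)
  \<comment> \<open>\<open>V\<close> and \<open>M\<close> are bundled into one pair-valued Neumann
    function, so that a property relating them extends to the ghost points.\<close>
  have V': "unitv (V p) = M p \<and> norm (V p) \<ge> 1 - \<eta>/224" if "p \<in> all_pts N" for p
    using neumann_bound_all[of N "\<lambda>p. (V p, M p)" "\<lambda>(v, m). unitv v = m \<and> norm v \<ge> 1 - \<eta>/224" p] N V neumann that
    by (auto simp: neumann_def)
  have a': "norm (a p) \<le> \<eta>/224" if "p \<in> all_pts N" for p
    using neumann_bound_all[OF na N, of "\<lambda>v. norm v \<le> \<eta>/224"] a that by blast
  have mt: "mt p = V p + a p" for p by (simp add: a_def)
  have nn: "mt p \<noteq> 0 \<and> V p \<noteq> 0 \<and> norm (V p) \<ge> 1/2" if p: "p \<in> inner_pts N" for p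
    using V[OF p] a[OF p] e norm_diff_ineq[of "V p" "a p"] by (auto simp: mt)
  then show "\<And>p. p \<in> inner_pts N \<Longrightarrow> mt p \<noteq> 0" by blast
  show p4: "norm (unitv (mt p) - M p) \<le> 4 * norm (a p)" if p: "p \<in> inner_pts N" for p
  proof -
    have "norm (unitv (mt p) - unitv (V p)) \<le> 2 * norm (mt p - V p) / norm (V p)" using nn[OF p] by (intro unitv_lipschitz) auto
    also have "\<dots> \<le> 2 * norm (mt p - V p) / (1/2)" using nn[OF p] by (intro divide_left_mono) auto
    finally show ?thesis using V[OF p] by (simp add: a_def)
  qed
  show "l2sq N (\<lambda>p. unitv (mt p) - M p) \<le> 16 * l2sq N a"
    unfolding l2sq_def gmean_cmult[symmetric]
  proof (rule gmean_mono)
    fix p assume "p \<in> inner_pts N"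
    then have "(norm (unitv (mt p) - M p))\<^sup>2 \<le> (4 * norm (a p))\<^sup>2" using p4 by (intro power_mono) auto
    then show "(norm (unitv (mt p) - M p))\<^sup>2 \<le> 16 * (norm (a p))\<^sup>2" by (simp add: power_mult_distrib)
  qed
  have "h1sq N (\<lambda>p. unitv (mt p) - M p) \<le> gmean N (\<lambda>p. (1 + \<eta>) * gradsq N a p + 1728 * L\<^sup>2 * (1 + 4/\<eta>) * (norm (a p))\<^sup>2)"
    unfolding h1sq_def
  proof (rule gmean_mono)
    fix p assume p: "p \<in> inner_pts N"
    have D: "(norm (dd N d (\<lambda>p. unitv (mt p) - M p) p))\<^sup>2 \<le> (1 + \<eta>) * (norm (dd N d a p))\<^sup>2 + (1 + 4/\<eta>) * (24 * L * norm (a p))\<^sup>2" for d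
    proof -
      let ?q = "fw d p"
      have q: "?q \<in> all_pts N" "p \<in> all_pts N" using p by (auto simp: fw_all inner_all)
      have "norm ((unitv (V ?q + a ?q) - unitv (V ?q)) - (unitv (V p + a p) - unitv (V p)))
        \<le> (1 + 28 * (\<eta>/224)) * norm (a ?q - a p) + 24 * norm (V ?q - V p) * norm (a p)"
        using e V'[OF q(1)] V'[OF q(2)] a'[OF q(1)] a'[OF q(2)] by (intro unitv_second_difference) auto
      then have "norm ((unitv (mt ?q) - M ?q) - (unitv (mt p) - M p)) \<le> (1 + \<eta>/8) * norm (a ?q - a p) + 24 * norm (V ?q - V p) * norm (a p)"
        using V'[OF q(1)] V'[OF q(2)] by (simp add: mt)
      then have "real N * norm ((unitv (mt ?q) - M ?q) - (unitv (mt p) - M p)) \<le> real N * ((1 + \<eta>/8) * norm (a ?q - a p) + 24 * norm (V ?q - V p) * norm (a p))"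
        by (rule mult_left_mono) simp
      then have "norm (dd N d (\<lambda>p. unitv (mt p) - M p) p) \<le> (1 + \<eta>/8) * norm (dd N d a p) + 24 * norm (dd N d V p) * norm (a p)"
        unfolding dd_def norm_scaleR by (simp add: algebra_simps)
      also have "\<dots> \<le> (1 + \<eta>/8) * norm (dd N d a p) + 24 * L * norm (a p)"
        using DV[OF p, of d] by (intro add_left_mono mult_right_mono mult_left_mono) auto
      finally have "(norm (dd N d (\<lambda>p. unitv (mt p) - M p) p))\<^sup>2 \<le> ((1 + \<eta>/8) * norm (dd N d a p) + 24 * L * norm (a p))\<^sup>2"
        by (rule power_mono) simp
      also have "\<dots> \<le> (1 + \<eta>) * (norm (dd N d a p))\<^sup>2 + (1 + 4/\<eta>) * (24 * L * norm (a p))\<^sup>2"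
        using e order_trans[OF norm_ge_zero DV[OF p, of d]] by (intro sq_add_le) auto
      finally show ?thesis .
    qed
    show "gradsq N (\<lambda>p. unitv (mt p) - M p) p \<le> (1 + \<eta>) * gradsq N a p + 1728 * L\<^sup>2 * (1 + 4/\<eta>) * (norm (a p))\<^sup>2"
    proof -
      define K where "K = 1 + 4 / \<eta>"
      have "1728 * L\<^sup>2 * K * (norm (a p))\<^sup>2 = 3 * (K * (24 * L * norm (a p))\<^sup>2)" by (simp add: power_mult_distrib)
      then show ?thesis
        using D[of 1] D[of 2] D[of 3] unfolding gradsq_dd sum_3 K_def[symmetric] distrib_left by linarith
    qed
  qed
  then show "h1sq N (\<lambda>p. unitv (mt p) - M p) \<le> (1 + \<eta>) * h1sq N a + 1728 * L\<^sup>2 * (1 + 4/\<eta>) * l2sq N a"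
    by (simp only: gmean_add gmean_cmult h1sq_def l2sq_def)
qed

text \<open>The error of the unnormalised solution splits as \<open>(1 + g) e + \<sigma> m\<close>.  The new \<open>\<sigma>\<^sup>2\<close> pays
  for all mixed terms, since \<open>e\<close> and \<open>c\<close>, being differences of unit vectors, are orthogonal to
  the unit sphere only to second order.\<close>
lemma projection_G_norm:
  fixes m M m1 M1 a :: "'a::real_inner"
  assumes u: "norm m = 1" "norm M = 1" "norm m1 = 1" "norm M1 = 1"
    and a: "a = (1 + g) *\<^sub>R (m - M) + \<sigma> *\<^sub>R m" and k: "0 < k" "k \<le> 1" and g: "\<bar>g\<bar> \<le> k"
    and e: "(norm (m - M))\<^sup>2 \<le> k" and c: "(norm (m1 - M1))\<^sup>2 \<le> k" and MM: "norm (M - M1) \<le> L * k"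
  defines "e \<equiv> m - M" and "c \<equiv> m1 - M1"
  shows "(norm e)\<^sup>2 + (norm (2 *\<^sub>R e - c))\<^sup>2
    \<le> (norm a)\<^sup>2 + (norm (2 *\<^sub>R a - c))\<^sup>2 + (40 + 4 * L\<^sup>2) * k * ((norm e)\<^sup>2 + (norm c)\<^sup>2)"
proof -
  define x where "x = norm e" define y where "y = norm c"
  have x0: "x \<ge> 0" "y \<ge> 0" by (auto simp: x_def y_def)
  have xk: "x\<^sup>2 \<le> k" "y\<^sup>2 \<le> k" using e c by (auto simp: x_def y_def e_def c_def)
  have L0: "0 \<le> L * k" using MM norm_ge_zero order_trans by blast
  have em: "e \<bullet> m = x\<^sup>2 / 2"
    using u(1,2) unfolding x_def e_def power2_norm_eq_inner norm_eq_1
    by (simp add: inner_diff_left inner_diff_right inner_commute[of m M])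
  have Mc: "M1 \<bullet> c = - y\<^sup>2 / 2"
    using u(3,4) unfolding y_def c_def power2_norm_eq_inner norm_eq_1
    by (simp add: inner_diff_left inner_diff_right inner_commute[of m1 M1])
  have mm: "m \<bullet> m = 1" using u by (simp add: norm_eq_1)
  have ec: "\<bar>e \<bullet> c\<bar> \<le> x * y" unfolding x_def y_def by (rule Cauchy_Schwarz_ineq2)
  \<comment> \<open>\<open>c\<close> is nearly orthogonal to \<open>M1\<close>, whereas
    \<open>m\<close> is close to \<open>M\<close>; passing between the two time levels costs
    \<open>L * k\<close>.\<close>
  have "\<bar>(M - M1) \<bullet> c\<bar> \<le> L * k * y"
    using Cauchy_Schwarz_ineq2[of "M - M1" c] mult_right_mono[OF MM norm_ge_zero[of c]] by (simp add: y_def)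
  moreover have "m \<bullet> c = e \<bullet> c + (M - M1) \<bullet> c + M1 \<bullet> c" by (simp add: e_def inner_diff_left)
  ultimately have mc: "\<bar>m \<bullet> c\<bar> \<le> x * y + L * k * y + y\<^sup>2 / 2" using ec Mc zero_le_power2[of y] by linarith
  have a2: "(norm a)\<^sup>2 = (1 + g)\<^sup>2 * x\<^sup>2 + (1 + g) * \<sigma> * x\<^sup>2 + \<sigma>\<^sup>2"
  proof -
    have "(norm a)\<^sup>2 = (1 + g)\<^sup>2 * (e \<bullet> e) + 2 * (1 + g) * \<sigma> * (e \<bullet> m) + \<sigma>\<^sup>2 * (m \<bullet> m)"
      unfolding a e_def[symmetric] power2_norm_eq_inner
      by (simp add: inner_add_left inner_add_right inner_commute[of m e] power2_eq_square algebra_simps)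
    then show ?thesis by (simp add: em mm x_def power2_norm_eq_inner)
  qed
  have ac: "a \<bullet> c = (1 + g) * (e \<bullet> c) + \<sigma> * (m \<bullet> c)"
    unfolding a e_def[symmetric] by (simp add: inner_add_left)
  have dbl: "(norm (2 *\<^sub>R z - c))\<^sup>2 = 4 * (norm z)\<^sup>2 - 4 * (z \<bullet> c) + (norm c)\<^sup>2" for z
    unfolding power2_norm_eq_inner by (simp add: inner_diff_left inner_diff_right inner_commute[of c z])
  \<comment> \<open>Gathers the factor of \<sigma> in the energy difference. The 5 is 1 + 4, from
    \<open>a\<close> and from \<open>2 *\<^sub>R a - c\<close>; completing the square then loses
    only \<open>R\<^sup>2 / 20\<close>.\<close>
  define R where "R = 5 * ((1 + g) * x\<^sup>2) - 4 * (m \<bullet> c)"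
  define B where "B = 12 * x\<^sup>2 + 4 * y\<^sup>2 + 4 * (L * k) * y"
  have RB: "\<bar>R\<bar> \<le> B"
  proof -
    have "\<bar>(1 + g) * x\<^sup>2\<bar> \<le> 2 * x\<^sup>2" unfolding abs_mult using g k by (intro mult_mono) auto
    moreover have "x * y * 2 \<le> x\<^sup>2 + y\<^sup>2" using zero_le_power2[of "x - y"] by (simp add: power2_eq_square algebra_simps)
    ultimately show ?thesis unfolding R_def B_def using mc zero_le_power2[of x] by linarith
  qed
  have "0 \<le> (5 * \<sigma> + R / 2)\<^sup>2" by simp
  then have s1: "5 * \<sigma>\<^sup>2 + \<sigma> * R \<ge> - R\<^sup>2 / 20" by (simp add: power2_eq_square algebra_simps)
  \<comment> \<open>\<open>R\<close> is quadratic in \<open>x\<close> and \<open>y\<close> up to a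
    term carrying \<open>k\<close>; since \<open>x\<^sup>2\<close> and \<open>y\<^sup>2\<close> are
    at most \<open>k\<close>, its square gains a factor \<open>k\<close>.\<close>
  have R2: "R\<^sup>2 / 20 \<le> 22 * k * x\<^sup>2 + 3 * k * y\<^sup>2 + 3 * L\<^sup>2 * k * y\<^sup>2"
  proof -
    have "R\<^sup>2 \<le> B\<^sup>2" using RB by (metis abs_ge_zero power2_abs power_mono)
    also have "B\<^sup>2 \<le> 3 * ((12 * x\<^sup>2)\<^sup>2 + (4 * y\<^sup>2)\<^sup>2 + (4 * (L * k) * y)\<^sup>2)"
      unfolding B_def
      using zero_le_power2[of "12 * x\<^sup>2 - 4 * y\<^sup>2"] zero_le_power2[of "12 * x\<^sup>2 - 4 * (L * k) * y"] zero_le_power2[of "4 * y\<^sup>2 - 4 * (L * k) * y"]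
      by (simp add: power2_eq_square algebra_simps)
    also have "\<dots> = 432 * (x\<^sup>2 * x\<^sup>2) + 48 * (y\<^sup>2 * y\<^sup>2) + 48 * L\<^sup>2 * (k * k) * y\<^sup>2"
      by (simp add: power2_eq_square algebra_simps)
    also have "x\<^sup>2 * x\<^sup>2 \<le> k * x\<^sup>2" using xk by (intro mult_right_mono) auto
    also have "y\<^sup>2 * y\<^sup>2 \<le> k * y\<^sup>2" using xk by (intro mult_right_mono) auto
    also have "48 * L\<^sup>2 * (k * k) * y\<^sup>2 \<le> 48 * L\<^sup>2 * (k * 1) * y\<^sup>2" using k by (intro mult_right_mono mult_left_mono) auto
    finally have "R\<^sup>2 \<le> 432 * (k * x\<^sup>2) + 48 * (k * y\<^sup>2) + 48 * (L\<^sup>2 * k * y\<^sup>2)" by (simp add: algebra_simps)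
    moreover have "0 \<le> k * x\<^sup>2" "0 \<le> k * y\<^sup>2" "0 \<le> L\<^sup>2 * k * y\<^sup>2" using k by auto
    ultimately show ?thesis by linarith
  qed
  have g1: "(2 * g + g\<^sup>2) * x\<^sup>2 \<ge> - (2 * k * x\<^sup>2)"
  proof -
    have "- (2 * k) \<le> 2 * g + g\<^sup>2" using g zero_le_power2[of g] by linarith
    then have "- (2 * k) * x\<^sup>2 \<le> (2 * g + g\<^sup>2) * x\<^sup>2" by (rule mult_right_mono) simp
    then show ?thesis by simp
  qed
  have g2: "4 * (g * (e \<bullet> c)) \<le> 2 * k * x\<^sup>2 + 2 * k * y\<^sup>2"
  proof -
    have "g * (e \<bullet> c) \<le> \<bar>g\<bar> * \<bar>e \<bullet> c\<bar>" by (metis abs_ge_self abs_mult)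
    also have "\<dots> \<le> k * (x * y)" using g ec k by (intro mult_mono) auto
    finally have "4 * (g * (e \<bullet> c)) \<le> 4 * (k * (x * y))" by simp
    also have "4 * (k * (x * y)) \<le> 2 * k * x\<^sup>2 + 2 * k * y\<^sup>2"
      using mult_nonneg_nonneg[OF less_imp_le[OF k(1)] zero_le_power2[of "x - y"]] by (simp add: power2_eq_square algebra_simps)
    finally show ?thesis .
  qed
  have "((norm a)\<^sup>2 + (norm (2 *\<^sub>R a - c))\<^sup>2) - ((norm e)\<^sup>2 + (norm (2 *\<^sub>R e - c))\<^sup>2)
     = 5 * ((2 * g + g\<^sup>2) * x\<^sup>2) + (5 * \<sigma>\<^sup>2 + \<sigma> * R) - 4 * (g * (e \<bullet> c))"
    unfolding dbl ac R_def a2 x_def[symmetric] by (simp add: power2_eq_square algebra_simps)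
  also have "\<dots> \<ge> 5 * (- (2 * k * x\<^sup>2)) - R\<^sup>2 / 20 - (2 * k * x\<^sup>2 + 2 * k * y\<^sup>2)"
    using g1 g2 s1 by linarith
  finally have "((norm a)\<^sup>2 + (norm (2 *\<^sub>R a - c))\<^sup>2) - ((norm e)\<^sup>2 + (norm (2 *\<^sub>R e - c))\<^sup>2)
     \<ge> - (34 * (k * x\<^sup>2) + 5 * (k * y\<^sup>2) + 3 * (L\<^sup>2 * k * y\<^sup>2))" using R2 by (simp add: algebra_simps)
  moreover have "34 * (k * x\<^sup>2) + 5 * (k * y\<^sup>2) + 3 * (L\<^sup>2 * k * y\<^sup>2) \<le> (40 + 4 * L\<^sup>2) * k * (x\<^sup>2 + y\<^sup>2)"
  proof -
    have "0 \<le> k * x\<^sup>2" "0 \<le> k * y\<^sup>2" "0 \<le> L\<^sup>2 * k * y\<^sup>2" "0 \<le> L\<^sup>2 * k * x\<^sup>2" using k by auto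
    then show ?thesis by (simp add: algebra_simps)
  qed
  ultimately show ?thesis unfolding x_def y_def by linarith
qed

lemma projection_G_grid:
  fixes mt m M m1 M1 :: grid and g :: "nat \<times> nat \<times> nat \<Rightarrow> real"
  assumes k: "0 < k" "k \<le> 1"
    and P: "\<And>p. p \<in> inner_pts N \<Longrightarrow> mt p \<noteq> 0 \<and> m p = unitv (mt p) \<and> norm (M p) = 1 \<and> norm (M1 p) = 1 \<and> norm (m1 p) = 1
        \<and> \<bar>g p\<bar> \<le> k \<and> (norm (m p - M p))\<^sup>2 \<le> k \<and> (norm (m1 p - M1 p))\<^sup>2 \<le> k \<and> norm (M p - M1 p) \<le> L * k"
  defines "a \<equiv> (\<lambda>p. mt p - (1 + g p) *\<^sub>R M p)" and "e \<equiv> (\<lambda>p. m p - M p)" and "c \<equiv> (\<lambda>p. m1 p - M1 p)"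
  shows "l2sq N e + l2sq N (\<lambda>p. 2 *\<^sub>R e p - c p) \<le> l2sq N a + l2sq N (\<lambda>p. 2 *\<^sub>R a p - c p) + (40 + 4 * L\<^sup>2) * k * (l2sq N e + l2sq N c)"
proof -
  have "gmean N (\<lambda>p. (norm (e p))\<^sup>2 + (norm (2 *\<^sub>R e p - c p))\<^sup>2)
    \<le> gmean N (\<lambda>p. (norm (a p))\<^sup>2 + (norm (2 *\<^sub>R a p - c p))\<^sup>2 + (40 + 4 * L\<^sup>2) * k * ((norm (e p))\<^sup>2 + (norm (c p))\<^sup>2))"
  proof (rule gmean_mono)
    fix p assume p: "p \<in> inner_pts N"
    have m: "norm (m p) = 1" "mt p = norm (mt p) *\<^sub>R m p" using P[OF p] by (auto simp: norm_nz) (simp add: unitv_def)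
    \<comment> \<open>The length defect \<open>norm (mt p) - 1 - g p\<close> takes the place of
      \<sigma>.\<close>
    have "a p = (1 + g p) *\<^sub>R (m p - M p) + (norm (mt p) - 1 - g p) *\<^sub>R m p"
      unfolding a_def by (subst m(2)) (simp add: algebra_simps)
    then show "(norm (e p))\<^sup>2 + (norm (2 *\<^sub>R e p - c p))\<^sup>2
      \<le> (norm (a p))\<^sup>2 + (norm (2 *\<^sub>R a p - c p))\<^sup>2 + (40 + 4 * L\<^sup>2) * k * ((norm (e p))\<^sup>2 + (norm (c p))\<^sup>2)"
      unfolding e_def c_def using P[OF p] m(1) k by (intro projection_G_norm) auto
  qed
  then show ?thesis by (simp only: gmean_add gmean_cmult l2sq_def)
qed

section \<open>Even reflection of the exact solution\<close>

lemma hvd_affine: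
  assumes F: "(F has_vector_derivative D) (at (a + c * s) within T)" and S: "\<And>r. r \<in> S \<Longrightarrow> a + c * r \<in> T"
  shows "((\<lambda>r. F (a + c * r)) has_vector_derivative c *\<^sub>R D) (at s within S)"
proof -
  have 1: "((\<lambda>r. a + c * r) has_vector_derivative c) (at s within S)"
    by (auto intro!: derivative_eq_intros)
  have 2: "(F has_vector_derivative D) (at (a + c * s) within (\<lambda>r. a + c * r) ` S)"
    using F by (rule has_vector_derivative_within_subset) (use S in auto)
  show ?thesis using vector_diff_chain_within[OF 1 2] by (simp add: o_def)
qed

lemma hvd_union:
  assumes "(f has_vector_derivative D) (at x within S)" "(f has_vector_derivative D) (at x within T)"
  shows "(f has_vector_derivative D) (at x within (S \<union> T))"
  using assms unfolding has_vector_derivative_def has_derivative_within by (auto intro: Lim_Un)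

text \<open>A vacuous derivative, the limit filter being trivial. It lets
  \<open>hvd_three_pieces\<close> glue its pieces without treating the break points
  separately.\<close>

lemma hvd_outside: "x \<notin> S \<Longrightarrow> closed S \<Longrightarrow> (f has_vector_derivative D) (at x within S)"
  unfolding has_vector_derivative_def has_derivative_within
  by (auto simp: not_in_closure_trivial_limitI bounded_linear_scaleR_left)

text \<open>One reflection at 0 and one at 1 suffice, since only [-1, 2] is ever visited.\<close>

definition refl :: "real \<Rightarrow> real" where "refl r = (if r < 0 then - r else if r > 1 then 2 - r else r)"
text \<open>The derivative of \<open>refl\<close>, with the value 1 chosen at the break points;
  whatever it multiplies vanishes there.\<close>

definition refl_sgn :: "real \<Rightarrow> real" where "refl_sgn r = (if r < 0 \<or> r > 1 then -1 else 1)"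

lemma refl_bounds: "-1 \<le> r \<Longrightarrow> r \<le> 2 \<Longrightarrow> 0 \<le> refl r \<and> refl r \<le> 1" by (auto simp: refl_def)
lemma refl_id: "0 \<le> r \<Longrightarrow> r \<le> 1 \<Longrightarrow> refl r = r" by (auto simp: refl_def)
lemma refl_lipschitz: "\<bar>refl r - refl s\<bar> \<le> \<bar>r - s\<bar>" by (auto simp: refl_def)
lemma abs_sg [simp]: "\<bar>refl_sgn r\<bar> = 1" by (auto simp: refl_sgn_def)

text \<open>The factor \<open>c\<close> is 1 for an even and -1 for an odd extension. The prescribed
  values must agree at the break points, which is where vanishing at 0 and 1 enters.\<close>

lemma hvd_three_pieces:
  fixes F :: "real \<Rightarrow> 'a::real_normed_vector"
  assumes F: "\<And>r. r \<in> {0..1} \<Longrightarrow> (F has_vector_derivative F' r) (at r within {0..1})"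
    and G0: "\<And>r. r \<in> {-1..0} \<Longrightarrow> G r = c *\<^sub>R F (- r)" and G1: "\<And>r. r \<in> {0..1} \<Longrightarrow> G r = F r"
    and G2: "\<And>r. r \<in> {1..2} \<Longrightarrow> G r = c *\<^sub>R F (2 - r)"
    and D0: "\<And>r. r \<in> {-1..0} \<Longrightarrow> G' r = - (c *\<^sub>R F' (- r))" and D1: "\<And>r. r \<in> {0..1} \<Longrightarrow> G' r = F' r"
    and D2: "\<And>r. r \<in> {1..2} \<Longrightarrow> G' r = - (c *\<^sub>R F' (2 - r))" and r: "r \<in> {-1..2}"
  shows "(G has_vector_derivative G' r) (at r within {-1..2})"
proof -
  have a: "(G has_vector_derivative G' r) (at r within {-1..0})"
  proof (cases "r \<in> {-1..0}")
    case True
    have "((\<lambda>r. F (0 + (-1) * r)) has_vector_derivative (-1) *\<^sub>R F' (- r)) (at r within {-1..0})"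
      by (rule hvd_affine[where T="{0..1}"]) (use F[of "- r"] True in auto)
    then have "((\<lambda>r. c *\<^sub>R F (- r)) has_vector_derivative c *\<^sub>R (- F' (- r))) (at r within {-1..0})"
      by (intro has_vector_derivative_scaleR[where f="\<lambda>_. c" and f'=0, simplified]) auto
    then show ?thesis using True D0[OF True] by (auto intro: has_vector_derivative_weaken simp: G0)
  qed (auto intro: hvd_outside)
  have b: "(G has_vector_derivative G' r) (at r within {0..1})"
  proof (cases "r \<in> {0..1}")
    case True
    then show ?thesis using F[OF True] D1[OF True] by (auto intro: has_vector_derivative_weaken simp: G1)
  qed (auto intro: hvd_outside)
  have c: "(G has_vector_derivative G' r) (at r within {1..2})"
  proof (cases "r \<in> {1..2}")
    case True
    have "((\<lambda>r. F (2 + (-1) * r)) has_vector_derivative (-1) *\<^sub>R F' (2 - r)) (at r within {1..2})"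
      by (rule hvd_affine[where T="{0..1}"]) (use F[of "2 - r"] True in auto)
    then have "((\<lambda>r. c *\<^sub>R F (2 - r)) has_vector_derivative c *\<^sub>R (- F' (2 - r))) (at r within {1..2})"
      by (intro has_vector_derivative_scaleR[where f="\<lambda>_. c" and f'=0, simplified]) auto
    then show ?thesis using True D2[OF True] by (auto intro: has_vector_derivative_weaken simp: G2)
  qed (auto intro: hvd_outside)
  have "{-1..0} \<union> {0..1} \<union> {1..2} = {-1..(2::real)}" by auto
  then show ?thesis using hvd_union[OF hvd_union[OF a b] c] by metis
qed

lemma hvd_even_extension:
  fixes F :: "real \<Rightarrow> 'a::real_normed_vector"
  assumes F: "\<And>r. r \<in> {0..1} \<Longrightarrow> (F has_vector_derivative F' r) (at r within {0..1})"
    and z: "F' 0 = 0" "F' 1 = 0" and r: "r \<in> {-1..2}"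
  shows "((\<lambda>r. F (refl r)) has_vector_derivative refl_sgn r *\<^sub>R F' (refl r)) (at r within {-1..2})"
  by (rule hvd_three_pieces[OF F, where c=1]) (use z r in \<open>auto simp: refl_def refl_sgn_def\<close>)

lemma hvd_odd_extension:
  fixes F :: "real \<Rightarrow> 'a::real_normed_vector"
  assumes F: "\<And>r. r \<in> {0..1} \<Longrightarrow> (F has_vector_derivative F' r) (at r within {0..1})"
    and z: "F 0 = 0" "F 1 = 0" and r: "r \<in> {-1..2}"
  shows "((\<lambda>r. refl_sgn r *\<^sub>R F (refl r)) has_vector_derivative F' (refl r)) (at r within {-1..2})"
  by (rule hvd_three_pieces[OF F, where c="-1"]) (use z r in \<open>auto simp: refl_def refl_sgn_def\<close>)

text \<open>If the signs differ, the points lie on opposite sides of a wall, where \<open>K\<close>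
  vanishes, and their distances from it add up to at most \<open>\<bar>r - s\<bar>\<close>.\<close>

lemma lipschitz_odd_extension:
  fixes K :: "real \<Rightarrow> 'a::real_normed_vector"
  assumes K: "\<And>r s. r \<in> {0..1} \<Longrightarrow> s \<in> {0..1} \<Longrightarrow> norm (K r - K s) \<le> B * \<bar>r - s\<bar>"
    and z: "K 0 = 0" "K 1 = 0" and r: "r \<in> {-1..2}" and s: "s \<in> {-1..2}"
  shows "norm (refl_sgn r *\<^sub>R K (refl r) - refl_sgn s *\<^sub>R K (refl s)) \<le> B * \<bar>r - s\<bar>"
proof -
  have B0: "B \<ge> 0" using K[of 0 1] norm_ge_zero[of "K 0 - K 1"] by (simp del: norm_ge_zero)
  have f: "refl r \<in> {0..1}" "refl s \<in> {0..1}" using refl_bounds r s by auto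
  show ?thesis
  proof (cases "refl_sgn r = refl_sgn s")
    case True
    have "norm (refl_sgn r *\<^sub>R K (refl r) - refl_sgn s *\<^sub>R K (refl s)) = norm (K (refl r) - K (refl s))"
      unfolding True by (simp flip: scaleR_diff_right)
    also have "\<dots> \<le> B * \<bar>refl r - refl s\<bar>" by (rule K[OF f])
    also have "\<dots> \<le> B * \<bar>r - s\<bar>" by (rule mult_left_mono[OF refl_lipschitz B0])
    finally show ?thesis .
  next
    case False
    have b: "norm (K a) \<le> B * a" "norm (K a) \<le> B * (1 - a)" if "a \<in> {0..1}" for a
      using K[OF that, of 0] K[OF that, of 1] z that by auto
    have "norm (refl_sgn r *\<^sub>R K (refl r) - refl_sgn s *\<^sub>R K (refl s)) \<le> norm (K (refl r)) + norm (K (refl s))"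
      using norm_triangle_ineq4[of "refl_sgn r *\<^sub>R K (refl r)" "refl_sgn s *\<^sub>R K (refl s)"] by simp
    also have "\<dots> \<le> B * \<bar>r - s\<bar>"
    proof -
      have "refl r + refl s \<le> \<bar>r - s\<bar> \<or> (1 - refl r) + (1 - refl s) \<le> \<bar>r - s\<bar>"
        using False r s by (auto simp: refl_def refl_sgn_def split: if_splits)
      then show ?thesis
      proof
        assume "refl r + refl s \<le> \<bar>r - s\<bar>"
        then have "B * (refl r + refl s) \<le> B * \<bar>r - s\<bar>" by (rule mult_left_mono[OF _ B0])
        then show ?thesis using b(1)[OF f(1)] b(1)[OF f(2)] by (simp add: algebra_simps)
      next
        assume "(1 - refl r) + (1 - refl s) \<le> \<bar>r - s\<bar>"
        then have "B * ((1 - refl r) + (1 - refl s)) \<le> B * \<bar>r - s\<bar>" by (rule mult_left_mono[OF _ B0])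
        then show ?thesis using b(2)[OF f(1)] b(2)[OF f(2)] by (simp add: algebra_simps)
      qed
    qed
    finally show ?thesis .
  qed
qed

section \<open>Reflection of the cube, one coordinate at a time\<close>

text \<open>Coordinate lines are parametrised by the value of a coordinate and not by an increment,
  because reflection commutes with replacing a coordinate (\<open>refl_pt_upd\<close>).\<close>

definition upd :: "real^3 \<Rightarrow> 3 \<Rightarrow> real \<Rightarrow> real^3" where "upd x d r = (\<chi> i. if i = d then r else x $ i)"

lemma upd_nth [simp]: "upd x d r $ i = (if i = d then r else x $ i)" by (simp add: upd_def)
lemma add_axis_upd: "x + s *\<^sub>R axis d 1 = upd x d (x $ d + s)" by (simp add: vec_eq_iff axis_def)
lemma upd_axis: "upd x d r + s *\<^sub>R axis d 1 = upd x d (r + s)" by (simp add: vec_eq_iff axis_def)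

definition refl_pt :: "real^3 \<Rightarrow> real^3" where "refl_pt x = (\<chi> i. refl (x $ i))"
definition xbox :: "(real^3) set" where "xbox = {x. \<forall>i. -1 \<le> x $ i \<and> x $ i \<le> 2}"

lemma xbox_nth: "x \<in> xbox \<Longrightarrow> x $ i \<in> {-1..2}" by (simp add: xbox_def)
lemma refl_pt_nth [simp]: "refl_pt x $ i = refl (x $ i)" by (simp add: refl_pt_def)
lemma refl_pt_upd: "refl_pt (upd x d r) = upd (refl_pt x) d (refl r)" by (simp add: vec_eq_iff)
lemma refl_pt_cube: "x \<in> xbox \<Longrightarrow> refl_pt x \<in> cube" using refl_bounds by (auto simp: xbox_def cube_def)
lemma refl_pt_id: "x \<in> cube \<Longrightarrow> refl_pt x = x" by (auto simp: vec_eq_iff cube_def refl_id)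
lemma cube_xbox: "x \<in> cube \<Longrightarrow> x \<in> xbox"
  unfolding cube_def xbox_def by (auto intro: order_trans[of "-1::real" 0] order_trans[of _ "1::real" 2])
lemma cube_upd: "x \<in> cube \<Longrightarrow> r \<in> {0..1} \<Longrightarrow> upd x d r \<in> cube" by (auto simp: cube_def)
lemma xbox_upd: "x \<in> xbox \<Longrightarrow> upd x d r \<in> xbox \<longleftrightarrow> r \<in> {-1..2}" by (auto simp: xbox_def)

text \<open>\<open>spatial_deriv\<close> is anchored at parameter 0 of a point; here the point moves
  along a segment, with a speed \<open>c\<close> that allows for symmetric differences.\<close>

lemma sd_path:
  assumes sd: "spatial_deriv f i g" and S: "\<And>s. s \<in> S \<Longrightarrow> x + (c * s) *\<^sub>R axis i 1 \<in> cube" and s: "s \<in> S"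
  shows "((\<lambda>s. f (x + (c * s) *\<^sub>R axis i 1)) has_vector_derivative c *\<^sub>R g (x + (c * s) *\<^sub>R axis i 1)) (at s within S)"
proof -
  let ?y = "x + (c * s) *\<^sub>R axis i 1"
  have e: "?y + (- c * s + c * r) *\<^sub>R axis i 1 = x + (c * r) *\<^sub>R axis i 1" for r by (simp add: algebra_simps)
  have "((\<lambda>s. f (?y + s *\<^sub>R axis i 1)) has_vector_derivative g ?y) (at (- c * s + c * s) within {s. ?y + s *\<^sub>R axis i 1 \<in> cube})"
    using sd S[OF s] by (simp add: spatial_deriv_def)
  then have "((\<lambda>r. f (?y + (- c * s + c * r) *\<^sub>R axis i 1)) has_vector_derivative c *\<^sub>R g ?y) (at s within S)"
    by (rule hvd_affine) (use S in \<open>auto simp only: e mem_Collect_eq\<close>)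
  then show ?thesis unfolding e .
qed

lemma sd_upd:
  assumes "spatial_deriv f i g" "x \<in> cube" "r \<in> {0..1}"
  shows "((\<lambda>r. f (upd x i r)) has_vector_derivative g (upd x i r)) (at r within {0..1})"
  using sd_path[OF assms(1), of "{0..1}" "upd x i 0" 1 r] assms cube_upd[OF assms(2)]
  by (simp add: upd_axis)

text \<open>The part of the C^4 regularity that survives at every time: Lipschitz and
  second-difference bounds on the second derivatives stand in for the third and fourth
  derivatives.\<close>

definition smooth3 :: "real \<Rightarrow> (real^3 \<Rightarrow> real^3) \<Rightarrow> (3 \<Rightarrow> real^3 \<Rightarrow> real^3) \<Rightarrow> (3 \<Rightarrow> 3 \<Rightarrow> real^3 \<Rightarrow> real^3) \<Rightarrow> bool" where
  "smooth3 B f g H \<longleftrightarrow>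
     (\<forall>i. spatial_deriv f i (g i)) \<and> (\<forall>i j. spatial_deriv (g i) j (H i j)) \<and> (\<forall>i j. H i j = H j i) \<and>
     (\<forall>x\<in>cube. \<forall>i j. norm (g i x) \<le> B \<and> norm (H i j x) \<le> B) \<and>
     (\<forall>i j l x s. x \<in> cube \<and> x + s *\<^sub>R axis l 1 \<in> cube \<longrightarrow> norm (H i j (x + s *\<^sub>R axis l 1) - H i j x) \<le> B * \<bar>s\<bar>) \<and>
     (\<forall>i x s. x + s *\<^sub>R axis i 1 \<in> cube \<and> x + (- s) *\<^sub>R axis i 1 \<in> cube \<longrightarrow>
        norm (H i i (x + s *\<^sub>R axis i 1) + H i i (x + (- s) *\<^sub>R axis i 1) - 2 *\<^sub>R H i i x) \<le> B * s\<^sup>2) \<and>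
     (\<forall>x\<in>cube. \<forall>i. x $ i = 0 \<or> x $ i = 1 \<longrightarrow> g i x = 0)"

locale smooth =
  fixes B f g H
  assumes sm: "smooth3 B f g H"
begin

lemma f_sd: "spatial_deriv f i (g i)" and g_sd: "spatial_deriv (g i) j (H i j)" and H_sym: "H i j = H j i"
  and g_bd: "x \<in> cube \<Longrightarrow> norm (g i x) \<le> B" and H_bd: "x \<in> cube \<Longrightarrow> norm (H i j x) \<le> B"
  and H_lip: "x \<in> cube \<Longrightarrow> x + s *\<^sub>R axis l 1 \<in> cube \<Longrightarrow> norm (H i j (x + s *\<^sub>R axis l 1) - H i j x) \<le> B * \<bar>s\<bar>"
  and H_sec: "x + s *\<^sub>R axis i 1 \<in> cube \<Longrightarrow> x + (- s) *\<^sub>R axis i 1 \<in> cube \<Longrightarrow>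
        norm (H i i (x + s *\<^sub>R axis i 1) + H i i (x + (- s) *\<^sub>R axis i 1) - 2 *\<^sub>R H i i x) \<le> B * s\<^sup>2"
  and g_wall: "x \<in> cube \<Longrightarrow> x $ i = 0 \<or> x $ i = 1 \<Longrightarrow> g i x = 0"
  using sm unfolding smooth3_def by blast+

lemma B0: "B \<ge> 0"
proof -
  have "(0::real^3) \<in> cube" by (simp add: cube_def)
  then show ?thesis by (rule order_trans[OF norm_ge_zero g_bd])
qed

text \<open>The normal derivative is zero along the whole wall, so its tangential derivative is zero
  there as well.\<close>

lemma mixed_wall1:
  assumes x: "x \<in> cube" and de: "d \<noteq> e" and w: "x $ d = 0 \<or> x $ d = 1"
  shows "H d e x = 0"
proof -
  have r: "x $ e \<in> {0..1}" using x by (auto simp: cube_def)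
  have 1: "((\<lambda>r. g d (upd x e r)) has_vector_derivative H d e (upd x e (x $ e))) (at (x $ e) within {0..1})"
    by (rule sd_upd[OF g_sd x r])
  have "((\<lambda>r. 0) has_vector_derivative H d e (upd x e (x $ e))) (at (x $ e) within {0..1})"
    using 1 r by (rule has_vector_derivative_weaken) (use g_wall[of "upd x e _" d] cube_upd[OF x] de w in auto)
  then have "H d e (upd x e (x $ e)) = 0"
    using vector_derivative_unique_within_closed_interval[of 0 1 "x $ e" "\<lambda>r. 0" "H d e (upd x e (x $ e))" 0] r
    by (simp add: cbox_interval)
  moreover have "upd x e (x $ e) = x" by (simp add: vec_eq_iff)
  ultimately show ?thesis by simp
qed

lemma mixed_wall:
  assumes "x \<in> cube" "d \<noteq> e" "x $ d = 0 \<or> x $ d = 1 \<or> x $ e = 0 \<or> x $ e = 1"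
  shows "H d e x = 0"
  using mixed_wall1[of x d e] mixed_wall1[of x e d] assms H_sym[of d e] by metis

definition U where "U x = f (refl_pt x)"
definition W where "W d x = refl_sgn (x $ d) *\<^sub>R g d (refl_pt x)"
text \<open>Pure second derivatives of the even extension are even and may be nonzero on the walls.
  Mixed ones are odd in both directions but vanish on the walls (\<open>mixed_wall\<close>), so
  their sign changes cause no jump.\<close>

definition HH where "HH d e x = (if d = e then H d d (refl_pt x) else (refl_sgn (x $ d) * refl_sgn (x $ e)) *\<^sub>R H d e (refl_pt x))"

lemma W_bd: "x \<in> xbox \<Longrightarrow> norm (W d x) \<le> B"
  using g_bd[OF refl_pt_cube] by (simp add: W_def)

lemma HH_bd: "x \<in> xbox \<Longrightarrow> norm (HH d e x) \<le> B"
  using H_bd[OF refl_pt_cube] by (simp add: HH_def abs_mult)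

lemma U_deriv0:
  assumes x: "x \<in> xbox" and r: "r \<in> {-1..2}"
  shows "((\<lambda>r. U (upd x d r)) has_vector_derivative W d (upd x d r)) (at r within {-1..2})"
  unfolding U_def W_def refl_pt_upd upd_nth if_True simp_thms
  using hvd_even_extension[of "\<lambda>r. f (upd (refl_pt x) d r)" "\<lambda>r. g d (upd (refl_pt x) d r)" r] r
    sd_upd[OF f_sd refl_pt_cube[OF x]] g_wall[OF cube_upd[OF refl_pt_cube[OF x]]]
  by simp

lemma W_deriv0:
  assumes x: "x \<in> xbox" and r: "r \<in> {-1..2}"
  shows "((\<lambda>r. W d (upd x e r)) has_vector_derivative HH d e (upd x e r)) (at r within {-1..2})"
proof (cases "d = e")
  case True
  show ?thesis
    unfolding W_def HH_def refl_pt_upd True upd_nth if_True simp_thms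
    using hvd_odd_extension[of "\<lambda>r. g e (upd (refl_pt x) e r)" "\<lambda>r. H e e (upd (refl_pt x) e r)" r] r
      sd_upd[OF g_sd refl_pt_cube[OF x]] g_wall[OF cube_upd[OF refl_pt_cube[OF x]]]
    by simp
next
  case False
  have 1: "((\<lambda>r. g d (upd (refl_pt x) e (refl r))) has_vector_derivative refl_sgn r *\<^sub>R H d e (upd (refl_pt x) e (refl r))) (at r within {-1..2})"
    by (rule hvd_even_extension[of "\<lambda>r. g d (upd (refl_pt x) e r)" "\<lambda>r. H d e (upd (refl_pt x) e r)"])
      (use r sd_upd[OF g_sd refl_pt_cube[OF x]] mixed_wall[OF cube_upd[OF refl_pt_cube[OF x]] False] in auto)
  have "((\<lambda>r. refl_sgn (x $ d) *\<^sub>R g d (upd (refl_pt x) e (refl r))) has_vector_derivative refl_sgn (x $ d) *\<^sub>R (refl_sgn r *\<^sub>R H d e (upd (refl_pt x) e (refl r)))) (at r within {-1..2})"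
    by (rule has_vector_derivative_scaleR[where f="\<lambda>_. refl_sgn (x $ d)" and f'=0, simplified]) (rule 1)
  then show ?thesis using False unfolding W_def HH_def refl_pt_upd by simp
qed

lemma U_deriv:
  assumes S: "\<And>s. s \<in> S \<Longrightarrow> x + s *\<^sub>R axis d 1 \<in> xbox" and s: "s \<in> S"
  shows "((\<lambda>s. U (x + s *\<^sub>R axis d 1)) has_vector_derivative W d (x + s *\<^sub>R axis d 1)) (at s within S)"
proof -
  let ?y = "x + s *\<^sub>R axis d 1"
  have y: "?y \<in> xbox" using S s by blast
  have u: "upd ?y d (x $ d + 1 * r) = x + r *\<^sub>R axis d 1" for r by (simp add: vec_eq_iff axis_def)
  have "((\<lambda>r. U (upd ?y d (x $ d + 1 * r))) has_vector_derivative 1 *\<^sub>R W d (upd ?y d (x $ d + 1 * s))) (at s within S)"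
  proof (rule hvd_affine[where T="{-1..2}"])
    show in_T: "x $ d + 1 * r \<in> {-1..2}" if "r \<in> S" for r
    proof -
      have "(x + r *\<^sub>R axis d 1) $ d \<in> {-1..2}" using S[OF that] by (rule xbox_nth)
      then show ?thesis by simp
    qed
    show "((\<lambda>a. U (upd ?y d a)) has_vector_derivative W d (upd ?y d (x $ d + 1 * s))) (at (x $ d + 1 * s) within {-1..2})"
      by (rule U_deriv0[OF y in_T[OF s]])
  qed
  then show ?thesis unfolding u by simp
qed

lemma W_deriv:
  assumes S: "\<And>s. s \<in> S \<Longrightarrow> x + s *\<^sub>R axis d 1 \<in> xbox" and s: "s \<in> S"
  shows "((\<lambda>s. W e (x + s *\<^sub>R axis d 1)) has_vector_derivative HH e d (x + s *\<^sub>R axis d 1)) (at s within S)"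
proof -
  let ?y = "x + s *\<^sub>R axis d 1"
  have y: "?y \<in> xbox" using S s by blast
  have u: "upd ?y d (x $ d + 1 * r) = x + r *\<^sub>R axis d 1" for r by (simp add: vec_eq_iff axis_def)
  have "((\<lambda>r. W e (upd ?y d (x $ d + 1 * r))) has_vector_derivative 1 *\<^sub>R HH e d (upd ?y d (x $ d + 1 * s))) (at s within S)"
  proof (rule hvd_affine[where T="{-1..2}"])
    show in_T: "x $ d + 1 * r \<in> {-1..2}" if "r \<in> S" for r
    proof -
      have "(x + r *\<^sub>R axis d 1) $ d \<in> {-1..2}" using S[OF that] by (rule xbox_nth)
      then show ?thesis by simp
    qed
    show "((\<lambda>a. W e (upd ?y d a)) has_vector_derivative HH e d (upd ?y d (x $ d + 1 * s))) (at (x $ d + 1 * s) within {-1..2})"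
      by (rule W_deriv0[OF y in_T[OF s]])
  qed
  then show ?thesis unfolding u by simp
qed

text \<open>Along direction \<open>l\<close> the second derivative is reflected oddly only if
  \<open>l\<close> is one of two different indices, and then it vanishes at both walls by
  \<open>mixed_wall\<close>; otherwise the reflection is even.\<close>

lemma HH_lip0:
  assumes x: "x \<in> xbox" and r: "r \<in> {-1..2}" and s: "s \<in> {-1..2}"
  shows "norm (HH d e (upd x l r) - HH d e (upd x l s)) \<le> B * \<bar>r - s\<bar>"
proof -
  define K where "K r = H d e (upd (refl_pt x) l r)" for r
  have K: "norm (K r - K s) \<le> B * \<bar>r - s\<bar>" if "r \<in> {0..1}" "s \<in> {0..1}" for r s
    using H_lip[OF cube_upd[OF refl_pt_cube[OF x] that(2)], of l "r - s" l d e] cube_upd[OF refl_pt_cube[OF x] that(1)]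
    unfolding K_def upd_axis by simp
  have f: "refl r \<in> {0..1}" "refl s \<in> {0..1}" using refl_bounds r s by auto
  have ev: "norm (K (refl r) - K (refl s)) \<le> B * \<bar>r - s\<bar>"
    using K[OF f] mult_left_mono[OF refl_lipschitz[of r s] B0] by linarith
  show ?thesis
  proof (cases "d = e")
    case True
    then show ?thesis using ev by (simp add: HH_def refl_pt_upd K_def)
  next
    case de: False
    show ?thesis
    proof (cases "l = d \<or> l = e")
      case True
      define c where "c = refl_sgn (x $ (if l = d then e else d))"
      have z: "K 0 = 0" "K 1 = 0"
        unfolding K_def by (rule mixed_wall[OF cube_upd[OF refl_pt_cube[OF x]] de], use True in auto)+
      have e: "HH d e (upd x l q) = c *\<^sub>R (refl_sgn q *\<^sub>R K (refl q))" for q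
        using True de by (auto simp: HH_def refl_pt_upd K_def c_def)
      have "\<bar>c\<bar> = 1" by (simp add: c_def)
      then have "norm (HH d e (upd x l r) - HH d e (upd x l s)) = norm (refl_sgn r *\<^sub>R K (refl r) - refl_sgn s *\<^sub>R K (refl s))"
        unfolding e scaleR_diff_right[symmetric] norm_scaleR by simp
      then show ?thesis using lipschitz_odd_extension[OF K z r s] by simp
    next
      case False
      then have "HH d e (upd x l q) = (refl_sgn (x $ d) * refl_sgn (x $ e)) *\<^sub>R K (refl q)" for q
        using de by (auto simp: HH_def refl_pt_upd K_def)
      then have "norm (HH d e (upd x l r) - HH d e (upd x l s)) = norm (K (refl r) - K (refl s))"
        by (simp add: abs_mult flip: scaleR_diff_right)
      then show ?thesis using ev by simp
    qed
  qed
qed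

lemma HH_lip:
  assumes x: "x \<in> xbox" and y: "x + s *\<^sub>R axis l 1 \<in> xbox"
  shows "norm (HH d e (x + s *\<^sub>R axis l 1) - HH d e x) \<le> B * \<bar>s\<bar>"
proof -
  have "x $ l \<in> {-1..2}" using x by (rule xbox_nth)
  moreover have "x $ l + s \<in> {-1..2}"
    using y unfolding add_axis_upd xbox_upd[OF x] .
  moreover have "x = upd x l (x $ l)" by (simp add: vec_eq_iff)
  ultimately show ?thesis using HH_lip0[OF x, of "x $ l + s" "x $ l" d e l] by (simp add: add_axis_upd)
qed

lemma xbox_seg:
  assumes "x \<in> xbox" "x + h *\<^sub>R axis d 1 \<in> xbox" "0 \<le> s" "s \<le> h"
  shows "x + s *\<^sub>R axis d 1 \<in> xbox"
  using assms xbox_nth[OF assms(1), of d] xbox_nth[OF assms(2), of d]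
  by (simp add: add_axis_upd xbox_upd)

lemma U_lip:
  assumes "x \<in> xbox" "x + h *\<^sub>R axis d 1 \<in> xbox" "0 \<le> h"
  shows "norm (U (x + h *\<^sub>R axis d 1) - U x) \<le> B * h"
  using vector_mvt_bound[of h "\<lambda>s. U (x + s *\<^sub>R axis d 1)" "\<lambda>s. W d (x + s *\<^sub>R axis d 1)" B]
    U_deriv[of "{0..h}" x d] W_bd[of "x + _ *\<^sub>R axis d 1" d] xbox_seg[OF assms(1,2)] assms
  by simp

lemma W_lip0:
  assumes "x \<in> xbox" "x + h *\<^sub>R axis d 1 \<in> xbox" "0 \<le> h"
  shows "norm (W e (x + h *\<^sub>R axis d 1) - W e x) \<le> B * h"
  using vector_mvt_bound[of h "\<lambda>s. W e (x + s *\<^sub>R axis d 1)" "\<lambda>s. HH e d (x + s *\<^sub>R axis d 1)" B]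
    W_deriv[where S="{0..h}" and x=x and d=d and e=e] HH_bd[of "x + _ *\<^sub>R axis d 1" e d] xbox_seg[OF assms(1,2)] assms
  by simp

lemma W_lip:
  assumes "x \<in> xbox" "x + s *\<^sub>R axis d 1 \<in> xbox"
  shows "norm (W e (x + s *\<^sub>R axis d 1) - W e x) \<le> B * \<bar>s\<bar>"
proof (cases "s \<ge> 0")
  case False
  have "x + s *\<^sub>R axis d 1 + (- s) *\<^sub>R axis d 1 = x" by simp
  then show ?thesis using W_lip0[OF assms(2), where h="- s" and d=d and e=e] assms False by (simp add: norm_minus_commute)
qed (use W_lip0 assms in auto)

text \<open>Two steps of length at most 1/2 in the same direction stay below 2, and one backward
  step stays above -1; this fits the extended box.\<close>

lemma cube_add:
  assumes x: "x \<in> cube" and h: "0 \<le> \<tau>" "\<tau> \<le> h" "h \<le> 1/2" and s: "s \<in> {0..h}" and r: "r \<in> {0..h}"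
  shows "x + (- \<tau>) *\<^sub>R axis c 1 + s *\<^sub>R axis d 1 + r *\<^sub>R axis b 1 \<in> xbox"
  unfolding xbox_def
proof (clarify)
  fix i
  have "0 \<le> x $ i" "x $ i \<le> 1" using x by (auto simp: cube_def)
  then show "-1 \<le> (x + (- \<tau>) *\<^sub>R axis c 1 + s *\<^sub>R axis d 1 + r *\<^sub>R axis b 1) $ i
     \<and> (x + (- \<tau>) *\<^sub>R axis c 1 + s *\<^sub>R axis d 1 + r *\<^sub>R axis b 1) $ i \<le> 2"
    using h s r by (auto simp: axis_def)
qed

text \<open>The shift \<tau> will be 0 or \<open>h\<close>, according to which of the two points
  averaged by \<open>avgA\<close> is the base point; the slope is always taken at
  \<open>x\<close>.\<close>

lemma U_first_order:
  fixes c d :: 3 and \<tau> h :: real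
  assumes x: "x \<in> cube" and h: "0 \<le> \<tau>" "\<tau> \<le> h" "h \<le> 1/2"
  defines "v \<equiv> (- \<tau>) *\<^sub>R axis c (1::real)"
  shows "norm (U (x + v + h *\<^sub>R axis d 1) - U (x + v) - h *\<^sub>R W d x) \<le> 2 * B * h\<^sup>2"
proof -
  define \<phi> where "\<phi> s = U (x + v + s *\<^sub>R axis d 1) - s *\<^sub>R W d x" for s
  have bx: "x + v + s *\<^sub>R axis d 1 \<in> xbox" if "s \<in> {0..h}" for s
    using cube_add[OF x h that, of 0 c d] h by (simp add: v_def)
  have "norm (\<phi> h - \<phi> 0) \<le> (2 * B * h) * h"
  proof (rule vector_mvt_bound)
    fix s assume s: "s \<in> {0..h}"
    show "(\<phi> has_vector_derivative W d (x + v + s *\<^sub>R axis d 1) - W d x) (at s within {0..h})"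
      unfolding \<phi>_def by (intro has_vector_derivative_diff U_deriv bx s) (auto intro!: derivative_eq_intros)
    have 1: "norm (W d (x + v + s *\<^sub>R axis d 1) - W d (x + v)) \<le> B * h"
      using W_lip[of "x + v" s d d] bx[OF s] bx[of 0] s h mult_left_mono[of s h B] B0 by auto
    have 2: "norm (W d (x + v) - W d x) \<le> B * h"
      using W_lip[OF cube_xbox[OF x], of "- \<tau>" c d] bx[of 0] h mult_left_mono[of \<tau> h B] B0 unfolding v_def by auto
    show "norm (W d (x + v + s *\<^sub>R axis d 1) - W d x) \<le> 2 * B * h"
      using norm_triangle_ineq[of "W d (x + v + s *\<^sub>R axis d 1) - W d (x + v)" "W d (x + v) - W d x"] 1 2 by simp
  qed (use h in auto)
  then show ?thesis by (simp add: \<phi>_def power2_eq_square algebra_simps)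
qed

text \<open>The remainder of \<open>U_first_order\<close> changes by only O(h^3) from one cell to
  the next. The change is a double increment, in directions \<open>d\<close> and \<open>b\<close>,
  so two mean value bounds reduce it to the Lipschitz bound on \<open>HH\<close>.\<close>

lemma U_second_order:
  fixes b c d :: 3 and x :: "real^3" and \<tau> h :: real
  assumes x: "x \<in> cube" and h: "0 \<le> \<tau>" "\<tau> \<le> h" "h \<le> 1/2"
  defines "v \<equiv> (- \<tau>) *\<^sub>R axis c (1::real)" and "x' \<equiv> x + h *\<^sub>R axis b 1"
  shows "norm ((U (x' + v + h *\<^sub>R axis d 1) - U (x' + v) - h *\<^sub>R W d x') - (U (x + v + h *\<^sub>R axis d 1) - U (x + v) - h *\<^sub>R W d x)) \<le> 2 * B * h ^ 3"
proof -
  have bx: "x + v + s *\<^sub>R axis d 1 + r *\<^sub>R axis b 1 \<in> xbox" "x + v + r *\<^sub>R axis b 1 \<in> xbox" "x + r *\<^sub>R axis b 1 \<in> xbox"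
    if "s \<in> {0..h}" "r \<in> {0..h}" for s r
    using cube_add[OF x h that, of c d b] cube_add[OF x h, of 0 r c d b] cube_add[OF x, of 0 h 0 r c d b] that h
    by (simp_all add: v_def)
  have W2: "norm ((W d (x + v + s *\<^sub>R axis d 1 + h *\<^sub>R axis b 1) - W d (x + h *\<^sub>R axis b 1)) - (W d (x + v + s *\<^sub>R axis d 1) - W d x)) \<le> 2 * B * h * h"
    if s: "s \<in> {0..h}" for s
  proof -
    define \<psi> where "\<psi> r = W d (x + v + s *\<^sub>R axis d 1 + r *\<^sub>R axis b 1) - W d (x + r *\<^sub>R axis b 1)" for r
    have "norm (\<psi> h - \<psi> 0) \<le> (2 * B * h) * h"
    proof (rule vector_mvt_bound)
      fix r assume r: "r \<in> {0..h}"
      show "(\<psi> has_vector_derivative HH d b (x + v + s *\<^sub>R axis d 1 + r *\<^sub>R axis b 1) - HH d b (x + r *\<^sub>R axis b 1)) (at r within {0..h})"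
        unfolding \<psi>_def by (intro has_vector_derivative_diff W_deriv bx s r)
      have e1: "x + v + r *\<^sub>R axis b 1 + s *\<^sub>R axis d 1 = x + v + s *\<^sub>R axis d 1 + r *\<^sub>R axis b 1" by simp
      have e2: "x + r *\<^sub>R axis b 1 + (- \<tau>) *\<^sub>R axis c 1 = x + v + r *\<^sub>R axis b 1" by (simp add: v_def)
      have 1: "norm (HH d b (x + v + s *\<^sub>R axis d 1 + r *\<^sub>R axis b 1) - HH d b (x + v + r *\<^sub>R axis b 1)) \<le> B * h"
        using HH_lip[of "x + v + r *\<^sub>R axis b 1" s d d b, unfolded e1] bx[OF s r] s mult_left_mono[of s h B] B0 by auto
      have 2: "norm (HH d b (x + v + r *\<^sub>R axis b 1) - HH d b (x + r *\<^sub>R axis b 1)) \<le> B * h"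
        using HH_lip[of "x + r *\<^sub>R axis b 1" "- \<tau>" c d b, unfolded e2] bx[OF s r] h mult_left_mono[of \<tau> h B] B0 by auto
      show "norm (HH d b (x + v + s *\<^sub>R axis d 1 + r *\<^sub>R axis b 1) - HH d b (x + r *\<^sub>R axis b 1)) \<le> 2 * B * h"
        using norm_triangle_ineq[of "HH d b (x + v + s *\<^sub>R axis d 1 + r *\<^sub>R axis b 1) - HH d b (x + v + r *\<^sub>R axis b 1)"
            "HH d b (x + v + r *\<^sub>R axis b 1) - HH d b (x + r *\<^sub>R axis b 1)"] 1 2 by simp
    qed (use h in auto)
    then show ?thesis by (simp add: \<psi>_def)
  qed
  define \<phi> where "\<phi> s = U (x' + v + s *\<^sub>R axis d 1) - U (x + v + s *\<^sub>R axis d 1) - s *\<^sub>R (W d x' - W d x)" for s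
  have e3: "x' + v + s *\<^sub>R axis d 1 = x + v + s *\<^sub>R axis d 1 + h *\<^sub>R axis b 1" for s by (simp add: x'_def)
  have "norm (\<phi> h - \<phi> 0) \<le> (2 * B * h * h) * h"
  proof (rule vector_mvt_bound)
    fix s assume s: "s \<in> {0..h}"
    have b1: "x' + v + q *\<^sub>R axis d 1 \<in> xbox" "x + v + q *\<^sub>R axis d 1 \<in> xbox" if "q \<in> {0..h}" for q
      using bx(1)[OF that, of h] bx(1)[OF that, of 0] h unfolding e3 by auto
    show "(\<phi> has_vector_derivative W d (x' + v + s *\<^sub>R axis d 1) - W d (x + v + s *\<^sub>R axis d 1) - (W d x' - W d x)) (at s within {0..h})"
      unfolding \<phi>_def by (intro has_vector_derivative_diff U_deriv b1 s) (auto intro!: derivative_eq_intros)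
    show "norm (W d (x' + v + s *\<^sub>R axis d 1) - W d (x + v + s *\<^sub>R axis d 1) - (W d x' - W d x)) \<le> 2 * B * h * h"
      using W2[OF s] unfolding e3 by (simp add: x'_def algebra_simps)
  qed (use h in auto)
  then show ?thesis by (simp add: \<phi>_def power3_eq_cube algebra_simps)
qed

end

section \<open>Grid points, their neighbours and their mirror images\<close>

lemma gpt_nth: "gpt N p $ d = (real (coord d p) - 1/2) / real N"
  using exhaust_3[of d] by (cases p) (auto simp: gpt_def coord_def)

lemma coord_fw: "coord e (fw d p) = (if e = d then coord e p + 1 else coord e p)"
  using exhaust_3[of d] exhaust_3[of e] by (cases p) (auto simp: coord_def fw_def)

lemma all_pts_pc: "p \<in> all_pts N \<longleftrightarrow> (\<forall>d. coord d p \<le> N + 1)"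
  by (cases p) (auto simp: all_pts_def coord_def forall_3)

lemma inner_pts_pc: "p \<in> inner_pts N \<longleftrightarrow> (\<forall>d. 1 \<le> coord d p \<and> coord d p \<le> N)"
  by (cases p) (auto simp: inner_pts_def coord_def forall_3)

lemma gpt_fw: "gpt N (fw d p) = gpt N p + (1 / real N) *\<^sub>R axis d 1"
  by (simp add: vec_eq_iff gpt_nth coord_fw axis_def diff_divide_distrib add_divide_distrib)

lemma gpt_bw: "p \<in> inner_pts N \<Longrightarrow> gpt N (bw d p) = gpt N p + (- (1 / real N)) *\<^sub>R axis d 1"
  using gpt_fw[of N d "bw d p"] by simp

lemma gpt_cube: "p \<in> inner_pts N \<Longrightarrow> gpt N p \<in> cube"
  unfolding cube_def inner_pts_pc
proof (clarify)
  fix i assume "\<forall>d. 1 \<le> coord d p \<and> coord d p \<le> N"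
  then have "1 \<le> coord i p" "coord i p \<le> N" by auto
  then show "0 \<le> gpt N p $ i \<and> gpt N p $ i \<le> 1" by (auto simp: gpt_nth divide_le_eq)
qed

lemma gpt_xbox: assumes "p \<in> all_pts N" "N > 0" shows "gpt N p \<in> xbox"
  unfolding xbox_def
proof (clarify)
  fix i
  have "coord i p \<le> N + 1" using assms by (simp add: all_pts_pc)
  then have "real (coord i p) \<le> real N + 1" by linarith
  moreover have "1 \<le> real N" using assms by simp
  ultimately show "-1 \<le> gpt N p $ i \<and> gpt N p $ i \<le> 2"
    using assms by (simp add: gpt_nth le_divide_eq divide_le_eq)
qed

lemma coord_cl: "coord d (clamp_pt N p) = clamp N (coord d p)"
  by (cases p) (auto simp: clamp_pt_def coord_def)

text \<open>Ghost points lie half a cell outside the cube, so reflection takes them to the nearest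
  interior points. Hence the clamped interpolant samples the even extension.\<close>

lemma refl_pt_gpt:
  assumes "p \<in> all_pts N" "N > 0" shows "refl_pt (gpt N p) = gpt N (clamp_pt N p)"
  unfolding vec_eq_iff refl_pt_nth
proof
  fix i
  have n: "coord i p \<le> N + 1" using assms by (simp add: all_pts_pc)
  consider "coord i p = 0" | "1 \<le> coord i p" "coord i p \<le> N" | "coord i p = N + 1" using n by linarith
  then show "refl (gpt N p $ i) = gpt N (clamp_pt N p) $ i"
  proof cases
    case 1 then show ?thesis using assms by (simp add: gpt_nth coord_cl clamp_def refl_def field_simps)
  next
    case 2
    then have "real (coord i p) \<le> real N" "1 \<le> real (coord i p)" by auto
    then show ?thesis using 2 assms by (simp add: gpt_nth coord_cl clamp_def refl_def field_simps)
  next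
    case 3 then show ?thesis using assms by (simp add: gpt_nth coord_cl clamp_def refl_def field_simps)
  qed
qed

section \<open>Spatial consistency\<close>

lemma cube_axis: "x \<in> cube \<Longrightarrow> x + s *\<^sub>R axis d 1 \<in> cube \<longleftrightarrow> 0 \<le> x $ d + s \<and> x $ d + s \<le> 1"
  by (auto simp: cube_def axis_def)

lemma dd_interp_bound:
  assumes sd: "spatial_deriv \<phi> d \<psi>" and b: "\<And>x. x \<in> cube \<Longrightarrow> norm (\<psi> x) \<le> \<rho>" and N: "N > 0" and p: "p \<in> inner_pts N"
  shows "norm (dd N d (interp N \<phi>) p) \<le> \<rho>"
proof (cases "fw d p \<in> inner_pts N")
  case True
  have c: "gpt N p + (1 * s) *\<^sub>R axis d 1 \<in> cube" if "s \<in> {0..1 / real N}" for s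
    using gpt_cube[OF True] gpt_cube[OF p] that unfolding gpt_fw cube_axis[OF gpt_cube[OF p]] by (auto simp: cube_def)
  have "norm (\<phi> (gpt N p + (1 * (1 / real N)) *\<^sub>R axis d 1) - \<phi> (gpt N p + (1 * 0) *\<^sub>R axis d 1)) \<le> \<rho> * (1 / real N)"
    by (rule vector_mvt_bound[OF _ sd_path[OF sd c]]) (use b c in auto)
  then show ?thesis
    using N by (simp add: dd_def interp_cl clamp_pt_id[OF p] clamp_pt_id[OF True] gpt_fw pos_le_divide_eq mult.commute)
next
  case False
  have "clamp_pt N (fw d p) = clamp_pt N p"
    using p False exhaust_3[of d] by (cases p) (auto simp: clamp_pt_def clamp_def fw_def inner_pts_def)
  moreover have "0 \<le> \<rho>" using b[OF gpt_cube[OF p]] norm_ge_zero order_trans by blast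
  ultimately show ?thesis by (simp add: dd_def interp_cl)
qed

context smooth
begin

lemma interp_U: "p \<in> all_pts N \<Longrightarrow> N > 0 \<Longrightarrow> interp N f p = U (gpt N p)"
  by (simp add: interp_cl U_def refl_pt_gpt)

lemma dd_interp:
  assumes "p \<in> all_pts N" "fw d p \<in> all_pts N" "N > 0"
  shows "norm (dd N d (interp N f) p) \<le> B"
proof -
  have "norm (U (gpt N p + (1 / real N) *\<^sub>R axis d 1) - U (gpt N p)) \<le> B * (1 / real N)"
    by (rule U_lip) (use assms gpt_xbox[of p N] gpt_xbox[of "fw d p" N] in \<open>auto simp: gpt_fw\<close>)
  then show ?thesis using assms by (simp add: dd_def interp_U gpt_fw pos_le_divide_eq mult.commute)
qed

lemma dd_avgA_interp:
  assumes p: "p \<in> inner_pts N" and N: "N > 0"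
  shows "norm (dd N d (avgA (interp N f)) p) \<le> 2 * B"
proof -
  have 1: "\<bar>dd N d (avgA (interp N f)) p $ c\<bar> \<le> B" for c
  proof -
    have q: "bw c (fw d p) \<in> all_pts N" using p by (cases p) (auto simp: fw_def bw_def inner_pts_def all_pts_def)
    have a: "\<bar>dd N d (interp N f) p $ c\<bar> \<le> B" using dd_interp[OF inner_all[OF p] fw_all[OF p] N] component_le_norm_cart order_trans by blast
    have b: "\<bar>dd N d (interp N f) (bw c p) $ c\<bar> \<le> B"
      using dd_interp[OF bw_all[OF p] _ N, of d c] q component_le_norm_cart order_trans unfolding fw_bw_commute[OF p] by blast
    show ?thesis unfolding dd_avgA_nth[OF p] using a b by (simp add: abs_le_iff field_simps)
  qed
  have "(norm (dd N d (avgA (interp N f)) p))\<^sup>2 \<le> (\<Sum>c\<in>(UNIV::3 set). B\<^sup>2)"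
    unfolding norm3_eq using 1 by (intro sum_mono) (metis abs_ge_zero power2_abs power_mono)
  also have "\<dots> \<le> (2 * B)\<^sup>2" by (simp add: power_mult_distrib)
  finally show ?thesis by (rule power2_le_imp_le) (use B0 in simp)
qed

text \<open>The difference quotient across a face is compared with the normal derivative at the
  centre of the face, and the differences of these with the second derivative at the cell centre.
  The first error \<open>F\<close> is O(h^2) but would lose an order when differenced, so it stays a
  flux; on the walls quotient and derivative both vanish. The second error is
  \<open>r\<close>.\<close>

lemma laplacian_consistency:
  assumes N: "N > 0"
  obtains F r where "\<And>d p. p \<in> all_pts N \<Longrightarrow> coord d p = 0 \<or> coord d p = N \<Longrightarrow> F d p = (0::real^3)"
    and "\<And>d p. p \<in> inner_pts N \<Longrightarrow> norm (F d p) \<le> B * (1 / real N)\<^sup>2"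
    and "\<And>p. p \<in> inner_pts N \<Longrightarrow> norm (r p) \<le> 2 * B * (1 / real N)\<^sup>2"
    and "\<And>p. p \<in> inner_pts N \<Longrightarrow> lap_h N (interp N f) p = (\<Sum>d\<in>UNIV. H d d (gpt N p))
        + (\<Sum>d\<in>UNIV. real N *\<^sub>R (F d p - F d (bw d p))) + r p"
proof -
  define h where "h = 1 / real N"
  have h: "h > 0" "real N * h = 1" using N by (auto simp: h_def)
  define M where "M = interp N f"
  define gf where "gf d p = g d (gpt N p + (h/2) *\<^sub>R axis d 1)" for d p
  define F where "F d p = (if coord d p = 0 \<or> coord d p = N then 0 else dd N d M p - gf d p)" for d p
  define r where "r p = (\<Sum>d\<in>UNIV. real N *\<^sub>R (gf d p - gf d (bw d p)) - H d d (gpt N p))" for p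
  have nM: "neumann N M" unfolding M_def interp_cl[abs_def] by (rule neumann_interp_cl[OF N])
  have near: "gpt N p + s *\<^sub>R axis d 1 \<in> cube" if p: "p \<in> inner_pts N" and s: "\<bar>s\<bar> \<le> h/2" for p s d
  proof -
    have "1 \<le> coord d p" "coord d p \<le> N" using p by (auto simp: inner_pts_pc)
    then have "h * 1 \<le> h * real (coord d p)" "h * real (coord d p) \<le> h * real N" using h by auto
    moreover have "gpt N p $ d = h * real (coord d p) - h/2" by (simp add: gpt_nth h_def diff_divide_distrib)
    ultimately show ?thesis using s h(2) unfolding cube_axis[OF gpt_cube[OF p]] abs_le_iff
      by (simp add: mult.commute[of h "real N"])
  qed
  have gfz: "gf d q = 0" if p: "p \<in> inner_pts N" and q: "q = p \<or> q = bw d p" and w: "coord d q = 0 \<or> coord d q = N" for p q d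
  proof -
    have 1: "gpt N q + (h/2) *\<^sub>R axis d 1 \<in> cube"
    proof -
      have "gpt N (bw d p) + (h/2) *\<^sub>R axis d 1 = gpt N p + (- (h/2)) *\<^sub>R axis d 1"
        using gpt_bw[OF p, of d] by (simp add: h_def vec_eq_iff)
      moreover have "gpt N p + (h/2) *\<^sub>R axis d 1 \<in> cube" "gpt N p + (- (h/2)) *\<^sub>R axis d 1 \<in> cube"
        using h by (intro near[OF p]; simp)+
      ultimately show ?thesis using q by metis
    qed
    have "(gpt N q + (h/2) *\<^sub>R axis d 1) $ d = real (coord d q) / real N"
      by (simp add: gpt_nth h_def diff_divide_distrib)
    then have "(gpt N q + (h/2) *\<^sub>R axis d 1) $ d = 0 \<or> (gpt N q + (h/2) *\<^sub>R axis d 1) $ d = 1" using w N by auto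
    then show ?thesis unfolding gf_def by (rule g_wall[OF 1])
  qed
  have split: "dd N d M q = F d q + gf d q" if p: "p \<in> inner_pts N" and q: "q = p \<or> q = bw d p" for p q d
  proof (cases "coord d q = 0 \<or> coord d q = N")
    case True
    have "q \<in> all_pts N" using p q inner_all bw_all by blast
    then show ?thesis using True gfz[OF p q True] dd_wall[OF nM] by (simp add: F_def)
  qed (simp add: F_def)
  show thesis
  proof (rule that)
    show "F d p = 0" if "p \<in> all_pts N" "coord d p = 0 \<or> coord d p = N" for d p using that by (simp add: F_def)
    show "norm (F d p) \<le> B * (1 / real N)\<^sup>2" if p: "p \<in> inner_pts N" for d p
    proof (cases "coord d p = N")
      case True then show ?thesis using B0 by (simp add: F_def)
    next
      case False
      have fp: "fw d p \<in> inner_pts N" using p False unfolding inner_pts_pc coord_fw by (metis le_neq_implies_less less_eq_Suc_le Suc_eq_plus1 le_SucI)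
      define y where "y = gpt N p + (h/2) *\<^sub>R axis d 1"
      have yc: "y + (c * s) *\<^sub>R axis d 1 \<in> cube" if "c = 1 \<or> c = -1" "s \<in> {0..h/2}" for c s
      proof -
        have e: "y + (c * s) *\<^sub>R axis d 1 = gpt N p + (h/2 + c * s) *\<^sub>R axis d 1" by (simp add: y_def scaleR_add_left)
        show ?thesis
          using gpt_cube[OF fp] gpt_cube[OF p] that h
          unfolding e gpt_fw h_def[symmetric] cube_axis[OF gpt_cube[OF p]] by (auto simp: cube_def)
      qed
      have y0: "y \<in> cube" using yc[of 1 0] h by simp
      have 2: "norm (g d (y + (1 * s) *\<^sub>R axis d 1) + g d (y + (-1 * s) *\<^sub>R axis d 1) - 2 *\<^sub>R g d y) \<le> B * h * (h/2)" if s: "s \<in> {0..h/2}" for s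
      proof -
        define \<psi> where "\<psi> s = g d (y + (1 * s) *\<^sub>R axis d 1) + g d (y + (-1 * s) *\<^sub>R axis d 1)" for s
        have "norm (\<psi> s - \<psi> 0) \<le> B * h * s"
        proof (rule vector_mvt_bound)
          fix q assume q: "q \<in> {0..s}"
          show "(\<psi> has_vector_derivative 1 *\<^sub>R H d d (y + (1 * q) *\<^sub>R axis d 1) + (-1) *\<^sub>R H d d (y + (-1 * q) *\<^sub>R axis d 1)) (at q within {0..s})"
            unfolding \<psi>_def by (intro has_vector_derivative_add sd_path[OF g_sd]) (use yc[of 1] yc[of "-1"] q s in auto)
          have "norm (H d d (y + (1 * q) *\<^sub>R axis d 1) - H d d y) \<le> B * \<bar>q\<bar>"
            using H_lip[OF y0, of q d d d] yc[of 1 q] q s by simp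
          moreover have "norm (H d d y - H d d (y + (-1 * q) *\<^sub>R axis d 1)) \<le> B * \<bar>q\<bar>"
            using H_lip[OF y0, of "-q" d d d] yc[of "-1" q] q s by (simp add: norm_minus_commute)
          moreover have "B * \<bar>q\<bar> \<le> B * (h/2)" using q s B0 by (intro mult_left_mono) auto
          ultimately show "norm (1 *\<^sub>R H d d (y + (1 * q) *\<^sub>R axis d 1) + (-1) *\<^sub>R H d d (y + (-1 * q) *\<^sub>R axis d 1)) \<le> B * h"
            using norm_triangle_ineq[of "H d d (y + (1 * q) *\<^sub>R axis d 1) - H d d y" "H d d y - H d d (y + (-1 * q) *\<^sub>R axis d 1)"] by simp
        qed (use s in auto)
        also have "B * h * s \<le> B * h * (h/2)" using s B0 h by (intro mult_left_mono) auto
        finally show ?thesis by (simp add: \<psi>_def scaleR_2)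
      qed
      \<comment> \<open>Expanding symmetrically about the face centre cancels the second derivative,
        which leaves the Lipschitz bound on \<open>H\<close>.\<close>
      define \<phi> where "\<phi> s = f (y + (1 * s) *\<^sub>R axis d 1) - f (y + (-1 * s) *\<^sub>R axis d 1) - s *\<^sub>R (2 *\<^sub>R g d y)" for s
      have "norm (\<phi> (h/2) - \<phi> 0) \<le> B * h * (h/2) * (h/2)"
      proof (rule vector_mvt_bound)
        fix s assume s: "s \<in> {0..h/2}"
        show "(\<phi> has_vector_derivative 1 *\<^sub>R g d (y + (1 * s) *\<^sub>R axis d 1) - (-1) *\<^sub>R g d (y + (-1 * s) *\<^sub>R axis d 1) - 2 *\<^sub>R g d y) (at s within {0..h/2})"
          unfolding \<phi>_def by (intro has_vector_derivative_diff sd_path[OF f_sd])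
            (use yc[of 1] yc[of "-1"] s in \<open>auto intro!: derivative_eq_intros\<close>)
        show "norm (1 *\<^sub>R g d (y + (1 * s) *\<^sub>R axis d 1) - (-1) *\<^sub>R g d (y + (-1 * s) *\<^sub>R axis d 1) - 2 *\<^sub>R g d y) \<le> B * h * (h/2)"
          using 2[OF s] by simp
      qed (use h in auto)
      moreover have "\<phi> 0 = 0" by (simp add: \<phi>_def)
      moreover have "\<phi> (h/2) = h *\<^sub>R F d p"
      proof -
        have a: "y + (1 * (h/2)) *\<^sub>R axis d 1 = gpt N (fw d p)" "y + (-1 * (h/2)) *\<^sub>R axis d 1 = gpt N p"
          by (simp_all add: y_def gpt_fw h_def vec_eq_iff)
        have "h *\<^sub>R dd N d M p = f (gpt N (fw d p)) - f (gpt N p)"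
          using h by (simp add: dd_def M_def interp_cl clamp_pt_id[OF p] clamp_pt_id[OF fp] mult.commute[of h])
        moreover have "coord d p \<noteq> 0" using p by (auto simp: inner_pts_pc dest: spec[of _ d])
        ultimately show ?thesis using False unfolding \<phi>_def a by (simp add: F_def gf_def y_def[symmetric] scaleR_diff_right)
      qed
      ultimately have "h * norm (F d p) \<le> h * (B * h\<^sup>2 / 4)" using h by (simp add: power2_eq_square)
      then have "norm (F d p) \<le> B * h\<^sup>2 / 4" using h by simp
      also have "\<dots> \<le> B * h\<^sup>2" using mult_nonneg_nonneg[OF B0 zero_le_power2[of h]] by simp
      finally show ?thesis by (simp add: h_def)
    qed
    show "norm (r p) \<le> 2 * B * (1 / real N)\<^sup>2" if p: "p \<in> inner_pts N" for p
    proof -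
      have "norm (real N *\<^sub>R (gf d p - gf d (bw d p)) - H d d (gpt N p)) \<le> B * h\<^sup>2 / 2" for d
      proof -
        let ?x = "gpt N p"
        have c: "?x + (c * s) *\<^sub>R axis d 1 \<in> cube" if "c = 1 \<or> c = -1" "s \<in> {0..h/2}" for c s
          using that by (intro near[OF p]) auto
        \<comment> \<open>The same expansion one derivative higher, about the cell centre;
          \<open>H_sec\<close> supplies the last order.\<close>
        define \<kappa> where "\<kappa> s = g d (?x + (1 * s) *\<^sub>R axis d 1) - g d (?x + (-1 * s) *\<^sub>R axis d 1) - s *\<^sub>R (2 *\<^sub>R H d d ?x)" for s
        have "norm (\<kappa> (h/2) - \<kappa> 0) \<le> B * h\<^sup>2 * (h/2)"
        proof (rule vector_mvt_bound)
          fix s assume s: "s \<in> {0..h/2}"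
          show "(\<kappa> has_vector_derivative 1 *\<^sub>R H d d (?x + (1 * s) *\<^sub>R axis d 1) - (-1) *\<^sub>R H d d (?x + (-1 * s) *\<^sub>R axis d 1) - 2 *\<^sub>R H d d ?x) (at s within {0..h/2})"
            unfolding \<kappa>_def by (intro has_vector_derivative_diff sd_path[OF g_sd])
              (use c[of 1] c[of "-1"] s in \<open>auto intro!: derivative_eq_intros\<close>)
          have "norm (1 *\<^sub>R H d d (?x + (1 * s) *\<^sub>R axis d 1) - (-1) *\<^sub>R H d d (?x + (-1 * s) *\<^sub>R axis d 1) - 2 *\<^sub>R H d d ?x) \<le> B * s\<^sup>2"
            using H_sec[of ?x s d] c[of 1 s] c[of "-1" s] s by simp
          also have "B * s\<^sup>2 \<le> B * h\<^sup>2" using s h B0 by (intro mult_left_mono power_mono) auto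
          finally show "norm (1 *\<^sub>R H d d (?x + (1 * s) *\<^sub>R axis d 1) - (-1) *\<^sub>R H d d (?x + (-1 * s) *\<^sub>R axis d 1) - 2 *\<^sub>R H d d ?x) \<le> B * h\<^sup>2" .
        qed (use h in auto)
        moreover have "\<kappa> 0 = 0" by (simp add: \<kappa>_def)
        moreover have "\<kappa> (h/2) = h *\<^sub>R (real N *\<^sub>R (gf d p - gf d (bw d p)) - H d d ?x)"
        proof -
          have "gpt N (bw d p) + (h/2) *\<^sub>R axis d 1 = ?x + (-1 * (h/2)) *\<^sub>R axis d 1"
            using gpt_bw[OF p, of d] by (simp add: h_def vec_eq_iff)
          then have "gf d (bw d p) = g d (?x + (-1 * (h/2)) *\<^sub>R axis d 1)" by (simp only: gf_def)
          then show ?thesis using h by (simp add: \<kappa>_def gf_def scaleR_diff_right mult.commute[of h])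
        qed
        ultimately have "h * norm (real N *\<^sub>R (gf d p - gf d (bw d p)) - H d d ?x) \<le> h * (B * h\<^sup>2 / 2)"
          using h by (simp add: mult.commute)
        then show ?thesis using h by simp
      qed
      then have "norm (r p) \<le> (\<Sum>d\<in>(UNIV::3 set). B * h\<^sup>2 / 2)" unfolding r_def by (intro sum_norm_le)
      also have "\<dots> \<le> 2 * B * h\<^sup>2" using mult_nonneg_nonneg[OF B0 zero_le_power2[of h]] by simp
      finally show ?thesis by (simp add: h_def)
    qed
    show "lap_h N (interp N f) p = (\<Sum>d\<in>UNIV. H d d (gpt N p))
        + (\<Sum>d\<in>UNIV. real N *\<^sub>R (F d p - F d (bw d p))) + r p" if p: "p \<in> inner_pts N" for p
      unfolding M_def[symmetric] lap_h_dd[OF p] split[OF p disjI1[OF refl]] split[OF p disjI2[OF refl]] r_def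
      by (simp add: sum_3 algebra_simps)
  qed
qed

text \<open>The averaged gradient is only a first-order approximation (its defect is \<open>gdef\<close>), but the defect
  varies slowly, also across the walls, because the even reflection of \<open>f\<close> has Lipschitz second derivatives.\<close>
definition gdef where "gdef N p = gradsq N (avgA (interp N f)) p - (\<Sum>d\<in>UNIV. (norm (g d (gpt N p)))\<^sup>2)"

text \<open>The Taylor remainder of entry \<open>(d, c)\<close> of the averaged gradient: component
  \<open>c\<close> averages the quotients based at \<open>x\<close> and one cell back in direction
  \<open>c\<close>.\<close>

definition Rm where "Rm N d c x = (real N / 2) *\<^sub>R
   ((U (x + (1 / real N) *\<^sub>R axis d 1) - U x - (1 / real N) *\<^sub>R W d x)
  + (U (x + (- (1 / real N)) *\<^sub>R axis c 1 + (1 / real N) *\<^sub>R axis d 1) - U (x + (- (1 / real N)) *\<^sub>R axis c 1) - (1 / real N) *\<^sub>R W d x))"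

text \<open>Each entry of the averaged gradient is the exact one plus its remainder, so the
  difference of squares factors.\<close>

lemma gdef_Rm:
  assumes p: "p \<in> inner_pts N"
  shows "gdef N p = (\<Sum>d\<in>UNIV. \<Sum>c\<in>UNIV. (Rm N d c (gpt N p) $ c) * (Rm N d c (gpt N p) $ c + 2 * (W d (gpt N p) $ c)))"
proof -
  have N: "N > 0" using p by (auto simp: inner_pts_def)
  let ?x = "gpt N p"
  have W: "g d ?x = W d ?x" for d
  proof -
    have "0 \<le> ?x $ d" "?x $ d \<le> 1" using gpt_cube[OF p] by (auto simp: cube_def)
    then show ?thesis by (simp add: W_def refl_pt_id[OF gpt_cube[OF p]] refl_sgn_def)
  qed
  have q: "dd N d (avgA (interp N f)) p $ c = Rm N d c ?x $ c + W d ?x $ c" for d c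
  proof -
    have b: "fw d (bw c p) \<in> all_pts N" using p by (cases p) (auto simp: fw_def bw_def inner_pts_def all_pts_def)
    have e1: "dd N d (interp N f) p = real N *\<^sub>R (U (?x + (1 / real N) *\<^sub>R axis d 1) - U ?x)"
      using interp_U[OF inner_all[OF p] N] interp_U[OF fw_all[OF p] N, of d] by (simp add: dd_def gpt_fw)
    have e2: "dd N d (interp N f) (bw c p) = real N *\<^sub>R (U (?x + (- (1 / real N)) *\<^sub>R axis c 1 + (1 / real N) *\<^sub>R axis d 1) - U (?x + (- (1 / real N)) *\<^sub>R axis c 1))"
      using interp_U[OF bw_all[OF p] N, of c] interp_U[OF b N] gpt_bw[OF p, of c] by (simp add: dd_def gpt_fw)
    show ?thesis
      using N unfolding dd_avgA_nth[OF p] Rm_def e1 e2 by (simp add: field_simps)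
  qed
  show ?thesis
    unfolding gdef_def gradsq_dd norm3_eq q W sum_subtractf[symmetric]
    by (intro sum.cong refl) (simp add: power2_eq_square algebra_simps)
qed

lemma Rm_bound:
  assumes x: "x \<in> cube" and N: "N \<ge> 2"
  shows "norm (Rm N d c x) \<le> 2 * B * (1 / real N)"
proof -
  define h where "h = 1 / real N"
  have h: "0 < h" "h \<le> 1/2" "real N * h = 1" using N by (auto simp: h_def field_simps)
  have 1: "norm (U (x + h *\<^sub>R axis d 1) - U x - h *\<^sub>R W d x) \<le> 2 * B * h\<^sup>2"
    using U_first_order[OF x, of 0 h c d] h by simp
  have 2: "norm (U (x + (- h) *\<^sub>R axis c 1 + h *\<^sub>R axis d 1) - U (x + (- h) *\<^sub>R axis c 1) - h *\<^sub>R W d x) \<le> 2 * B * h\<^sup>2"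
    using U_first_order[OF x, of h h c d] h by simp
  have "norm (Rm N d c x) \<le> real N / 2 * (2 * B * h\<^sup>2 + 2 * B * h\<^sup>2)"
    unfolding Rm_def h_def[symmetric] norm_scaleR
    by (intro mult_mono order_trans[OF norm_triangle_ineq add_mono] 1 2) auto
  also have "\<dots> = 2 * B * h * (real N * h)" by (simp add: power2_eq_square)
  finally show ?thesis using h by (simp add: h_def)
qed

lemma Rm_diff_bound:
  assumes x: "x \<in> cube" and N: "N \<ge> 2"
  shows "norm (Rm N d c (x + (1 / real N) *\<^sub>R axis b 1) - Rm N d c x) \<le> 2 * B * (1 / real N)\<^sup>2"
proof -
  define h where "h = 1 / real N"
  have h: "0 < h" "h \<le> 1/2" "real N * h = 1" using N by (auto simp: h_def field_simps)
  define x' where "x' = x + h *\<^sub>R axis b 1"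
  let ?a = "\<lambda>x. U (x + h *\<^sub>R axis d 1) - U x - h *\<^sub>R W d x"
  let ?b = "\<lambda>x. U (x + (- h) *\<^sub>R axis c 1 + h *\<^sub>R axis d 1) - U (x + (- h) *\<^sub>R axis c 1) - h *\<^sub>R W d x"
  have 1: "norm (?a x' - ?a x) \<le> 2 * B * h ^ 3"
    using U_second_order[OF x, of 0 h, where b=b and c=c and d=d] h by (simp add: x'_def)
  have 2: "norm (?b x' - ?b x) \<le> 2 * B * h ^ 3"
    using U_second_order[OF x, of h h, where b=b and c=c and d=d] h unfolding x'_def by simp
  have "Rm N d c x' - Rm N d c x = (real N / 2) *\<^sub>R ((?a x' - ?a x) + (?b x' - ?b x))"
    unfolding Rm_def h_def[symmetric] scaleR_diff_right[symmetric] by (intro arg_cong2[where f=scaleR] refl) simp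
  then have "norm (Rm N d c x' - Rm N d c x) = real N / 2 * norm ((?a x' - ?a x) + (?b x' - ?b x))"
    by simp
  also have "\<dots> \<le> real N / 2 * (2 * B * h ^ 3 + 2 * B * h ^ 3)"
    by (intro mult_left_mono order_trans[OF norm_triangle_ineq add_mono] 1 2) auto
  also have "\<dots> = 2 * B * h\<^sup>2 * (real N * h)" by (simp add: power2_eq_square power3_eq_cube)
  finally show ?thesis using h by (simp add: h_def x'_def)
qed

text \<open>Nine entries, each at most \<open>2 * B * h\<close> times \<open>3 * B\<close>, give
  54.\<close>

lemma gdef_bound:
  assumes p: "p \<in> inner_pts N" and N: "N \<ge> 2"
  shows "\<bar>gdef N p\<bar> \<le> 54 * B\<^sup>2 * (1 / real N)"
proof -
  define h where "h = 1 / real N"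
  have h: "0 < h" "h \<le> 1/2" using N by (auto simp: h_def field_simps)
  let ?x = "gpt N p"
  have "\<bar>(Rm N d c ?x $ c) * (Rm N d c ?x $ c + 2 * (W d ?x $ c))\<bar> \<le> (2 * B * h) * (3 * B)" for d c
    unfolding abs_mult
  proof (intro mult_mono)
    show a: "\<bar>Rm N d c ?x $ c\<bar> \<le> 2 * B * h"
      using Rm_bound[OF gpt_cube[OF p] N] component_le_norm_cart order_trans unfolding h_def by blast
    have b: "\<bar>W d ?x $ c\<bar> \<le> B"
      using W_bd[OF cube_xbox[OF gpt_cube[OF p]]] component_le_norm_cart order_trans by blast
    have "2 * B * h \<le> 2 * B * (1/2)" using h B0 by (intro mult_left_mono) auto
    then show "\<bar>Rm N d c ?x $ c + 2 * (W d ?x $ c)\<bar> \<le> 3 * B" using a b by linarith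
  qed (use h B0 in auto)
  then have "\<bar>gdef N p\<bar> \<le> (\<Sum>d\<in>(UNIV::3 set). \<Sum>c\<in>(UNIV::3 set). (2 * B * h) * (3 * B))"
    unfolding gdef_Rm[OF p] by (intro order_trans[OF sum_abs sum_mono])
  then show ?thesis by (simp add: h_def power2_eq_square algebra_simps)
qed

text \<open>In the product rule for each entry the remainder either changes, by O(h^2), or is itself
  O(h) and multiplies a change of size O(h). Nine entries of size
  \<open>12 * B\<^sup>2 * h\<^sup>2\<close> give 108.\<close>

lemma gdef_diff_bound:
  assumes p: "p \<in> inner_pts N" and q: "fw b p \<in> inner_pts N" and N: "N \<ge> 2"
  shows "\<bar>gdef N (fw b p) - gdef N p\<bar> \<le> 108 * B\<^sup>2 * (1 / real N)\<^sup>2"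
proof -
  define h where "h = 1 / real N"
  have h: "0 < h" "h \<le> 1/2" using N by (auto simp: h_def field_simps)
  let ?x = "gpt N p" and ?y = "gpt N (fw b p)"
  have y: "?y = ?x + h *\<^sub>R axis b 1" by (simp add: gpt_fw h_def)
  have term_bound: "\<bar>(Rm N d c ?y $ c) * (Rm N d c ?y $ c + 2 * (W d ?y $ c)) - (Rm N d c ?x $ c) * (Rm N d c ?x $ c + 2 * (W d ?x $ c))\<bar>
     \<le> 12 * B\<^sup>2 * h\<^sup>2" for d c
  proof -
    define a where "a = Rm N d c ?x $ c" define a' where "a' = Rm N d c ?y $ c"
    define w where "w = W d ?x $ c" define w' where "w' = W d ?y $ c"
    have a: "\<bar>a\<bar> \<le> 2 * B * h" "\<bar>a'\<bar> \<le> 2 * B * h"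
      using Rm_bound[OF gpt_cube[OF p] N] Rm_bound[OF gpt_cube[OF q] N] component_le_norm_cart order_trans
      unfolding h_def a_def a'_def by blast+
    have da: "\<bar>a' - a\<bar> \<le> 2 * B * h\<^sup>2"
      using Rm_diff_bound[OF gpt_cube[OF p] N, of d c b] component_le_norm_cart[of "Rm N d c ?y - Rm N d c ?x" c]
      unfolding a_def a'_def h_def gpt_fw by simp
    have w: "\<bar>w'\<bar> \<le> B" using W_bd[OF cube_xbox[OF gpt_cube[OF q]]] component_le_norm_cart order_trans unfolding w'_def by blast
    have "norm (W d ?y - W d ?x) \<le> B * h"
      using W_lip[OF cube_xbox[OF gpt_cube[OF p]], of h b d] cube_xbox[OF gpt_cube[OF q]] h unfolding y by simp
    then have dw: "\<bar>w' - w\<bar> \<le> B * h" using component_le_norm_cart[of "W d ?y - W d ?x" c] by (simp add: w_def w'_def)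
    have bh: "B * h \<le> B * (1/2)" using h B0 by (intro mult_left_mono) auto
    have bh2: "B * h * h \<le> B * h * (1/2)" using h B0 by (intro mult_left_mono) auto
    have 1: "\<bar>a' - a\<bar> * \<bar>a' + 2 * w'\<bar> \<le> (2 * B * h\<^sup>2) * (3 * B)"
      using da a w bh B0 by (intro mult_mono) auto
    have 2: "\<bar>a\<bar> * \<bar>(a' - a) + 2 * (w' - w)\<bar> \<le> (2 * B * h) * (3 * B * h)"
    proof (intro mult_mono)
      show "\<bar>(a' - a) + 2 * (w' - w)\<bar> \<le> 3 * B * h" using da dw bh2 by (simp add: power2_eq_square)
    qed (use a B0 h in auto)
    have "a' * (a' + 2 * w') - a * (a + 2 * w) = (a' - a) * (a' + 2 * w') + a * ((a' - a) + 2 * (w' - w))"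
      by (simp add: algebra_simps)
    then have "\<bar>a' * (a' + 2 * w') - a * (a + 2 * w)\<bar> \<le> \<bar>a' - a\<bar> * \<bar>a' + 2 * w'\<bar> + \<bar>a\<bar> * \<bar>(a' - a) + 2 * (w' - w)\<bar>"
      by (metis abs_mult abs_triangle_ineq)
    also have "\<dots> \<le> (2 * B * h\<^sup>2) * (3 * B) + (2 * B * h) * (3 * B * h)" using 1 2 by linarith
    also have "\<dots> = 12 * B\<^sup>2 * h\<^sup>2" by (simp add: power2_eq_square)
    finally show ?thesis unfolding a_def a'_def w_def w'_def .
  qed
  have "\<bar>gdef N (fw b p) - gdef N p\<bar> \<le> (\<Sum>d\<in>(UNIV::3 set). \<Sum>c\<in>(UNIV::3 set). 12 * B\<^sup>2 * h\<^sup>2)"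
    unfolding gdef_Rm[OF p] gdef_Rm[OF q] sum_subtractf[symmetric]
    by (intro order_trans[OF sum_abs sum_mono] term_bound)
  then show ?thesis by (simp add: h_def)
qed

end

section \<open>Regularity of the exact solution\<close>

lemma AE_lborel_dense:
  fixes P :: "real \<Rightarrow> bool"
  assumes "AE t in lborel. P t" "a < b"
  shows "\<exists>t. a < t \<and> t < b \<and> P t"
proof (rule ccontr)
  assume n: "\<not> ?thesis"
  have "AE t in lborel. t \<notin> {a<..<b}" using assms(1) by (rule AE_mp) (use n in auto)
  then have "{a<..<b} \<in> null_sets lborel" by (subst AE_iff_null_sets) auto
  then show False using assms(2) by (auto simp: null_sets_def)
qed

text \<open>A set of full measure is dense, so a bound valid almost everywhere passes to every time
  for a continuous function. This is how the L^inf regularity in time becomes usable at the grid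
  times.\<close>

lemma continuous_le_AE:
  fixes \<phi> :: "real \<Rightarrow> real"
  assumes T: "T > 0" and c: "continuous_on {0..T} \<phi>" and P: "AE t in lborel. P t"
    and le: "\<And>t. t \<in> {0..T} \<Longrightarrow> P t \<Longrightarrow> \<phi> t \<le> c" and t: "t \<in> {0..T}"
  shows "\<phi> t \<le> c"
proof (rule ccontr)
  assume "\<not> ?thesis"
  then have "\<phi> t - c > 0" by simp
  then obtain d where d: "d > 0" "\<And>s. s \<in> {0..T} \<Longrightarrow> dist s t < d \<Longrightarrow> dist (\<phi> s) (\<phi> t) < \<phi> t - c"
    using c t unfolding continuous_on_iff by blast
  have "max 0 (t - d) < min T (t + d)" using d(1) t T by auto
  then obtain s where s: "max 0 (t - d) < s" "s < min T (t + d)" "P s" using AE_lborel_dense[OF P] by blast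
  then have "s \<in> {0..T}" "dist s t < d" by (auto simp: dist_real_def)
  then show False using d(2)[of s] le[of s] s(3) by (auto simp: dist_real_def)
qed

lemma sd_lipschitz:
  assumes sd: "spatial_deriv v l v'" and b: "\<And>x. x \<in> cube \<Longrightarrow> norm (v' x) \<le> b"
    and x: "x \<in> cube" and y: "x + s *\<^sub>R axis l 1 \<in> cube"
  shows "norm (v (x + s *\<^sub>R axis l 1) - v x) \<le> b * \<bar>s\<bar>"
proof -
  have c: "x + (s * r) *\<^sub>R axis l 1 \<in> cube" if r: "r \<in> {0..1}" for r
  proof -
    have 1: "0 \<le> x $ l" "x $ l \<le> 1" using x by (auto simp: cube_def)
    have "0 \<le> (1 - r) * (x $ l)" "0 \<le> r * (x $ l + s)" "0 \<le> (1 - r) * (1 - x $ l)" "0 \<le> r * (1 - (x $ l + s))"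
      using 1 r y unfolding cube_axis[OF x] by auto
    then have "0 \<le> x $ l + s * r" "x $ l + s * r \<le> 1" by (auto simp: algebra_simps)
    then show ?thesis unfolding cube_axis[OF x] by simp
  qed
  have "norm (v (x + (s * 1) *\<^sub>R axis l 1) - v (x + (s * 0) *\<^sub>R axis l 1)) \<le> (\<bar>s\<bar> * b) * 1"
    by (rule vector_mvt_bound[OF _ sd_path[OF sd c]]) (use b c in \<open>auto intro!: mult_left_mono\<close>)
  then show ?thesis by (simp add: mult.commute)
qed

lemma cube_midpoint:
  assumes "x + s *\<^sub>R axis l 1 \<in> cube" "x + (- s) *\<^sub>R axis l 1 \<in> cube"
  shows "x \<in> cube"
  unfolding cube_def
proof (clarify)
  fix i
  have "0 \<le> (x + s *\<^sub>R axis l 1) $ i \<and> (x + s *\<^sub>R axis l 1) $ i \<le> 1" "0 \<le> (x + (- s) *\<^sub>R axis l 1) $ i \<and> (x + (- s) *\<^sub>R axis l 1) $ i \<le> 1"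
    using assms unfolding cube_def by blast+
  then show "0 \<le> x $ i \<and> x $ i \<le> 1" by (auto simp: axis_def split: if_splits)
qed

lemma sd_second_difference:
  assumes sd: "spatial_deriv v l v'" and sd': "spatial_deriv v' l v''" and b: "\<And>x. x \<in> cube \<Longrightarrow> norm (v'' x) \<le> b"
    and y: "x + s *\<^sub>R axis l 1 \<in> cube" and z: "x + (- s) *\<^sub>R axis l 1 \<in> cube"
  shows "norm (v (x + s *\<^sub>R axis l 1) + v (x + (- s) *\<^sub>R axis l 1) - 2 *\<^sub>R v x) \<le> 2 * b * s\<^sup>2"
proof -
  have x: "x \<in> cube" by (rule cube_midpoint[OF y z])
  have b0: "b \<ge> 0" using b[OF x] norm_ge_zero order_trans by blast
  have c: "x + (c * s * r) *\<^sub>R axis l 1 \<in> cube" if r: "r \<in> {0..1}" and c: "c = 1 \<or> c = -1" for r c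
  proof -
    have w: "0 \<le> x $ l + c * s" "x $ l + c * s \<le> 1" using y z c unfolding cube_axis[OF x] by auto
    have 1: "0 \<le> x $ l" "x $ l \<le> 1" using x by (auto simp: cube_def)
    have "0 \<le> (1 - r) * (x $ l)" "0 \<le> r * (x $ l + c * s)" "0 \<le> (1 - r) * (1 - x $ l)" "0 \<le> r * (1 - (x $ l + c * s))"
      using 1 r w by auto
    then have "0 \<le> x $ l + c * s * r" "x $ l + c * s * r \<le> 1" by (auto simp: algebra_simps)
    then show ?thesis unfolding cube_axis[OF x] by simp
  qed
  define \<phi> where "\<phi> r = v (x + (s * r) *\<^sub>R axis l 1) + v (x + (- s * r) *\<^sub>R axis l 1)" for r
  have "norm (\<phi> 1 - \<phi> 0) \<le> (2 * b * s\<^sup>2) * 1"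
  proof (rule vector_mvt_bound)
    fix r :: real assume r: "r \<in> {0..1}"
    show "(\<phi> has_vector_derivative s *\<^sub>R v' (x + (s * r) *\<^sub>R axis l 1) + (- s) *\<^sub>R v' (x + (- s * r) *\<^sub>R axis l 1)) (at r within {0..1})"
      unfolding \<phi>_def by (intro has_vector_derivative_add sd_path[OF sd]) (use c[of _ 1] c[of _ "-1"] r in auto)
    have 1: "norm (v' (x + (s * r) *\<^sub>R axis l 1) - v' x) \<le> b * \<bar>s * r\<bar>"
      using sd_lipschitz[OF sd' b x, of "s * r"] c[OF r, of 1] by simp
    have 2: "norm (v' x - v' (x + (- s * r) *\<^sub>R axis l 1)) \<le> b * \<bar>s * r\<bar>"
      using sd_lipschitz[OF sd' b x, of "- s * r"] c[OF r, of "-1"] by (simp add: norm_minus_commute)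
    have 3: "b * \<bar>s * r\<bar> \<le> b * (\<bar>s\<bar> * 1)" unfolding abs_mult using r b0 by (intro mult_left_mono) auto
    have "norm (v' (x + (s * r) *\<^sub>R axis l 1) - v' (x + (- s * r) *\<^sub>R axis l 1)) \<le> 2 * b * \<bar>s\<bar>"
      using norm_triangle_ineq[of "v' (x + (s * r) *\<^sub>R axis l 1) - v' x" "v' x - v' (x + (- s * r) *\<^sub>R axis l 1)"] 1 2 3 by simp
    then have "\<bar>s\<bar> * norm (v' (x + (s * r) *\<^sub>R axis l 1) - v' (x + (- s * r) *\<^sub>R axis l 1)) \<le> \<bar>s\<bar> * (2 * b * \<bar>s\<bar>)"
      by (rule mult_left_mono) simp
    moreover have "s *\<^sub>R v' (x + (s * r) *\<^sub>R axis l 1) + (- s) *\<^sub>R v' (x + (- s * r) *\<^sub>R axis l 1)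
       = s *\<^sub>R (v' (x + (s * r) *\<^sub>R axis l 1) - v' (x + (- s * r) *\<^sub>R axis l 1))" by (simp add: scaleR_diff_right)
    moreover have "\<bar>s\<bar> * (2 * b * \<bar>s\<bar>) = 2 * b * s\<^sup>2" by (simp add: power2_eq_square mult.left_commute[of "\<bar>s\<bar>"])
    ultimately show "norm (s *\<^sub>R v' (x + (s * r) *\<^sub>R axis l 1) + (- s) *\<^sub>R v' (x + (- s * r) *\<^sub>R axis l 1)) \<le> 2 * b * s\<^sup>2"
      by (simp only: norm_scaleR)
  qed simp
  then show ?thesis by (simp add: \<phi>_def scaleR_2)
qed

section \<open>Consistency of extrapolation and BDF2 in time\<close>

lemma hvd_lipschitz:
  fixes v v' :: "real \<Rightarrow> 'a::real_normed_vector"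
  assumes d: "\<And>t. t \<in> {0..T} \<Longrightarrow> (v has_vector_derivative v' t) (at t within {0..T})"
    and b: "\<And>t. t \<in> {0..T} \<Longrightarrow> norm (v' t) \<le> b" and s: "0 \<le> s" "s \<le> t" "t \<le> T"
  shows "norm (v t - v s) \<le> b * (t - s)"
proof -
  have "norm (v (s + 1 * (t - s)) - v (s + 1 * 0)) \<le> b * (t - s)"
  proof (rule vector_mvt_bound[where \<phi>="\<lambda>r. v (s + 1 * r)" and \<phi>'="\<lambda>r. 1 *\<^sub>R v' (s + 1 * r)"])
    show "((\<lambda>r. v (s + 1 * r)) has_vector_derivative 1 *\<^sub>R v' (s + 1 * r)) (at r within {0..t - s})" if "r \<in> {0..t - s}" for r
      by (rule hvd_affine[where T="{0..T}"]) (use d s that in auto)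
  qed (use b s in auto)
  then show ?thesis by simp
qed

lemma time_extrapolation:
  fixes v0 v1 v2 :: "real \<Rightarrow> 'a::real_normed_vector"
  assumes d0: "\<And>t. t \<in> {0..T} \<Longrightarrow> (v0 has_vector_derivative v1 t) (at t within {0..T})"
    and d1: "\<And>t. t \<in> {0..T} \<Longrightarrow> (v1 has_vector_derivative v2 t) (at t within {0..T})"
    and b: "\<And>t. t \<in> {0..T} \<Longrightarrow> norm (v2 t) \<le> b" and k: "0 < k" "0 \<le> t - 2 * k" "t \<le> T"
  shows "norm (2 *\<^sub>R v0 (t - k) - v0 (t - 2 * k) - v0 t) \<le> 2 * b * k\<^sup>2"
proof -
  have b0: "b \<ge> 0" using order_trans[OF norm_ge_zero b[of t]] k by auto
  define \<phi> where "\<phi> s = 2 *\<^sub>R v0 (t + (-1) * s) - v0 (t + (-2) * s)" for s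
  have "norm (\<phi> k - \<phi> 0) \<le> (2 * b * k) * k"
  proof (rule vector_mvt_bound)
    fix s assume s: "s \<in> {0..k}"
    show "(\<phi> has_vector_derivative 2 *\<^sub>R ((-1) *\<^sub>R v1 (t + (-1) * s)) - (-2) *\<^sub>R v1 (t + (-2) * s)) (at s within {0..k})"
      unfolding \<phi>_def
      by (intro has_vector_derivative_diff has_vector_derivative_scaleR[where f="\<lambda>_. 2" and f'=0, simplified] hvd_affine[where T="{0..T}"] d0)
        (use k s in auto)
    have "norm (v1 (t - s) - v1 (t - 2 * s)) \<le> b * ((t - s) - (t - 2 * s))"
      using s k by (intro hvd_lipschitz[OF d1 b]) auto
    also have "\<dots> \<le> b * k" using s b0 by (intro mult_left_mono) auto
    finally have "2 * norm (v1 (t - s) - v1 (t - 2 * s)) \<le> 2 * (b * k)" by simp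
    moreover have "2 *\<^sub>R ((-1) *\<^sub>R v1 (t + (-1) * s)) - (-2) *\<^sub>R v1 (t + (-2) * s) = (-2) *\<^sub>R (v1 (t - s) - v1 (t - 2 * s))"
      by (simp add: scaleR_diff_right)
    ultimately show "norm (2 *\<^sub>R ((-1) *\<^sub>R v1 (t + (-1) * s)) - (-2) *\<^sub>R v1 (t + (-2) * s)) \<le> 2 * b * k"
      by (simp only: norm_scaleR)
  qed (use k in auto)
  moreover have "\<phi> k - \<phi> 0 = 2 *\<^sub>R v0 (t - k) - v0 (t - 2 * k) - v0 t" by (simp add: \<phi>_def scaleR_2)
  ultimately show ?thesis by (simp add: power2_eq_square)
qed

text \<open>As a function of the step, the defect has as derivative the extrapolation defect of
  \<open>v1\<close>, which \<open>time_extrapolation\<close> bounds.\<close>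

lemma time_bdf2:
  fixes v0 v1 v2 v3 :: "real \<Rightarrow> 'a::real_normed_vector"
  assumes d0: "\<And>t. t \<in> {0..T} \<Longrightarrow> (v0 has_vector_derivative v1 t) (at t within {0..T})"
    and d1: "\<And>t. t \<in> {0..T} \<Longrightarrow> (v1 has_vector_derivative v2 t) (at t within {0..T})"
    and d2: "\<And>t. t \<in> {0..T} \<Longrightarrow> (v2 has_vector_derivative v3 t) (at t within {0..T})"
    and b: "\<And>t. t \<in> {0..T} \<Longrightarrow> norm (v3 t) \<le> b" and k: "0 < k" "0 \<le> t - 2 * k" "t \<le> T"
  shows "norm ((3/2) *\<^sub>R v0 t - 2 *\<^sub>R v0 (t - k) + (1/2) *\<^sub>R v0 (t - 2 * k) - k *\<^sub>R v1 t) \<le> 2 * b * k ^ 3"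
proof -
  define \<phi> where "\<phi> s = (1/2) *\<^sub>R v0 (t + (-2) * s) - 2 *\<^sub>R v0 (t + (-1) * s) - s *\<^sub>R v1 t" for s
  have "norm (\<phi> k - \<phi> 0) \<le> (2 * b * k\<^sup>2) * k"
  proof (rule vector_mvt_bound)
    fix s assume s: "s \<in> {0..k}"
    show "(\<phi> has_vector_derivative (1/2) *\<^sub>R ((-2) *\<^sub>R v1 (t + (-2) * s)) - 2 *\<^sub>R ((-1) *\<^sub>R v1 (t + (-1) * s)) - v1 t) (at s within {0..k})"
      unfolding \<phi>_def
      by (intro has_vector_derivative_diff has_vector_derivative_scaleR[where f="\<lambda>_. 2" and f'=0, simplified]
          has_vector_derivative_scaleR[where f="\<lambda>_. 1/2" and f'=0, simplified] hvd_affine[where T="{0..T}"] d0)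
        (use k s in \<open>auto intro!: derivative_eq_intros\<close>)
    have b0: "b \<ge> 0" using order_trans[OF norm_ge_zero b[of t]] k by auto
    have "norm (2 *\<^sub>R v1 (t - s) - v1 (t - 2 * s) - v1 t) \<le> 2 * b * k\<^sup>2"
    proof (cases "s = 0")
      case True then show ?thesis using b0 by (simp add: scaleR_2)
    next
      case False
      then have "norm (2 *\<^sub>R v1 (t - s) - v1 (t - 2 * s) - v1 t) \<le> 2 * b * s\<^sup>2"
        using s k by (intro time_extrapolation[OF d1 d2 b]) auto
      also have "\<dots> \<le> 2 * b * k\<^sup>2" using s b0 by (intro mult_left_mono power_mono) auto
      finally show ?thesis .
    qed
    then show "norm ((1/2) *\<^sub>R ((-2) *\<^sub>R v1 (t + (-2) * s)) - 2 *\<^sub>R ((-1) *\<^sub>R v1 (t + (-1) * s)) - v1 t) \<le> 2 * b * k\<^sup>2"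
      by (simp add: add.commute)
  qed (use k in auto)
  moreover have "\<phi> k - \<phi> 0 = (3/2) *\<^sub>R v0 t - 2 *\<^sub>R v0 (t - k) + (1/2) *\<^sub>R v0 (t - 2 * k) - k *\<^sub>R v1 t"
  proof -
    have "(3/2) *\<^sub>R v0 t = 2 *\<^sub>R v0 t - (1/2) *\<^sub>R v0 t" by (simp flip: scaleR_left_diff_distrib)
    then show ?thesis by (simp add: \<phi>_def)
  qed
  ultimately show ?thesis by (simp add: power3_eq_cube power2_eq_square mult.assoc)
qed

section \<open>From the regularity class to uniform bounds\<close>

lemma minc_munit: "minc (\<lambda>_. 0) i = munit i" by (auto simp: minc_def munit_def)
lemma mord_minc: "mord (minc a i) = mord a + 1" using exhaust_3[of i] by (auto simp: mord_def minc_def)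
lemma mord_munit: "mord (munit i) = 1" using mord_minc[of "\<lambda>_. 0" i] by (simp add: minc_munit mord_def)
lemma minc_commute: "minc (minc a i) j = minc (minc a j) i" by (auto simp: minc_def fun_eq_iff)

lemma compact_cube: "compact cube"
proof -
  have e: "cube = cbox 0 1" by (auto simp: cube_def mem_box_cart)
  show ?thesis unfolding e by (rule compact_cbox)
qed

text \<open>All that is used about the exact solution, with one constant \<open>B\<close> for every
  bound. The defects of BDF2 and of extrapolation are recorded here, so that time derivatives beyond
  \<open>ft\<close> do not appear later.\<close>

definition exact_solution where
  "exact_solution \<alpha> T B me ft g H \<longleftrightarrow> B \<ge> 1 \<and>
     (\<forall>t\<in>{0..T}. smooth3 B (\<lambda>x. me x t) (\<lambda>i x. g i x t) (\<lambda>i j x. H i j x t)) \<and>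
     (\<forall>x\<in>cube. \<forall>t\<in>{0..T}. norm (me x t) = 1) \<and>
     (\<forall>x\<in>cube. \<forall>t\<in>{0<..T}. ft x t = - cross3 (me x t) (\<Sum>i\<in>UNIV. H i i x t) + \<alpha> *\<^sub>R (\<Sum>i\<in>UNIV. H i i x t)
         + (\<alpha> * (\<Sum>i\<in>UNIV. (norm (g i x t))\<^sup>2)) *\<^sub>R me x t) \<and>
     (\<forall>x\<in>cube. \<forall>t k. 0 < k \<and> 0 \<le> t - 2 * k \<and> t \<le> T \<longrightarrow>
        norm ((3/2) *\<^sub>R me x t - 2 *\<^sub>R me x (t - k) + (1/2) *\<^sub>R me x (t - 2 * k) - k *\<^sub>R ft x t) \<le> B * k ^ 3 \<and>
        norm (2 *\<^sub>R me x (t - k) - me x (t - 2 * k) - me x t) \<le> B * k\<^sup>2 \<and>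
        (\<forall>i. norm (2 *\<^sub>R g i x (t - k) - g i x (t - 2 * k) - g i x t) \<le> B * k\<^sup>2) \<and>
        norm (me x t - me x (t - k)) \<le> B * k)"

lemma LL_exact_imp_exact_solution:
  assumes T: "T > 0" and LL: "LL_exact \<alpha> T me"
  shows "\<exists>B ft g H. exact_solution \<alpha> T B me ft g (H :: 3 \<Rightarrow> 3 \<Rightarrow> real^3 \<Rightarrow> real \<Rightarrow> real^3)"
proof -
  define z :: "3 \<Rightarrow> nat" where "z = (\<lambda>_. 0)"
  obtain D where R: "regular_family T me D" and one: "\<And>x t. x \<in> cube \<Longrightarrow> t \<in> {0..T} \<Longrightarrow> norm (me x t) = 1"
    and pde: "\<And>x t. x \<in> cube \<Longrightarrow> t \<in> {0<..T} \<Longrightarrow> D z 1 x t = - cross3 (me x t) (\<Sum>i\<in>UNIV. D (minc (munit i) i) 0 x t)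
        + \<alpha> *\<^sub>R (\<Sum>i\<in>UNIV. D (minc (munit i) i) 0 x t) + (\<alpha> * (\<Sum>i\<in>UNIV. (norm (D (munit i) 0 x t))\<^sup>2)) *\<^sub>R me x t"
    and neum: "\<And>x t i. x \<in> cube \<Longrightarrow> t \<in> {0<..T} \<Longrightarrow> x $ i = 0 \<or> x $ i = 1 \<Longrightarrow> D (munit i) 0 x t = 0"
    using LL unfolding LL_exact_def Let_def z_def by blast
  have me: "\<And>x t. x \<in> cube \<Longrightarrow> t \<in> {0..T} \<Longrightarrow> D z 0 x t = me x t"
    and cont: "\<And>a j. (a, j) \<in> contidx \<Longrightarrow> continuous_on {(x, t). x \<in> cube \<and> t \<in> {0..T}} (\<lambda>(x, t). D a j x t)"
    and sd: "\<And>a j i t. (a, j) \<in> contidx \<Longrightarrow> (minc a i, j) \<in> contidx \<Longrightarrow> t \<in> {0..T} \<Longrightarrow> spatial_deriv (\<lambda>x. D a j x t) i (\<lambda>x. D (minc a i) j x t)"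
    and td: "\<And>a j x t. (a, j) \<in> contidx \<Longrightarrow> (a, Suc j) \<in> contidx \<Longrightarrow> x \<in> cube \<Longrightarrow> t \<in> {0..T} \<Longrightarrow>
        ((\<lambda>s. D a j x s) has_vector_derivative D a (Suc j) x t) (at t within {0..T})"
    using R unfolding regular_family_def z_def by blast+
  obtain B2 where AE: "AE t in lborel. t \<in> {0..T} \<longrightarrow>
        (\<forall>a. mord a \<le> 4 \<longrightarrow> continuous_on cube (\<lambda>x. D a 0 x t) \<and> (\<forall>x\<in>cube. norm (D a 0 x t) \<le> B2)) \<and>
        (\<forall>a i. mord a < 4 \<longrightarrow> spatial_deriv (\<lambda>x. D a 0 x t) i (\<lambda>x. D (minc a i) 0 x t))" (is "AE t in lborel. _ \<longrightarrow> ?P t")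
    using R unfolding regular_family_def by blast
  have z0: "mord z = 0" by (simp add: z_def mord_def)
  have mz: "minc z i = munit i" for i by (simp add: z_def minc_munit)
  have c0: "(z, j) \<in> contidx" if "j \<le> 3" for j using that z0 by (simp add: contidx_def)
  have c1: "(munit i, j) \<in> contidx" if "j \<le> 2" for i j using that by (simp add: contidx_def mord_munit)
  have c2: "(minc (munit i) l, 0) \<in> contidx" for i l by (simp add: contidx_def mord_munit mord_minc)
  \<comment> \<open>The derivatives whose maxima enter \<open>B\<close>; the sum of their separate
    bounds serves for all of them at once.\<close>
  define I :: "((3 \<Rightarrow> nat) \<times> nat) set" where "I = (\<lambda>j. (z, j)) ` {..3} \<union> (\<lambda>(i, j). (munit i, j)) ` (UNIV \<times> {..2}) \<union> (\<lambda>(i, l). (minc (munit i) l, 0)) ` (UNIV \<times> UNIV)"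
  have I: "finite I" "I \<subseteq> contidx" using c0 c1 c2 by (auto simp: I_def)
  have "\<exists>b. \<forall>x\<in>cube. \<forall>t\<in>{0..T}. norm (D (fst q) (snd q) x t) \<le> b" if q: "q \<in> I" for q
  proof -
    have "(fst q, snd q) \<in> contidx" using q I by auto
    then have "compact ((\<lambda>(x, t). D (fst q) (snd q) x t) ` (cube \<times> {0..T}))"
      using cont[of "fst q" "snd q"] by (intro compact_continuous_image compact_Times compact_cube compact_Icc) (simp add: Sigma_def, erule continuous_on_subset, auto)
    then obtain b where "\<forall>y\<in>(\<lambda>(x, t). D (fst q) (snd q) x t) ` (cube \<times> {0..T}). norm y \<le> b"
      using compact_imp_bounded bounded_iff by blast
    then show ?thesis by (intro exI[of _ b]) auto
  qed
  then obtain b where b: "\<And>q x t. q \<in> I \<Longrightarrow> x \<in> cube \<Longrightarrow> t \<in> {0..T} \<Longrightarrow> norm (D (fst q) (snd q) x t) \<le> b q" by metis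
  define B1 where "B1 = (\<Sum>q\<in>I. \<bar>b q\<bar>)"
  have B1: "norm (D a j x t) \<le> B1" if "(a, j) \<in> I" "x \<in> cube" "t \<in> {0..T}" for a j x t
    using b[OF that] member_le_sum[OF that(1), of "\<lambda>q. \<bar>b q\<bar>"] I by (simp add: B1_def)
  have B10: "B1 \<ge> 0" by (simp add: B1_def sum_nonneg)
  have i0: "(z, j) \<in> I" if "j \<le> 3" for j using that by (simp add: I_def)
  have i1: "(munit i, j) \<in> I" if "j \<le> 2" for i j using that by (force simp: I_def)
  have i2: "(minc (munit i) l, 0) \<in> I" for i l by (force simp: I_def)
  define B where "B = 1 + 2 * B1 + 2 * \<bar>B2\<bar>"
  define g where "g i x t = D (munit i) 0 x t" for i x t
  define H where "H i l x t = D (minc (munit i) l) 0 x t" for i l x t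
  have tcont: "continuous_on {0..T} (\<lambda>t. D a j x t)" if "(a, j) \<in> contidx" "x \<in> cube" for a j x
  proof -
    have "continuous_on {0..T} (\<lambda>t. (\<lambda>(x, t). D a j x t) (x, t))"
      by (rule continuous_on_compose2[OF cont[OF that(1)]]) (use that(2) in \<open>auto intro!: continuous_on_Pair\<close>)
    then show ?thesis by simp
  qed
  have ae_le: "\<phi> t \<le> c" if "continuous_on {0..T} \<phi>" "\<And>t. t \<in> {0..T} \<Longrightarrow> ?P t \<Longrightarrow> \<phi> t \<le> c" "t \<in> {0..T}" for \<phi> :: "real \<Rightarrow> real" and c t
    by (rule continuous_le_AE[OF T that(1) AE _ that(3)]) (use that(2) in blast)
  have hl: "norm (H i j (x + s *\<^sub>R axis l 1) t - H i j x t) \<le> B2 * \<bar>s\<bar>"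
    if x: "x \<in> cube" "x + s *\<^sub>R axis l 1 \<in> cube" and t: "t \<in> {0..T}" for i j l x s t
  proof (rule ae_le[OF _ _ t])
    show "continuous_on {0..T} (\<lambda>t. norm (H i j (x + s *\<^sub>R axis l 1) t - H i j x t))"
      unfolding H_def by (intro continuous_intros tcont c2 x)
    show "norm (H i j (x + s *\<^sub>R axis l 1) t - H i j x t) \<le> B2 * \<bar>s\<bar>" if "?P t" for t
      unfolding H_def using that x by (intro sd_lipschitz[where v'="\<lambda>x. D (minc (minc (munit i) j) l) 0 x t"]) (auto simp: mord_minc mord_munit)
  qed
  have hs: "norm (H i i (x + s *\<^sub>R axis i 1) t + H i i (x + (- s) *\<^sub>R axis i 1) t - 2 *\<^sub>R H i i x t) \<le> 2 * B2 * s\<^sup>2"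
    if x: "x + s *\<^sub>R axis i 1 \<in> cube" "x + (- s) *\<^sub>R axis i 1 \<in> cube" "x \<in> cube" and t: "t \<in> {0..T}" for i x s t
  proof (rule ae_le[OF _ _ t])
    show "continuous_on {0..T} (\<lambda>t. norm (H i i (x + s *\<^sub>R axis i 1) t + H i i (x + (- s) *\<^sub>R axis i 1) t - 2 *\<^sub>R H i i x t))"
      unfolding H_def by (intro continuous_intros tcont c2 x)
    show "norm (H i i (x + s *\<^sub>R axis i 1) t + H i i (x + (- s) *\<^sub>R axis i 1) t - 2 *\<^sub>R H i i x t) \<le> 2 * B2 * s\<^sup>2" if "?P t" for t
      unfolding H_def using that x
      by (intro sd_second_difference[where v'="\<lambda>x. D (minc (minc (munit i) i) i) 0 x t" and v''="\<lambda>x. D (minc (minc (minc (munit i) i) i) i) 0 x t"])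
        (auto simp: mord_minc mord_munit)
  qed
  \<comment> \<open>The boundary condition is given for positive times only; time 0 is a null set
    and follows by continuity.\<close>
  have neum0: "g i x t = 0" if "x \<in> cube" "t \<in> {0..T}" "x $ i = 0 \<or> x $ i = 1" for x t i
  proof -
    have ae: "AE t in lborel. t \<noteq> (0::real)" by (rule AE_lborel_singleton)
    have "norm (g i x t) \<le> 0"
    proof (rule continuous_le_AE[OF T _ ae _ that(2), where \<phi>="\<lambda>t. norm (g i x t)"])
      show "continuous_on {0..T} (\<lambda>t. norm (g i x t))"
        unfolding g_def by (intro continuous_intros tcont c1 that) simp
    qed (use that neum in \<open>auto simp: g_def\<close>)
    then show ?thesis by simp
  qed
  have h1sq: "B \<ge> 1" "B1 \<le> B" "2 * B1 \<le> B" "B2 \<le> B" "2 * B2 \<le> B" using B10 by (auto simp: B_def)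
  have "exact_solution \<alpha> T B me (D z 1) g H"
    unfolding exact_solution_def
  proof (intro conjI ballI allI impI)
    show "B \<ge> 1" by fact
    fix t assume t: "t \<in> {0..T}"
    show "smooth3 B (\<lambda>x. me x t) (\<lambda>i x. g i x t) (\<lambda>i j x. H i j x t)"
      unfolding smooth3_def
    proof (intro conjI ballI allI impI)
      show "spatial_deriv (\<lambda>x. me x t) i (\<lambda>x. g i x t)" for i
      proof -
        have 1: "spatial_deriv (\<lambda>x. D z 0 x t) i (\<lambda>x. g i x t)"
          using sd[OF c0 _ t, of 0 i] c1[of 0 i] by (simp add: g_def mz)
        show ?thesis unfolding spatial_deriv_def
        proof
          fix x assume x: "x \<in> cube"
          have "((\<lambda>s. D z 0 (x + s *\<^sub>R axis i 1) t) has_vector_derivative g i x t) (at 0 within {s. x + s *\<^sub>R axis i 1 \<in> cube})"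
            using 1 x by (simp add: spatial_deriv_def)
          then show "((\<lambda>s. me (x + s *\<^sub>R axis i 1) t) has_vector_derivative g i x t) (at 0 within {s. x + s *\<^sub>R axis i 1 \<in> cube})"
            by (rule has_vector_derivative_weaken) (use x me t in auto)
        qed
      qed
      show "spatial_deriv (\<lambda>x. g i x t) j (\<lambda>x. H i j x t)" for i j
        unfolding g_def H_def using sd[OF c1 c2 t] by simp
      show "(\<lambda>x. H i j x t) = (\<lambda>x. H j i x t)" for i j
        unfolding H_def using minc_commute[of z i j] by (simp add: mz)
      show "norm (g i x t) \<le> B" if "x \<in> cube" for x i
        using B1[OF i1 that t, of 0 i] h1sq by (simp add: g_def)
      show "norm (H i j x t) \<le> B" if "x \<in> cube" for x i j
        using B1[OF i2 that t, of i j] h1sq by (simp add: H_def)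
      show "norm (H i j (x + s *\<^sub>R axis l 1) t - H i j x t) \<le> B * \<bar>s\<bar>" if "x \<in> cube \<and> x + s *\<^sub>R axis l 1 \<in> cube" for i j l x s
        using hl[of x s l t i j] that t mult_right_mono[OF h1sq(4) abs_ge_zero[of s]] by auto
      show "norm (H i i (x + s *\<^sub>R axis i 1) t + H i i (x + - s *\<^sub>R axis i 1) t - 2 *\<^sub>R H i i x t) \<le> B * s\<^sup>2"
        if "x + s *\<^sub>R axis i 1 \<in> cube \<and> x + - s *\<^sub>R axis i 1 \<in> cube" for i x s
        using hs[OF conjunct1[OF that] conjunct2[OF that] cube_midpoint[OF conjunct1[OF that] conjunct2[OF that]] t]
          mult_right_mono[OF h1sq(5) zero_le_power2[of s]] by linarith
      show "g i x t = 0" if "x \<in> cube" "x $ i = 0 \<or> x $ i = 1" for x i using neum0 that t by blast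
    qed
  next
    fix x t assume x: "x \<in> cube"
    show "norm (me x t) = 1" if "t \<in> {0..T}" using one x that by blast
    show "D z 1 x t = - cross3 (me x t) (\<Sum>i\<in>UNIV. H i i x t) + \<alpha> *\<^sub>R (\<Sum>i\<in>UNIV. H i i x t)
         + (\<alpha> * (\<Sum>i\<in>UNIV. (norm (g i x t))\<^sup>2)) *\<^sub>R me x t" if "t \<in> {0<..T}"
      unfolding H_def g_def by (rule pde[OF x that])
    fix k assume k: "0 < k \<and> 0 \<le> t - 2 * k \<and> t \<le> T"
    have tt: "t \<in> {0..T}" "t - k \<in> {0..T}" "t - 2 * k \<in> {0..T}" using k by auto
    have d0: "((\<lambda>s. D z j x s) has_vector_derivative D z (Suc j) x s) (at s within {0..T})" if "s \<in> {0..T}" "j \<le> 2" for s j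
      using td[OF c0 c0 x that(1), of j] that by simp
    have d1: "((\<lambda>s. D (munit i) j x s) has_vector_derivative D (munit i) (Suc j) x s) (at s within {0..T})" if "s \<in> {0..T}" "j \<le> 1" for i s j
      using td[OF c1 c1 x that(1), of j i] that by simp
    have b0: "norm (D z j x s) \<le> B1" if "s \<in> {0..T}" "j \<le> 3" for s j using B1[OF i0 x] that by blast
    have b1: "norm (D (munit i) j x s) \<le> B1" if "s \<in> {0..T}" "j \<le> 2" for i s j using B1[OF i1 x] that by blast
    have kk: "0 < k" "0 \<le> t - 2 * k" "t \<le> T" using k by auto
    have up: "c \<le> B * q" if "c \<le> 2 * B1 * q" "0 \<le> q" for c q using that mult_right_mono[OF h1sq(3) that(2)] by linarith
    show "norm ((3/2) *\<^sub>R me x t - 2 *\<^sub>R me x (t - k) + (1/2) *\<^sub>R me x (t - 2 * k) - k *\<^sub>R D z 1 x t) \<le> B * k ^ 3"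
      using time_bdf2[of T "D z 0 x" "D z 1 x" "D z 2 x" "D z 3 x" B1, OF _ _ _ _ kk] d0[of _ 0] d0[of _ 1] d0[of _ 2] b0[of _ 3]
        me[OF x tt(1)] me[OF x tt(2)] me[OF x tt(3)] kk(1)
      by (intro up) (simp_all add: numeral_2_eq_2 numeral_3_eq_3)
    show "norm (2 *\<^sub>R me x (t - k) - me x (t - 2 * k) - me x t) \<le> B * k\<^sup>2"
      using time_extrapolation[of T "D z 0 x" "D z 1 x" "D z 2 x" B1, OF _ _ _ kk] d0[of _ 0] d0[of _ 1] b0[of _ 2]
        me[OF x tt(1)] me[OF x tt(2)] me[OF x tt(3)]
      by (intro up) (simp_all add: numeral_2_eq_2)
    show "norm (2 *\<^sub>R g i x (t - k) - g i x (t - 2 * k) - g i x t) \<le> B * k\<^sup>2" for i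
      using time_extrapolation[of T "D (munit i) 0 x" "D (munit i) 1 x" "D (munit i) 2 x" B1, OF _ _ _ kk] d1[of _ 0 i] d1[of _ 1 i] b1[of _ 2 i]
      unfolding g_def by (intro up) (simp_all add: numeral_2_eq_2)
    have "norm (D z 0 x t - D z 0 x (t - k)) \<le> B1 * (t - (t - k))"
      using d0[of _ 0] b0[of _ 1] kk by (intro hvd_lipschitz[where v'="D z 1 x" and T=T]) auto
    then show "norm (me x t - me x (t - k)) \<le> B * k"
      using me[OF x tt(1)] me[OF x tt(2)] mult_right_mono[OF h1sq(2) less_imp_le[OF kk(1)]] by simp
  qed
  then show ?thesis by blast
qed

section \<open>The error equation\<close>

text \<open>The consistency errors in order: flux defect of the Laplacian, the same times the
  damping, differences of the length correction, pointwise remainder of the Laplacian, and time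
  errors converted by \<open>k \<le> C2 * h\<close>.\<close>

definition res_const :: "real \<Rightarrow> real \<Rightarrow> real \<Rightarrow> real" where
  "res_const \<alpha> B C2 = B + \<alpha> * B + \<alpha> * (\<alpha> * C2 * (72 * B\<^sup>2 + 36 * B ^ 3)) + 2 * (1 + \<alpha>) * B + B * C2\<^sup>2"

locale run =
  fixes \<alpha> T B :: real and me :: "real^3 \<Rightarrow> real \<Rightarrow> real^3" and ft :: "real^3 \<Rightarrow> real \<Rightarrow> real^3"
    and g :: "3 \<Rightarrow> real^3 \<Rightarrow> real \<Rightarrow> real^3" and H :: "3 \<Rightarrow> 3 \<Rightarrow> real^3 \<Rightarrow> real \<Rightarrow> real^3"
    and C1 C2 :: real and N :: nat and k :: real and m mt :: "nat \<Rightarrow> grid"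
  assumes ex: "exact_solution \<alpha> T B me ft g H" and al: "\<alpha> > 3" and C1: "C1 > 0" and C2: "C2 > 0"
    and N2: "N \<ge> 2" and k0: "k > 0" and k1: "k \<le> 1" and kC1: "C1 * (1 / real N) \<le> k" and kC2: "k \<le> C2 * (1 / real N)"
    and sch: "scheme \<alpha> N k m mt"
begin

definition h where "h = 1 / real N"
definition M where "M n = interp N (\<lambda>x. me x (real n * k))"
text \<open>The factor 2/3 inverts the leading BDF2 coefficient 3/2, so that the correction cancels
  the defect of the averaged gradient exactly. Clamping makes it a Neumann function.\<close>

definition gam where "gam n p = 2/3 * \<alpha> * k * smooth.gdef (\<lambda>x. me x (real n * k)) (\<lambda>i x. g i x (real n * k)) N (clamp_pt N p)"
definition V where "V n p = (1 + gam n p) *\<^sub>R M n p"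
definition er where "er n p = m n p - M n p"
text \<open>Levels 0 and 1 are given and not obtained by normalisation, so their error is taken
  uncorrected.\<close>

definition et where "et n = (if n < 2 then er n else (\<lambda>p. mt n p - V n p))"

lemma N0: "N > 0" and h0: "h > 0" and h1: "h \<le> 1/2" and Nh: "real N * h = 1"
  using N2 by (auto simp: h_def field_simps)

lemma B1: "B \<ge> 1" using ex by (simp add: exact_solution_def)

lemma time_ok: "real n * k \<le> T \<Longrightarrow> real n * k \<in> {0..T}" using k0 by auto

lemma sm: "real n * k \<le> T \<Longrightarrow> smooth B (\<lambda>x. me x (real n * k)) (\<lambda>i x. g i x (real n * k)) (\<lambda>i j x. H i j x (real n * k))"
  unfolding smooth_def using ex time_ok by (auto simp: exact_solution_def)

lemma norm_M: "real n * k \<le> T \<Longrightarrow> norm (M n p) = 1"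
  unfolding M_def interp_cl using ex time_ok gpt_cube[OF clamp_pt_inner[OF N0]] by (auto simp: exact_solution_def)

lemma neumann_M: "neumann N (M n)"
  unfolding M_def interp_cl[abs_def] by (rule neumann_interp_cl[OF N0])

lemma neumann_gam: "neumann N (gam n)"
  unfolding gam_def[abs_def] by (rule neumann_interp_cl[OF N0])

lemma neumann_m: "neumann N (m n)" using sch by (simp add: scheme_def inX_imp_neu)
lemma neumann_mt: "n \<ge> 2 \<Longrightarrow> neumann N (mt n)" using sch by (simp add: scheme_def inX_imp_neu)

lemma neumann_V: "neumann N (V n)"
  unfolding V_def[abs_def] by (rule neumann_comp2[OF neumann_gam neumann_M, where F="\<lambda>a b. (1 + a) *\<^sub>R b"])

lemma neumann_gamM: "neumann N (\<lambda>p. gam n p *\<^sub>R M n p)"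
  by (rule neumann_comp2[OF neumann_gam neumann_M])

lemma neumann_er: "neumann N (er n)"
  unfolding er_def[abs_def] by (rule neumann_comp2[OF neumann_m neumann_M])

lemma neumann_et: "neumann N (et n)"
  using neumann_er[of n] neumann_comp2[OF neumann_mt neumann_V, of n "(-)" n] by (auto simp: et_def)

lemma dd_M: "real n * k \<le> T \<Longrightarrow> p \<in> inner_pts N \<Longrightarrow> norm (dd N d (M n) p) \<le> B"
  unfolding M_def by (rule smooth.dd_interp[OF sm inner_all fw_all N0])

lemma dd_avgA_M: "real n * k \<le> T \<Longrightarrow> p \<in> inner_pts N \<Longrightarrow> norm (dd N d (avgA (M n)) p) \<le> 2 * B"
  unfolding M_def by (rule smooth.dd_avgA_interp[OF sm _ N0])

lemma gam_bound: 
  assumes n: "real n * k \<le> T"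
  shows "\<bar>gam n p\<bar> \<le> 36 * \<alpha> * B\<^sup>2 * h * k"
proof -
  have "\<bar>smooth.gdef (\<lambda>x. me x (real n * k)) (\<lambda>i x. g i x (real n * k)) N (clamp_pt N p)\<bar> \<le> 54 * B\<^sup>2 * h"
    using smooth.gdef_bound[OF sm[OF n] clamp_pt_inner[OF N0] N2] by (simp add: h_def)
  then have "2/3 * \<alpha> * k * \<bar>smooth.gdef (\<lambda>x. me x (real n * k)) (\<lambda>i x. g i x (real n * k)) N (clamp_pt N p)\<bar> \<le> 2/3 * \<alpha> * k * (54 * B\<^sup>2 * h)"
    using al k0 by (intro mult_left_mono) auto
  then show ?thesis using al k0 by (simp add: gam_def abs_mult algebra_simps)
qed

text \<open>Between interior neighbours \<open>gdef_diff_bound\<close> applies; across a wall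
  clamping makes the difference zero. One factor \<open>h\<close> is cancelled by
  \<open>real N\<close>.\<close>

lemma gam_diff_bound:
  assumes n: "real n * k \<le> T" and p: "p \<in> inner_pts N"
  shows "real N * \<bar>gam n (fw d p) - gam n p\<bar> \<le> 72 * \<alpha> * B\<^sup>2 * h * k"
proof (cases "fw d p \<in> inner_pts N")
  case True
  have "\<bar>smooth.gdef (\<lambda>x. me x (real n * k)) (\<lambda>i x. g i x (real n * k)) N (fw d p)
      - smooth.gdef (\<lambda>x. me x (real n * k)) (\<lambda>i x. g i x (real n * k)) N p\<bar> \<le> 108 * B\<^sup>2 * h\<^sup>2"
    using smooth.gdef_diff_bound[OF sm[OF n] p True N2] by (simp add: h_def)
  then have "real N * (2/3 * \<alpha> * k) * \<bar>smooth.gdef (\<lambda>x. me x (real n * k)) (\<lambda>i x. g i x (real n * k)) N (fw d p)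
      - smooth.gdef (\<lambda>x. me x (real n * k)) (\<lambda>i x. g i x (real n * k)) N p\<bar> \<le> real N * (2/3 * \<alpha> * k) * (108 * B\<^sup>2 * h\<^sup>2)"
    using al k0 by (intro mult_left_mono) auto
  also have "\<dots> = 72 * \<alpha> * B\<^sup>2 * h * k * (real N * h)" by (simp add: power2_eq_square)
  finally have 1: "real N * (2/3 * \<alpha> * k) * \<bar>smooth.gdef (\<lambda>x. me x (real n * k)) (\<lambda>i x. g i x (real n * k)) N (fw d p)
      - smooth.gdef (\<lambda>x. me x (real n * k)) (\<lambda>i x. g i x (real n * k)) N p\<bar> \<le> 72 * \<alpha> * B\<^sup>2 * h * k" by (simp add: Nh)
  have e: "\<bar>gam n (fw d p) - gam n p\<bar> = (2/3 * \<alpha> * k) * \<bar>smooth.gdef (\<lambda>x. me x (real n * k)) (\<lambda>i x. g i x (real n * k)) N (fw d p)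
      - smooth.gdef (\<lambda>x. me x (real n * k)) (\<lambda>i x. g i x (real n * k)) N p\<bar>"
    unfolding gam_def clamp_pt_id[OF p] clamp_pt_id[OF True] right_diff_distrib[symmetric] abs_mult using al k0 by simp
  show ?thesis unfolding e using 1 by (simp only: mult.assoc)
next
  case False
  have "clamp_pt N (fw d p) = clamp_pt N p"
    using p False exhaust_3[of d] by (cases p) (auto simp: clamp_pt_def clamp_def fw_def inner_pts_def)
  then show ?thesis using al k0 h0 by (simp add: gam_def)
qed

lemma dd_gamM:
  assumes n: "real n * k \<le> T" and p: "p \<in> inner_pts N"
  shows "norm (dd N d (\<lambda>p. gam n p *\<^sub>R M n p) p) \<le> \<alpha> * C2 * (72 * B\<^sup>2 + 36 * B ^ 3) * h\<^sup>2"
proof -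
  have kh: "h * k \<le> C2 * h\<^sup>2" using mult_left_mono[OF kC2, of h] h0 by (simp add: power2_eq_square h_def mult.assoc mult.left_commute)
  have "dd N d (\<lambda>p. gam n p *\<^sub>R M n p) p = (real N * (gam n (fw d p) - gam n p)) *\<^sub>R M n (fw d p) + gam n p *\<^sub>R dd N d (M n) p"
    by (simp add: dd_def algebra_simps)
  then have "norm (dd N d (\<lambda>p. gam n p *\<^sub>R M n p) p) \<le> real N * \<bar>gam n (fw d p) - gam n p\<bar> + \<bar>gam n p\<bar> * norm (dd N d (M n) p)"
    using norm_triangle_ineq[of "(real N * (gam n (fw d p) - gam n p)) *\<^sub>R M n (fw d p)" "gam n p *\<^sub>R dd N d (M n) p"]
    by (simp add: norm_M[OF n] abs_mult)
  also have "\<dots> \<le> 72 * \<alpha> * B\<^sup>2 * h * k + (36 * \<alpha> * B\<^sup>2 * h * k) * B"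
    using al k0 h0 by (intro add_mono mult_mono gam_diff_bound gam_bound dd_M n p) auto
  also have "\<dots> = \<alpha> * (72 * B\<^sup>2 + 36 * B ^ 3) * (h * k)" by (simp add: algebra_simps power2_eq_square power3_eq_cube)
  also have "\<dots> \<le> \<alpha> * (72 * B\<^sup>2 + 36 * B ^ 3) * (C2 * h\<^sup>2)" using kh al B1 by (intro mult_left_mono) auto
  finally show ?thesis by (simp add: algebra_simps)
qed

lemma res_const_parts:
  "B \<le> res_const \<alpha> B C2" "\<alpha> * B + \<alpha> * (\<alpha> * C2 * (72 * B\<^sup>2 + 36 * B ^ 3)) \<le> res_const \<alpha> B C2"
  "\<alpha> * C2 * (72 * B\<^sup>2 + 36 * B ^ 3) \<le> res_const \<alpha> B C2"
  "2 * (1 + \<alpha>) * B + B * C2\<^sup>2 \<le> res_const \<alpha> B C2" "B * C2\<^sup>2 \<le> res_const \<alpha> B C2"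
proof -
  have nn: "0 \<le> B" "0 \<le> \<alpha> * B" "0 \<le> \<alpha> * C2 * (72 * B\<^sup>2 + 36 * B ^ 3)" "0 \<le> 2 * (1 + \<alpha>) * B" "0 \<le> B * C2\<^sup>2"
    using B1 al C2 by auto
  have a: "1 * (\<alpha> * C2 * (72 * B\<^sup>2 + 36 * B ^ 3)) \<le> \<alpha> * (\<alpha> * C2 * (72 * B\<^sup>2 + 36 * B ^ 3))"
    using al nn by (intro mult_right_mono) auto
  show "B \<le> res_const \<alpha> B C2" "\<alpha> * B + \<alpha> * (\<alpha> * C2 * (72 * B\<^sup>2 + 36 * B ^ 3)) \<le> res_const \<alpha> B C2"
    "\<alpha> * C2 * (72 * B\<^sup>2 + 36 * B ^ 3) \<le> res_const \<alpha> B C2"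
    "2 * (1 + \<alpha>) * B + B * C2\<^sup>2 \<le> res_const \<alpha> B C2" "B * C2\<^sup>2 \<le> res_const \<alpha> B C2"
    unfolding res_const_def using nn a by linarith+
qed

lemma dd_V:
  assumes n: "real n * k \<le> T" and p: "p \<in> inner_pts N"
  shows "norm (dd N d (V n) p) \<le> B + res_const \<alpha> B C2"
proof -
  have "V n = (\<lambda>p. M n p + gam n p *\<^sub>R M n p)" by (simp add: V_def[abs_def] scaleR_add_left)
  then have "dd N d (V n) p = dd N d (M n) p + dd N d (\<lambda>p. gam n p *\<^sub>R M n p) p" by (simp only: dd_linear)
  then have "norm (dd N d (V n) p) \<le> norm (dd N d (M n) p) + norm (dd N d (\<lambda>p. gam n p *\<^sub>R M n p) p)" by (metis norm_triangle_ineq)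
  also have "\<dots> \<le> B + res_const \<alpha> B C2"
  proof (intro add_mono dd_M n p)
    have "h\<^sup>2 \<le> 1" using h0 h1 by (simp add: power_le_one)
    then have "\<alpha> * C2 * (72 * B\<^sup>2 + 36 * B ^ 3) * h\<^sup>2 \<le> \<alpha> * C2 * (72 * B\<^sup>2 + 36 * B ^ 3) * 1"
      using al C2 B1 by (intro mult_left_mono) auto
    then show "norm (dd N d (\<lambda>p. gam n p *\<^sub>R M n p) p) \<le> res_const \<alpha> B C2" using dd_gamM[OF n p, of d] res_const_parts(3) by linarith
  qed
  finally show ?thesis .
qed

definition Wn where "Wn n p = 2 *\<^sub>R M (n - 1) p - M (n - 2) p - M n p"
text \<open>The sum of \<open>M n\<close> and \<open>dn n\<close> is the extrapolated value used by
  the scheme.\<close>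

definition dn where "dn n = (\<lambda>p. 2 *\<^sub>R er (n - 1) p - er (n - 2) p + Wn n p)"

lemma time_back: assumes "n \<ge> 2" shows "real (n - 1) * k = real n * k - k" "real (n - 2) * k = real n * k - 2 * k"
  using assms by (auto simp: of_nat_diff algebra_simps)

lemma k2: "k\<^sup>2 \<le> C2\<^sup>2 * h\<^sup>2"
proof -
  have "k\<^sup>2 \<le> (C2 * h)\<^sup>2" using kC2 k0 by (intro power_mono) (auto simp: h_def)
  then show ?thesis by (simp add: power_mult_distrib)
qed

lemma Bk2: "B * k\<^sup>2 \<le> res_const \<alpha> B C2 * h\<^sup>2"
proof -
  have "B * k\<^sup>2 \<le> B * (C2\<^sup>2 * h\<^sup>2)" using k2 B1 by (intro mult_left_mono) auto
  also have "\<dots> = (B * C2\<^sup>2) * h\<^sup>2" by simp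
  also have "\<dots> \<le> res_const \<alpha> B C2 * h\<^sup>2" using res_const_parts(5) by (intro mult_right_mono) auto
  finally show ?thesis .
qed

lemma W_bounds:
  assumes n: "n \<ge> 2" "real n * k \<le> T" and p: "p \<in> inner_pts N"
  shows "norm (Wn n p) \<le> B * k\<^sup>2" and "norm (dd N d (Wn n) p) \<le> B * k\<^sup>2"
proof -
  define t where "t = real n * k"
  have t: "0 < k" "0 \<le> t - 2 * k" "t \<le> T"
  proof -
    have "real n \<ge> 2" using n(1) by linarith
    then have "real n * k \<ge> 2 * k" using k0 by (intro mult_right_mono) auto
    then show "0 < k" "0 \<le> t - 2 * k" "t \<le> T" using k0 n by (auto simp: t_def)
  qed
  have e: "norm (2 *\<^sub>R me x (t - k) - me x (t - 2 * k) - me x t) \<le> B * k\<^sup>2"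
    "norm (2 *\<^sub>R g i x (t - k) - g i x (t - 2 * k) - g i x t) \<le> B * k\<^sup>2" if "x \<in> cube" for x i
    using ex t that unfolding exact_solution_def by blast+
  have Wn_eq: "Wn n = interp N (\<lambda>x. 2 *\<^sub>R me x (t - k) - me x (t - 2 * k) - me x t)"
    unfolding Wn_def[abs_def] M_def interp_cl[abs_def] time_back[OF n(1)] t_def[symmetric] ..
  show "norm (Wn n p) \<le> B * k\<^sup>2" unfolding Wn_eq interp_cl clamp_pt_id[OF p] by (rule e(1)[OF gpt_cube[OF p]])
  have sdt: "spatial_deriv (\<lambda>x. me x s) d (\<lambda>x. g d x s)" if "s \<in> {0..T}" for s
  proof -
    have "smooth3 B (\<lambda>x. me x s) (\<lambda>i x. g i x s) (\<lambda>i j x. H i j x s)"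
      using ex that unfolding exact_solution_def by blast
    then show ?thesis by (rule smooth.f_sd[OF smooth.intro])
  qed
  have "spatial_deriv (\<lambda>x. 2 *\<^sub>R me x (t - k) - me x (t - 2 * k) - me x t) d (\<lambda>x. 2 *\<^sub>R g d x (t - k) - g d x (t - 2 * k) - g d x t)"
    unfolding spatial_deriv_def
    by (intro ballI has_vector_derivative_diff has_vector_derivative_scaleR[where f="\<lambda>_. 2" and f'=0, simplified]
        sdt[unfolded spatial_deriv_def, rule_format]) (use t in auto)
  then show "norm (dd N d (Wn n) p) \<le> B * k\<^sup>2" unfolding Wn_eq by (rule dd_interp_bound[OF _ e(2) N0 p])
qed

text \<open>The instance of \<open>energy_step\<close> with \<open>V n\<close> as reference for the
  new level and \<open>M\<close> for the old ones; this mismatch removes the first-order defect. The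
  gradient bound is \<open>2 * B\<close>, and the consistency errors are bounded by
  \<open>res_const\<close> times h^2.\<close>

lemma error_energy:
  assumes n: "n \<ge> 2" "real n * k \<le> T" and e: "0 < \<eta>" "\<eta> \<le> 1"
    and d: "\<And>p. p \<in> inner_pts N \<Longrightarrow> norm (dn n p) \<le> \<eta>"
    and Q: "\<And>p. p \<in> inner_pts N \<Longrightarrow> 2 * norm (et n p) * gradsq N (avgA (dn n)) p \<le> \<eta> * gradsq N (avgA (dn n)) p + \<theta> * (norm (et n p))\<^sup>2"
  defines "a \<equiv> et n" and "b \<equiv> er (n - 1)" and "c \<equiv> er (n - 2)"
  shows "l2sq N a + l2sq N (\<lambda>p. 2 *\<^sub>R a p - b p) \<le> l2sq N b + l2sq N (\<lambda>p. 2 *\<^sub>R b p - c p)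
    + 4 * k * ((3/2 + 6 * \<eta> - \<alpha>) * h1sq N a + (1 + (1 + 48 * \<alpha>) * \<eta>) * h1sq N b + (1/2 + (1 + 12 * \<alpha>) * \<eta>) * h1sq N c
        + energy_const \<alpha> (2 * B) \<eta> * (l2sq N a + l2sq N b + l2sq N c + (res_const \<alpha> B C2 * h\<^sup>2)\<^sup>2) + \<alpha> * \<theta> * l2sq N a)"
proof -
  define t where "t = real n * k"
  have t: "0 < k" "0 \<le> t - 2 * k" "t \<le> T" "t \<in> {0<..T}"
  proof -
    have "real n \<ge> 2" using n(1) by linarith
    then have "real n * k \<ge> 2 * k" using k0 by (intro mult_right_mono) auto
    then show "0 < k" "0 \<le> t - 2 * k" "t \<le> T" "t \<in> {0<..T}" using k0 n by (auto simp: t_def)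
  qed
  interpret S: smooth B "\<lambda>x. me x (real n * k)" "\<lambda>i x. g i x (real n * k)" "\<lambda>i j x. H i j x (real n * k)"
    by (rule sm[OF n(2)])
  obtain F rr where Fz: "\<And>d p. p \<in> all_pts N \<Longrightarrow> coord d p = 0 \<or> coord d p = N \<Longrightarrow> F d p = (0::real^3)"
    and F: "\<And>d p. p \<in> inner_pts N \<Longrightarrow> norm (F d p) \<le> B * h\<^sup>2"
    and rr: "\<And>p. p \<in> inner_pts N \<Longrightarrow> norm (rr p) \<le> 2 * B * h\<^sup>2"
    and lap: "\<And>p. p \<in> inner_pts N \<Longrightarrow> lap_h N (M n) p = (\<Sum>d\<in>UNIV. H d d (gpt N p) t)
        + (\<Sum>d\<in>UNIV. real N *\<^sub>R (F d p - F d (bw d p))) + rr p"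
    unfolding M_def h_def t_def by (rule S.laplacian_consistency[OF N0]) blast
  define G where "G = (\<lambda>p. gam n p *\<^sub>R M n p)"
  \<comment> \<open>The Laplacian of the length correction is itself a divergence, of a flux of size
    O(h^2).\<close>
  define Hf where "Hf d p = \<alpha> *\<^sub>R F d p + \<alpha> *\<^sub>R dd N d G p" for d p
  define r1 where "r1 p = (3/2) *\<^sub>R M n p - 2 *\<^sub>R M (n - 1) p + (1/2) *\<^sub>R M (n - 2) p - k *\<^sub>R ft (gpt N p) t" for p
  define r where "r p = - cross3 (M n p) (rr p) + \<alpha> *\<^sub>R rr p - (1 / k) *\<^sub>R r1 p" for p
  have ch: "c' * h\<^sup>2 \<le> res_const \<alpha> B C2 * h\<^sup>2" if "c' \<le> res_const \<alpha> B C2" for c' using that by (intro mult_right_mono) auto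
  have r1: "norm (r1 p) \<le> B * k ^ 3" if p: "p \<in> inner_pts N" for p
  proof -
    have "M n p = me (gpt N p) t" "M (n - 1) p = me (gpt N p) (t - k)" "M (n - 2) p = me (gpt N p) (t - 2 * k)"
      unfolding M_def interp_cl clamp_pt_id[OF p] time_back[OF n(1)] t_def by auto
    then show ?thesis unfolding r1_def using ex t gpt_cube[OF p] unfolding exact_solution_def by auto
  qed
  have er_m: "m j p = er j p + M j p" for j p by (simp add: er_def)
  have Md: "(\<lambda>p. M n p + dn n p) = (\<lambda>q. 2 *\<^sub>R m (n - 1) q - m (n - 2) q)"
    by (rule ext) (simp add: dn_def Wn_def er_def algebra_simps)
  show ?thesis
    unfolding a_def b_def c_def
  proof (rule energy_step[where M="M n" and w="Wn n" and r=r and F=F and H=Hf, OF N0 k0 _ e])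
    show "neumann N (et n)" "neumann N (er (n - 1))" "neumann N (er (n - 2))" "neumann N (M n)" by (rule neumann_et neumann_er neumann_M)+
    show "neumann N (Wn n)" unfolding Wn_def[abs_def]
      by (rule neumann_comp2[OF neumann_comp2[OF neumann_M neumann_M, where F="\<lambda>a b. 2 *\<^sub>R a - b"] neumann_M])
    show "F d p = 0 \<and> Hf d p = 0" if "p \<in> all_pts N" "coord d p = 0 \<or> coord d p = N" for d p
      using Fz[OF that] dd_wall[OF neumann_gamM that] by (simp add: Hf_def G_def)
    show "0 < \<alpha>" "0 \<le> 2 * B" using al B1 by auto
    fix p assume p: "p \<in> inner_pts N"
    show "norm (F d p) \<le> res_const \<alpha> B C2 * h\<^sup>2" for d using F[OF p] ch[OF res_const_parts(1)] by (rule order_trans)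
    show "norm (Hf d p) \<le> res_const \<alpha> B C2 * h\<^sup>2" for d
    proof -
      have "norm (Hf d p) \<le> \<alpha> * norm (F d p) + \<alpha> * norm (dd N d G p)"
        unfolding Hf_def using norm_triangle_ineq[of "\<alpha> *\<^sub>R F d p" "\<alpha> *\<^sub>R dd N d G p"] al by simp
      also have "\<dots> \<le> \<alpha> * (B * h\<^sup>2) + \<alpha> * (\<alpha> * C2 * (72 * B\<^sup>2 + 36 * B ^ 3) * h\<^sup>2)"
        using al F[OF p] dd_gamM[OF n(2) p] unfolding G_def by (intro add_mono mult_left_mono) auto
      also have "\<dots> = (\<alpha> * B + \<alpha> * (\<alpha> * C2 * (72 * B\<^sup>2 + 36 * B ^ 3))) * h\<^sup>2" by (simp add: algebra_simps)
      also have "\<dots> \<le> res_const \<alpha> B C2 * h\<^sup>2" by (rule ch[OF res_const_parts(2)])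
      finally show ?thesis .
    qed
    show "norm (r p) \<le> res_const \<alpha> B C2 * h\<^sup>2"
    proof -
      have 1: "norm (cross3 (M n p) (rr p)) \<le> norm (rr p)"
        using norm_cross_le[of "M n p" "rr p"] norm_M[OF n(2)] by simp
      have 2: "norm ((1 / k) *\<^sub>R r1 p) \<le> B * k\<^sup>2"
      proof -
        have "(1 / k) * norm (r1 p) \<le> (1 / k) * (B * k ^ 3)" using r1[OF p] k0 by (intro mult_left_mono) auto
        also have "\<dots> = B * k\<^sup>2" using k0 by (simp add: power2_eq_square power3_eq_cube)
        finally show ?thesis using k0 by simp
      qed
      have "norm (r p) \<le> norm (cross3 (M n p) (rr p)) + \<alpha> * norm (rr p) + norm ((1 / k) *\<^sub>R r1 p)"
        unfolding r_def using norm_triangle_ineq4[of "- cross3 (M n p) (rr p) + \<alpha> *\<^sub>R rr p" "(1 / k) *\<^sub>R r1 p"]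
          norm_triangle_ineq[of "- cross3 (M n p) (rr p)" "\<alpha> *\<^sub>R rr p"] al by simp
      also have "\<dots> \<le> (1 + \<alpha>) * norm (rr p) + B * k\<^sup>2" using 1 2 by (simp add: algebra_simps)
      also have "\<dots> \<le> (1 + \<alpha>) * (2 * B * h\<^sup>2) + B * (C2\<^sup>2 * h\<^sup>2)"
        using rr[OF p] k2 al B1 by (intro add_mono mult_left_mono) auto
      also have "\<dots> = (2 * (1 + \<alpha>) * B + B * C2\<^sup>2) * h\<^sup>2" by (simp add: algebra_simps)
      also have "\<dots> \<le> res_const \<alpha> B C2 * h\<^sup>2" by (rule ch[OF res_const_parts(4)])
      finally show ?thesis .
    qed
    show "norm (Wn n p) \<le> res_const \<alpha> B C2 * h\<^sup>2" using W_bounds(1)[OF n p] Bk2 by linarith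
    show "norm (dd N d (Wn n) p) \<le> res_const \<alpha> B C2 * h\<^sup>2" for d using W_bounds(2)[OF n p, of d] Bk2 by linarith
    show "norm (M n p) \<le> 1" using norm_M[OF n(2)] by simp
    show "norm (dd N d (M n) p) \<le> 2 * B" for d using dd_M[OF n(2) p, of d] B1 by linarith
    show "norm (dd N d (avgA (M n)) p) \<le> 2 * B" for d by (rule dd_avgA_M[OF n(2) p])
    show "norm (2 *\<^sub>R er (n - 1) p - er (n - 2) p + Wn n p) \<le> \<eta>" using d[OF p] by (simp add: dn_def)
    show "2 * norm (et n p) * gradsq N (avgA (\<lambda>p. 2 *\<^sub>R er (n - 1) p - er (n - 2) p + Wn n p)) p
      \<le> \<eta> * gradsq N (avgA (\<lambda>p. 2 *\<^sub>R er (n - 1) p - er (n - 2) p + Wn n p)) p + \<theta> * (norm (et n p))\<^sup>2"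
      using Q[OF p] unfolding dn_def .
    define mh where "mh = (\<lambda>q. 2 *\<^sub>R m (n - 1) q - m (n - 2) q)"
    define L where "L = (\<Sum>d\<in>UNIV. H d d (gpt N p) t)"
    define gs where "gs = (\<Sum>i\<in>UNIV. (norm (g i (gpt N p) t))\<^sup>2)"
    define dF where "dF = (\<Sum>d\<in>UNIV. real N *\<^sub>R (F d p - F d (bw d p)))"
    have Mt: "M n p = me (gpt N p) t" unfolding M_def interp_cl clamp_pt_id[OF p] t_def ..
    have pde: "ft (gpt N p) t = - cross3 (M n p) L + \<alpha> *\<^sub>R L + (\<alpha> * gs) *\<^sub>R M n p"
      unfolding Mt L_def gs_def using ex t gpt_cube[OF p] unfolding exact_solution_def by blast
    \<comment> \<open>Times 3/2, the correction equals \<open>k\<close> times the first-order defect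
      of the gradient term; as \<open>gm'\<close> it cancels that defect in the error
      equation.\<close>
    have gm: "(3/2) * gam n p = \<alpha> * k * (gradsq N (avgA (M n)) p - gs)"
      unfolding gam_def clamp_pt_id[OF p] S.gdef_def M_def gs_def t_def by simp
    have s: "(3/2) *\<^sub>R mt n p - 2 *\<^sub>R m (n - 1) p + (1/2) *\<^sub>R m (n - 2) p
      = k *\<^sub>R (- cross3 (mh p) (lap_h N mh p) + \<alpha> *\<^sub>R lap_h N (mt n) p + (\<alpha> * gradsq N (avgA mh) p) *\<^sub>R mh p)"
    proof -
      have "(1 / k) *\<^sub>R ((3/2) *\<^sub>R mt n p - 2 *\<^sub>R m (n - 1) p + (1/2) *\<^sub>R m (n - 2) p)
        = - cross3 (mh p) (lap_h N mh p) + \<alpha> *\<^sub>R lap_h N (mt n) p + (\<alpha> * gradsq N (avgA mh) p) *\<^sub>R mh p"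
        using sch n(1) p unfolding scheme_def Let_def mh_def by blast
      then have "k *\<^sub>R ((1 / k) *\<^sub>R ((3/2) *\<^sub>R mt n p - 2 *\<^sub>R m (n - 1) p + (1/2) *\<^sub>R m (n - 2) p))
        = k *\<^sub>R (- cross3 (mh p) (lap_h N mh p) + \<alpha> *\<^sub>R lap_h N (mt n) p + (\<alpha> * gradsq N (avgA mh) p) *\<^sub>R mh p)" by (rule arg_cong)
      then show ?thesis using k0 by simp
    qed
    have lmt: "lap_h N (mt n) p = lap_h N (et n) p + lap_h N (M n) p + lap_h N G p"
    proof -
      have "mt n = (\<lambda>p. et n p + M n p + G p)" using n(1) by (auto simp: et_def V_def G_def algebra_simps fun_eq_iff)
      then have "dd N d (mt n) q = dd N d (et n) q + dd N d (M n) q + dd N d G q" for d q by (simp only: dd_linear)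
      then show ?thesis unfolding lap_h_dd[OF p] by (simp add: sum_3 algebra_simps)
    qed
    have dH: "(\<Sum>d\<in>UNIV. real N *\<^sub>R (Hf d p - Hf d (bw d p))) = \<alpha> *\<^sub>R dF + \<alpha> *\<^sub>R lap_h N G p"
      unfolding Hf_def dF_def lap_h_dd[OF p] by (simp add: sum_3 algebra_simps)
    have lapn: "lap_h N (M n) p = L + dF + rr p" unfolding L_def dF_def by (rule lap[OF p])
    have ettm: "et n p = mt n p - (1 + gam n p) *\<^sub>R M n p" using n(1) by (simp add: et_def V_def)
    have kr1: "k *\<^sub>R r p = k *\<^sub>R (- cross3 (M n p) (rr p) + \<alpha> *\<^sub>R rr p) - r1 p"
      unfolding r_def using k0 by (simp add: scaleR_diff_right)
    have gm': "(3/2) *\<^sub>R (gam n p *\<^sub>R M n p) = k *\<^sub>R ((\<alpha> * gradsq N (avgA (M n)) p) *\<^sub>R M n p - (\<alpha> * gs) *\<^sub>R M n p)"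
      unfolding scaleR_scaleR gm scaleR_left_diff_distrib[symmetric] by (simp add: algebra_simps)
    have lhs: "(3/2) *\<^sub>R et n p - 2 *\<^sub>R er (n - 1) p + (1/2) *\<^sub>R er (n - 2) p
      = ((3/2) *\<^sub>R mt n p - 2 *\<^sub>R m (n - 1) p + (1/2) *\<^sub>R m (n - 2) p) - (k *\<^sub>R ft (gpt N p) t + r1 p) - (3/2) *\<^sub>R (gam n p *\<^sub>R M n p)"
      unfolding ettm er_def r1_def by (simp add: scaleR_add_left scaleR_diff_right scaleR_add_right)
    have rhs: "k *\<^sub>R (- (cross3 (mh p) (lap_h N mh p) - cross3 (M n p) (lap_h N (M n) p)) + \<alpha> *\<^sub>R lap_h N (et n) p
        + \<alpha> *\<^sub>R (gradsq N (avgA mh) p *\<^sub>R mh p - gradsq N (avgA (M n)) p *\<^sub>R M n p)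
        - cross3 (M n p) dF + (\<alpha> *\<^sub>R dF + \<alpha> *\<^sub>R lap_h N G p) + r p)
      = k *\<^sub>R (- cross3 (mh p) (lap_h N mh p) + \<alpha> *\<^sub>R lap_h N (mt n) p + (\<alpha> * gradsq N (avgA mh) p) *\<^sub>R mh p)
        - (k *\<^sub>R ft (gpt N p) t + r1 p) - k *\<^sub>R ((\<alpha> * gradsq N (avgA (M n)) p) *\<^sub>R M n p - (\<alpha> * gs) *\<^sub>R M n p)"
    proof -
      have c: "cross3 (M n p) (lap_h N (M n) p) = cross3 (M n p) L + cross3 (M n p) dF + cross3 (M n p) (rr p)"
        by (simp add: lapn cross_add_right)
      show ?thesis
        unfolding scaleR_add_right[of k _ "r p"] kr1 pde lmt c unfolding lapn
        by (simp add: scaleR_add_right scaleR_diff_right)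
    qed
    show "(3/2) *\<^sub>R et n p - 2 *\<^sub>R er (n - 1) p + (1/2) *\<^sub>R er (n - 2) p = k *\<^sub>R
      ( - (cross3 (M n p + (2 *\<^sub>R er (n - 1) p - er (n - 2) p + Wn n p)) (lap_h N (\<lambda>p. M n p + (2 *\<^sub>R er (n - 1) p - er (n - 2) p + Wn n p)) p) - cross3 (M n p) (lap_h N (M n) p)) + \<alpha> *\<^sub>R lap_h N (et n) p
        + \<alpha> *\<^sub>R (gradsq N (avgA (\<lambda>p. M n p + (2 *\<^sub>R er (n - 1) p - er (n - 2) p + Wn n p))) p *\<^sub>R (M n p + (2 *\<^sub>R er (n - 1) p - er (n - 2) p + Wn n p)) - gradsq N (avgA (M n)) p *\<^sub>R M n p)
        - cross3 (M n p) (\<Sum>d\<in>UNIV. real N *\<^sub>R (F d p - F d (bw d p)))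
        + (\<Sum>d\<in>UNIV. real N *\<^sub>R (Hf d p - Hf d (bw d p))) + r p)"
    proof -
      have Md': "(\<lambda>p. M n p + (2 *\<^sub>R er (n - 1) p - er (n - 2) p + Wn n p)) = mh" using Md unfolding dn_def mh_def .
      have Mdp: "M n p + (2 *\<^sub>R er (n - 1) p - er (n - 2) p + Wn n p) = mh p" using fun_cong[OF Md', of p] .
      show ?thesis unfolding Md' Mdp dH dF_def[symmetric] lhs rhs s gm' ..
    qed
  qed
qed

text \<open>What normalisation hands from \<open>et\<close> to \<open>er\<close>: the lost factors,
  with \<open>1 + \<eta>\<close> for gradients, and pointwise smallness. At the starting levels the
  two errors coincide.\<close>

definition good where "good \<eta> \<epsilon> n \<longleftrightarrow> l2sq N (er n) \<le> 16 * l2sq N (et n) \<and>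
    h1sq N (er n) \<le> (1 + \<eta>) * h1sq N (et n) + 1728 * (B + res_const \<alpha> B C2)\<^sup>2 * (1 + 4/\<eta>) * l2sq N (et n) \<and>
    (\<forall>p\<in>inner_pts N. (norm (er n p))\<^sup>2 \<le> 16 * \<epsilon> * h) \<and>
    (n \<ge> 2 \<longrightarrow> (\<forall>p\<in>inner_pts N. mt n p \<noteq> 0 \<and> m n p = unitv (mt n p)))"

lemma goodI:
  assumes n: "real n * k \<le> T" and e: "0 < \<eta>" "\<eta> \<le> 1" and gs: "36 * \<alpha> * B\<^sup>2 * h * k \<le> \<eta>/224" and eps: "\<epsilon> * h \<le> (\<eta>/224)\<^sup>2" "\<epsilon> > 0"
    and s: "\<And>p. p \<in> inner_pts N \<Longrightarrow> (norm (et n p))\<^sup>2 \<le> \<epsilon> * h"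
  shows "good \<eta> \<epsilon> n"
proof (cases "n < 2")
  case True
  have "(norm (er n p))\<^sup>2 \<le> 16 * \<epsilon> * h" if "p \<in> inner_pts N" for p
  proof -
    have "0 < \<epsilon> * h" using eps h0 by simp
    then show ?thesis using s[OF that] True by (simp add: et_def)
  qed
  moreover have "0 \<le> 1728 * (B + res_const \<alpha> B C2)\<^sup>2 * (1 + 4/\<eta>) * l2sq N (er n)" using e l2sq_nonneg by auto
  moreover have "0 \<le> \<eta> * h1sq N (er n)" using e h1sq_nonneg by auto
  ultimately show ?thesis using True l2sq_nonneg[of N "er n"] unfolding good_def by (simp add: et_def algebra_simps)
next
  case False
  then have n2: "n \<ge> 2" by simp
  have mn: "m n p = unitv (mt n p)" if "p \<in> all_pts N" for p
    using sch n2 that unfolding scheme_def unitv_def by auto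
  have Vp: "unitv (V n p) = M n p \<and> norm (V n p) \<ge> 1 - \<eta>/224" for p
  proof -
    have g: "\<bar>gam n p\<bar> \<le> \<eta>/224" using gam_bound[OF n] gs by (rule order_trans)
    then have pos: "1 + gam n p > 0" using e by linarith
    have "norm (V n p) = 1 + gam n p" using pos by (simp add: V_def norm_M[OF n])
    then show ?thesis using pos g by (simp add: unitv_def V_def norm_M[OF n])
  qed
  have a: "norm (mt n p - V n p) \<le> \<eta>/224" if "p \<in> inner_pts N" for p
  proof -
    have "(norm (mt n p - V n p))\<^sup>2 \<le> (\<eta>/224)\<^sup>2" using s[OF that] eps n2 by (simp add: et_def)
    then show ?thesis by (rule power2_le_imp_le) (use e in simp)
  qed
  note pe0 = projection_estimates[OF N0 e neumann_mt[OF n2] neumann_M neumann_V Vp dd_V[OF n] a]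
  have pe1: "h1sq N (\<lambda>p. unitv (mt n p) - M n p) \<le> (1 + \<eta>) * h1sq N (\<lambda>p. mt n p - V n p) + 1728 * (B + res_const \<alpha> B C2)\<^sup>2 * (1 + 4/\<eta>) * l2sq N (\<lambda>p. mt n p - V n p)"
    and pe2: "l2sq N (\<lambda>p. unitv (mt n p) - M n p) \<le> 16 * l2sq N (\<lambda>p. mt n p - V n p)"
    and pe3: "\<And>p. p \<in> inner_pts N \<Longrightarrow> norm (unitv (mt n p) - M n p) \<le> 4 * norm (mt n p - V n p)"
    and pe4: "\<And>p. p \<in> inner_pts N \<Longrightarrow> mt n p \<noteq> 0"
    by (rule pe0; assumption)+
  have etn: "et n = (\<lambda>p. mt n p - V n p)" using n2 by (simp add: et_def)
  have ern: "er n p = unitv (mt n p) - M n p" if "p \<in> all_pts N" for p using mn[OF that] by (simp add: er_def)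
  have A: "l2sq N (er n) = l2sq N (\<lambda>p. unitv (mt n p) - M n p)"
    unfolding l2sq_def by (rule gmean_cong) (simp add: ern inner_all)
  have "h1sq N (er n) = h1sq N (\<lambda>p. unitv (mt n p) - M n p)"
    unfolding h1sq_def by (rule gmean_cong) (simp add: gradsq_dd dd_def ern inner_all fw_all)
  moreover have "(norm (er n p))\<^sup>2 \<le> 16 * \<epsilon> * h" if p: "p \<in> inner_pts N" for p
  proof -
    have "norm (er n p) \<le> 4 * norm (et n p)" using pe3[OF p] by (simp add: ern inner_all p etn)
    then have "(norm (er n p))\<^sup>2 \<le> (4 * norm (et n p))\<^sup>2" by (rule power_mono) simp
    then show ?thesis using s[OF p] by (simp add: power_mult_distrib)
  qed
  ultimately show ?thesis
    unfolding good_def A using pe1 pe2 pe4 mn inner_all by (simp add: etn)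
qed

text \<open>Level 3 is the first at which \<open>m n\<close> and \<open>m (n - 1)\<close> are both
  known to have unit length. The bound \<open>16 * \<epsilon> * h \<le> k\<close> turns pointwise
  smallness into the \<open>k\<close> required by \<open>projection_G_norm\<close>.\<close>

lemma projected_energy:
  assumes n: "n \<ge> 3" "real n * k \<le> T" and gn: "good \<eta> \<epsilon> n" "good \<eta> \<epsilon> (n - 1)" and eps: "16 * \<epsilon> * h \<le> k" and gs: "36 * \<alpha> * B\<^sup>2 * h \<le> 1"
  shows "l2sq N (er n) + l2sq N (\<lambda>p. 2 *\<^sub>R er n p - er (n - 1) p)
    \<le> l2sq N (et n) + l2sq N (\<lambda>p. 2 *\<^sub>R et n p - er (n - 1) p) + (40 + 4 * B\<^sup>2) * k * (l2sq N (er n) + l2sq N (er (n - 1)))"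
proof -
  have n1: "real (n - 1) * k \<le> T"
  proof -
    have "real (n - 1) * k \<le> real n * k" using k0 by (intro mult_right_mono) auto
    then show ?thesis using n by linarith
  qed
  have et: "et n = (\<lambda>p. mt n p - (1 + gam n p) *\<^sub>R M n p)" using n by (simp add: et_def V_def fun_eq_iff)
  show ?thesis
    unfolding et er_def[abs_def]
  proof (rule projection_G_grid[OF k0 k1])
    fix p assume p: "p \<in> inner_pts N"
    have g: "\<bar>gam n p\<bar> \<le> k"
    proof -
      have "36 * \<alpha> * B\<^sup>2 * h * k \<le> 1 * k" using gs k0 by (intro mult_right_mono) auto
      then show ?thesis using gam_bound[OF n(2), of p] by linarith
    qed
    have e: "(norm (er n p))\<^sup>2 \<le> k" "(norm (er (n - 1) p))\<^sup>2 \<le> k" using gn p eps unfolding good_def by force+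
    have u: "mt n p \<noteq> 0" "m n p = unitv (mt n p)" "norm (m (n - 1) p) = 1"
      using gn n p unfolding good_def by (auto simp: norm_nz)
    have "norm (me (gpt N p) (real n * k) - me (gpt N p) (real n * k - k)) \<le> B * k"
    proof -
      have "real n \<ge> 2" using n(1) by linarith
      then have "0 \<le> real n * k - 2 * k" using mult_right_mono[of 2 "real n" k] k0 by simp
      then show ?thesis using ex n k0 gpt_cube[OF p] unfolding exact_solution_def by blast
    qed
    then have "norm (M n p - M (n - 1) p) \<le> B * k"
      unfolding M_def interp_cl clamp_pt_id[OF p] using n by (simp add: of_nat_diff algebra_simps)
    then show "mt n p \<noteq> 0 \<and> m n p = unitv (mt n p) \<and> norm (M n p) = 1 \<and> norm (M (n - 1) p) = 1 \<and> norm (m (n - 1) p) = 1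
        \<and> \<bar>gam n p\<bar> \<le> k \<and> (norm (m n p - M n p))\<^sup>2 \<le> k \<and> (norm (m (n - 1) p - M (n - 1) p))\<^sup>2 \<le> k \<and> norm (M n p - M (n - 1) p) \<le> B * k"
      using g e u norm_M[OF n(2)] norm_M[OF n1] by (simp add: er_def)
  qed
qed

end

section \<open>Stability\<close>

text \<open>With \<open>C1 * h \<le> k\<close> the hypotheses give \<open>l2sq\<close> of size
  O(h^4) and \<open>h1sq\<close> of size O(h^3). After the factor N^2 of \<open>agmon\<close> there
  remain O(h^2) and \<tau> times O(h): \<tau> is chosen for the second, then the mesh threshold for
  the first.\<close>

lemma agmon_small:
  assumes e: "\<epsilon> > 0" and K: "K > 0" and C1: "C1 > 0"
  shows "\<exists>\<delta>>0. \<forall>N k f. N > 0 \<and> 1 / real N < \<delta> \<and> C1 * (1 / real N) \<le> k \<and> l2sq N f \<le> K * (1 / real N) ^ 4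
      \<and> k * h1sq N f \<le> K * (1 / real N) ^ 4 \<longrightarrow> (\<forall>p\<in>inner_pts N. (norm (f p))\<^sup>2 \<le> \<epsilon> * (1 / real N))"
proof -
  define \<tau> where "\<tau> = \<epsilon> * C1 / (2 * K)"
  have tau: "\<tau> > 0" using assms by (simp add: \<tau>_def)
  define \<delta> where "\<delta> = \<epsilon> / (2 * (1 + 1/\<tau>) * K)"
  have d: "\<delta> > 0" using assms tau by (simp add: \<delta>_def add_pos_pos)
  show ?thesis
  proof (intro exI[of _ \<delta>] conjI d allI impI ballI)
    fix N k f p
    assume A: "N > 0 \<and> 1 / real N < \<delta> \<and> C1 * (1 / real N) \<le> k \<and> l2sq N f \<le> K * (1 / real N) ^ 4 \<and> k * h1sq N f \<le> K * (1 / real N) ^ 4"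
      and p: "p \<in> inner_pts N"
    define h where "h = 1 / real N"
    have h: "h > 0" "h < \<delta>" "C1 * h \<le> k" "l2sq N f \<le> K * h ^ 4" "k * h1sq N f \<le> K * h ^ 4" "real N * h = 1"
      using A by (auto simp: h_def)
    have "C1 * h * h1sq N f \<le> k * h1sq N f" using h h1sq_nonneg by (intro mult_right_mono) auto
    also have "\<dots> \<le> K * h ^ 4" by (rule h)
    also have "K * h ^ 4 = C1 * h * (K * h ^ 3 / C1)" using C1 by (simp add: power3_eq_cube power4_eq_xxxx)
    finally have bb: "h1sq N f \<le> K * h ^ 3 / C1" using h C1 by (simp add: pos_le_divide_eq mult.commute)
    have "(norm (f p))\<^sup>2 \<le> (real N)\<^sup>2 * ((1 + 1/\<tau>) * l2sq N f + \<tau> * h1sq N f)" by (rule agmon[OF p tau])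
    also have "\<dots> \<le> (real N)\<^sup>2 * ((1 + 1/\<tau>) * (K * h ^ 4) + \<tau> * (K * h ^ 3 / C1))"
      using h bb tau by (intro mult_left_mono add_mono) auto
    also have "\<dots> = (real N * h)\<^sup>2 * ((1 + 1/\<tau>) * K * h\<^sup>2 + \<tau> * K / C1 * h)"
      by (simp add: power2_eq_square power3_eq_cube power4_eq_xxxx algebra_simps)
    also have "\<dots> = ((1 + 1/\<tau>) * K * h) * h + \<tau> * K / C1 * h" using h(6) by (simp add: power2_eq_square)
    also have "\<dots> \<le> (\<epsilon> / 2) * h + (\<epsilon> / 2) * h"
    proof (intro add_mono mult_right_mono)
      have "(1 + 1/\<tau>) * K * h \<le> (1 + 1/\<tau>) * K * \<delta>" using h tau K by (intro mult_left_mono) auto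
      also have "\<dots> = \<epsilon> / 2"
      proof -
        define s where "s = 1 + 1/\<tau>"
        have "s > 0" using tau by (simp add: s_def add_pos_pos)
        then show ?thesis using K unfolding \<delta>_def s_def[symmetric] by simp
      qed
      finally show "(1 + 1/\<tau>) * K * h \<le> \<epsilon> / 2" .
      show "\<tau> * K / C1 \<le> \<epsilon> / 2" using K C1 by (simp add: \<tau>_def)
    qed (use h in auto)
    finally show "(norm (f p))\<^sup>2 \<le> \<epsilon> * (1 / real N)" by (simp add: h_def)
  qed
qed

lemma l2sq_two_minus: "l2sq N (\<lambda>p. 2 *\<^sub>R b p - c p) \<le> 8 * l2sq N b + 2 * l2sq N c"
proof -
  have "l2sq N (\<lambda>p. 2 *\<^sub>R b p - c p) \<le> gmean N (\<lambda>p. 8 * (norm (b p))\<^sup>2 + 2 * (norm (c p))\<^sup>2)"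
    unfolding l2sq_def
  proof (rule gmean_mono)
    fix p
    have "0 \<le> (norm (2 *\<^sub>R b p + c p))\<^sup>2" by simp
    then show "(norm (2 *\<^sub>R b p - c p))\<^sup>2 \<le> 8 * (norm (b p))\<^sup>2 + 2 * (norm (c p))\<^sup>2"
      unfolding power2_norm_eq_inner
      by (simp add: inner_diff_left inner_diff_right inner_add_left inner_add_right inner_commute[of "c p" "b p"])
  qed
  then show ?thesis by (simp add: gmean_add gmean_cmult l2sq_def)
qed

text \<open>The two older gradient terms are carried inside \<Phi> with weights \<open>Q + R\<close>
  and \<open>R\<close>, so each step consumes them and leaves the surplus \<kappa>, which
  accumulates the gradient sum. In \<open>rec\<close> the conclusion for smaller indices may be
  assumed, because the recursion of the scheme is itself conditional on small errors.\<close>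

lemma gronwall_two_step:
  fixes G \<beta> A :: "nat \<Rightarrow> real"
  assumes b: "\<And>j. \<beta> j \<ge> 0" and A: "\<And>j. A j \<le> G j" and k: "k \<ge> 0" and C: "C \<ge> 0" "k * C \<le> 1/4"
    and Q: "Q \<ge> 0" and R: "R \<ge> 0" and \<kappa>: "\<kappa> \<ge> 0" and \<rho>: "\<rho> \<ge> 0" and P: "P = Q + R + \<kappa>"
  defines "\<Phi> \<equiv> (\<lambda>n. G n + k * (Q + R) * \<beta> n + k * R * \<beta> (n - 1) + k * \<kappa> * (\<Sum>i\<in>{2..n}. \<beta> i))"
  assumes A1: "A 1 \<le> \<Phi> 2" and P2: "0 \<le> \<Phi> 2"
    and rec: "\<And>n. 3 \<le> n \<Longrightarrow> n \<le> L \<Longrightarrow> (\<And>j. 2 \<le> j \<Longrightarrow> j < n \<Longrightarrow> \<Phi> j + \<rho> \<le> (\<Phi> 2 + \<rho>) * exp (6 * (k * C) * real j)) \<Longrightarrow>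
       G n + k * P * \<beta> n \<le> G (n - 1) + k * Q * \<beta> (n - 1) + k * R * \<beta> (n - 2) + k * C * (A n + A (n - 1) + A (n - 2) + \<rho>)"
  shows "2 \<le> n \<Longrightarrow> n \<le> L \<Longrightarrow> \<Phi> n + \<rho> \<le> (\<Phi> 2 + \<rho>) * exp (6 * (k * C) * real n)"
proof (induction n rule: less_induct)
  case (less n)
  define D where "D = \<Phi> 2 + \<rho>"
  define x where "x = k * C"
  have D: "D \<ge> 0" and x: "0 \<le> x" "x \<le> 1/4" using P2 \<rho> k C by (auto simp: D_def x_def)
  have IH: "\<Phi> j + \<rho> \<le> D * exp (6 * x * real j)" if "2 \<le> j" "j < n" for j
    using less.IH[OF that(2) that(1)] less.prems that unfolding D_def x_def by simp
  show ?case
  proof (cases "n = 2")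
    case True
    have "D * 1 \<le> D * exp (6 * x * real n)" using D x by (intro mult_left_mono) auto
    then show ?thesis using True by (simp add: D_def x_def)
  next
    case False
    then have n3: "3 \<le> n" using less.prems by simp
    have AP: "A j \<le> \<Phi> j" for j
    proof -
      have "0 \<le> k * (Q + R) * \<beta> j + k * R * \<beta> (j - 1) + k * \<kappa> * (\<Sum>i\<in>{2..j}. \<beta> i)"
        using k Q R \<kappa> b by (intro add_nonneg_nonneg mult_nonneg_nonneg sum_nonneg) auto
      then show ?thesis using A[of j] unfolding \<Phi>_def by linarith
    qed
    have r: "G n + k * P * \<beta> n \<le> G (n - 1) + k * Q * \<beta> (n - 1) + k * R * \<beta> (n - 2) + x * (A n + A (n - 1) + A (n - 2) + \<rho>)"
      using rec[OF n3 less.prems(2)] IH unfolding x_def D_def by simp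
    have "{2..n} = insert n {2..n - 1}" "n \<notin> {2..n - 1}" using n3 by auto
    then have sm: "(\<Sum>i\<in>{2..n}. \<beta> i) = \<beta> n + (\<Sum>i\<in>{2..n - 1}. \<beta> i)" by simp
    have n12: "n - 1 - 1 = n - 2" by simp
    have "\<Phi> n = (G n + k * P * \<beta> n) + k * R * \<beta> (n - 1) + k * \<kappa> * (\<Sum>i\<in>{2..n - 1}. \<beta> i)"
      unfolding \<Phi>_def sm P by (simp add: algebra_simps)
    also have "\<dots> \<le> \<Phi> (n - 1) + x * (A n + A (n - 1) + A (n - 2) + \<rho>)"
      using r unfolding \<Phi>_def n12 by (simp add: algebra_simps)
    finally have s1: "\<Phi> n \<le> \<Phi> (n - 1) + x * (A n + A (n - 1) + A (n - 2) + \<rho>)" .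
    define E where "E = D * exp (6 * x * real (n - 1))"
    have mono: "D * exp (6 * x * real i) \<le> E" if "i \<le> n - 1" for i
      unfolding E_def using D x that by (intro mult_left_mono) (auto intro!: mult_left_mono)
    have p1: "\<Phi> (n - 1) + \<rho> \<le> E" unfolding E_def using IH[of "n - 1"] n3 by simp
    \<comment> \<open>For \<open>n = 3\<close> the recursion reaches back to level 1, before \<Phi>
      starts; hence the separate hypothesis \<open>A1\<close>.\<close>
    have p2: "A (n - 2) + \<rho> \<le> E"
    proof (cases "n = 3")
      case True
      have "D * 1 \<le> D * exp (6 * x * real (n - 1))" using D x by (intro mult_left_mono) auto
      then show ?thesis using True A1 unfolding E_def D_def by simp
    next
      case False
      then have "\<Phi> (n - 2) + \<rho> \<le> D * exp (6 * x * real (n - 2))" using n3 by (intro IH) auto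
      moreover have "D * exp (6 * x * real (n - 2)) \<le> E" by (rule mono) simp
      ultimately show ?thesis using AP[of "n - 2"] by linarith
    qed
    have "x * (A n + A (n - 1) + A (n - 2) + \<rho>) \<le> x * (\<Phi> n + (E - \<rho>) + (E - \<rho>) + \<rho>)"
      using AP[of n] AP[of "n - 1"] p1 p2 x by (intro mult_left_mono) auto
    then have "\<Phi> n \<le> (E - \<rho>) + x * (\<Phi> n + (E - \<rho>) + (E - \<rho>) + \<rho>)" using s1 p1 by linarith
    then have s2: "(1 - x) * (\<Phi> n + \<rho>) \<le> (1 + 2 * x) * E - 2 * (x * \<rho>)" by (simp add: algebra_simps)
    have E0: "E \<ge> 0" using D by (simp add: E_def)
    \<comment> \<open>Absorbing \<open>x * \<Phi> n\<close> on the left divides by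
      \<open>1 - x\<close>; for \<open>x \<le> 1/4\<close> the growth factor stays below
      \<open>1 + 6 * x\<close>.\<close>
    have xx: "1 + 2 * x \<le> (1 - x) * (1 + 6 * x)"
    proof -
      have "x * x \<le> x * (1/4)" using x by (intro mult_left_mono) auto
      then show ?thesis using x by (simp add: algebra_simps)
    qed
    have "(1 - x) * (\<Phi> n + \<rho>) \<le> (1 + 2 * x) * E" using s2 mult_nonneg_nonneg[OF x(1) \<rho>] by linarith
    also have "\<dots> \<le> (1 - x) * (1 + 6 * x) * E" using xx E0 by (rule mult_right_mono)
    also have "\<dots> \<le> (1 - x) * (exp (6 * x) * E)"
      unfolding mult.assoc using x E0 exp_ge_add_one_self[of "6 * x"] by (intro mult_left_mono mult_right_mono) auto
    finally have "\<Phi> n + \<rho> \<le> exp (6 * x) * E" using x by simp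
    also have "exp (6 * x) * E = D * exp (6 * x * real n)"
    proof -
      have "real n = 1 + real (n - 1)" using n3 by (simp add: of_nat_diff)
      then have "6 * x * real n = 6 * x * (1 + real (n - 1))" by (rule arg_cong)
      then have "6 * x * real n = 6 * x + 6 * x * real (n - 1)" by (simp only: distrib_left mult_1_right)
      then show ?thesis unfolding E_def by (simp add: exp_add)
    qed
    finally show ?thesis unfolding D_def x_def .
  qed
qed

section \<open>Crude and sharp estimates for one time step\<close>

definition proj_const :: "real \<Rightarrow> real \<Rightarrow> real \<Rightarrow> real \<Rightarrow> real" where
  "proj_const \<alpha> B C2 \<eta> = 1728 * (B + res_const \<alpha> B C2)\<^sup>2 * (1 + 4/\<eta>)"

text \<open>Read off from the end of \<open>crude_step\<close>: 184 is 16 * (37/4 + 9/4), and the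
  outer 2 undoes the 1/2 in front of the new squared norm.\<close>

definition crude_const :: "real \<Rightarrow> real \<Rightarrow> real \<Rightarrow> real \<Rightarrow> real \<Rightarrow> real" where
  "crude_const \<alpha> B C2 \<eta> K = 2 * (184 * K + 8 * (2 + 48 * \<alpha>) * (2 + proj_const \<alpha> B C2 \<eta>) * K + (res_const \<alpha> B C2)\<^sup>2)"

lemma CP0: "\<eta> > 0 \<Longrightarrow> proj_const \<alpha> B C2 \<eta> \<ge> 0" by (simp add: proj_const_def)

context run
begin

text \<open>The upper bounds on \<epsilon> serve normalisation, \<open>projected_energy\<close> and
  \<open>crude_step\<close> in turn. The last three conditions make the length correction and the
  extrapolation error small and let the new norm be absorbed.\<close>

definition small where "small \<eta> \<epsilon> \<longleftrightarrow> 0 < \<eta> \<and> \<eta> \<le> 1/12 \<and> 0 < \<epsilon> \<and> \<epsilon> \<le> (\<eta>/224)\<^sup>2 \<and> \<epsilon> \<le> C1/16 \<and> \<epsilon> \<le> \<eta> / (140000 * C2 * \<alpha>)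
   \<and> 36 * \<alpha> * B\<^sup>2 * h \<le> \<eta>/224 \<and> 3 * B\<^sup>2 * C2 * k \<le> \<epsilon> \<and> 16 * k * energy_const \<alpha> (2 * B) \<eta> \<le> 1"

definition sup_ok where "sup_ok K \<epsilon> \<longleftrightarrow> (\<forall>f. l2sq N f \<le> K * h ^ 4 \<and> k * h1sq N f \<le> K * h ^ 4 \<longrightarrow> (\<forall>p\<in>inner_pts N. (norm (f p))\<^sup>2 \<le> \<epsilon> * h))"

text \<open>Squared errors of second order are O(h^4). The gradient carries the weight
  \<open>k\<close> because only its time sum is controlled.\<close>

definition err_le where "err_le K n \<longleftrightarrow> l2sq N (et n) \<le> K * h ^ 4 \<and> k * h1sq N (et n) \<le> K * h ^ 4"

lemma small_good:
  assumes s: "small \<eta> \<epsilon>" and n: "real n * k \<le> T" and b: "err_le K n" and ag: "sup_ok K \<epsilon>"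
  shows "good \<eta> \<epsilon> n" "\<And>p. p \<in> inner_pts N \<Longrightarrow> (norm (et n p))\<^sup>2 \<le> \<epsilon> * h"
proof -
  show e: "(norm (et n p))\<^sup>2 \<le> \<epsilon> * h" if "p \<in> inner_pts N" for p
    using ag b that unfolding sup_ok_def err_le_def by blast
  have "36 * \<alpha> * B\<^sup>2 * h * k \<le> 36 * \<alpha> * B\<^sup>2 * h * 1" using al h0 k1 by (intro mult_left_mono) auto
  moreover have "\<epsilon> * h \<le> (\<eta>/224)\<^sup>2 * 1" using s h0 h1 unfolding small_def by (intro mult_mono) auto
  ultimately show "good \<eta> \<epsilon> n" using s by (intro goodI[OF n _ _ _ _ _ e]) (auto simp: small_def)
qed

lemma good_BB: "good \<eta> \<epsilon> n \<Longrightarrow> h1sq N (er n) \<le> (1 + \<eta>) * h1sq N (et n) + proj_const \<alpha> B C2 \<eta> * l2sq N (et n)"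
  and good_AA: "good \<eta> \<epsilon> n \<Longrightarrow> l2sq N (er n) \<le> 16 * l2sq N (et n)"
  by (auto simp: good_def proj_const_def)

text \<open>241 = 12 * 16 + 3 * 16 + 1: \<open>norm_three_sq\<close> applied to two old errors
  bounded by \<open>16 * \<epsilon> * h\<close>, with the extrapolation error using up the last
  unit.\<close>

lemma dn_small:
  assumes s: "small \<eta> \<epsilon>" and n: "n \<ge> 2" "real n * k \<le> T" and gd: "good \<eta> \<epsilon> (n - 1)" "good \<eta> \<epsilon> (n - 2)" and p: "p \<in> inner_pts N"
  shows "(norm (dn n p))\<^sup>2 \<le> 241 * \<epsilon> * h" "norm (dn n p) \<le> \<eta>"
proof -
  have k4: "3 * (B * k\<^sup>2)\<^sup>2 \<le> \<epsilon> * h"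
  proof -
    have "3 * (B * k\<^sup>2)\<^sup>2 = (3 * B\<^sup>2 * k) * k * k\<^sup>2" by (simp add: power2_eq_square algebra_simps)
    also have "\<dots> \<le> (3 * B\<^sup>2 * k) * (C2 * h) * 1"
      using kC2 k0 k1 C2 h0 by (intro mult_mono) (auto simp: h_def power_le_one)
    also have "\<dots> = (3 * B\<^sup>2 * C2 * k) * h" by simp
    also have "\<dots> \<le> \<epsilon> * h" using s h0 by (intro mult_right_mono) (auto simp: small_def)
    finally show ?thesis .
  qed
  have "(norm (Wn n p))\<^sup>2 \<le> (B * k\<^sup>2)\<^sup>2" using W_bounds(1)[OF n p] by (rule power_mono) simp
  then have w: "3 * (norm (Wn n p))\<^sup>2 \<le> \<epsilon> * h" using k4 by linarith
  have e: "(norm (er (n - 1) p))\<^sup>2 \<le> 16 * (\<epsilon> * h)" "(norm (er (n - 2) p))\<^sup>2 \<le> 16 * (\<epsilon> * h)" using gd p unfolding good_def by auto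
  show 1: "(norm (dn n p))\<^sup>2 \<le> 241 * \<epsilon> * h"
    unfolding dn_def using norm_three_sq[of "er (n - 1) p" "er (n - 2) p" "Wn n p"] e w by linarith
  have "241 * \<epsilon> * h \<le> 241 * (\<eta>/224)\<^sup>2 * 1" using s h0 h1 unfolding small_def by (intro mult_mono) auto
  also have "\<dots> \<le> \<eta>\<^sup>2" by (simp add: power_divide)
  finally have "(norm (dn n p))\<^sup>2 \<le> \<eta>\<^sup>2" using 1 by linarith
  then show "norm (dn n p) \<le> \<eta>" by (rule power2_le_imp_le) (use s in \<open>simp add: small_def\<close>)
qed

lemma kBB_er:
  assumes "good \<eta> \<epsilon> n" "err_le K n" "0 < \<eta>" "\<eta> \<le> 1"
  shows "k * h1sq N (er n) \<le> (2 + proj_const \<alpha> B C2 \<eta>) * K * h ^ 4" "l2sq N (er n) \<le> 16 * K * h ^ 4"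
proof -
  have "k * h1sq N (er n) \<le> k * ((1 + \<eta>) * h1sq N (et n) + proj_const \<alpha> B C2 \<eta> * l2sq N (et n))"
    using good_BB[OF assms(1)] k0 by (intro mult_left_mono) auto
  also have "\<dots> = (1 + \<eta>) * (k * h1sq N (et n)) + k * (proj_const \<alpha> B C2 \<eta> * l2sq N (et n))" by (simp add: algebra_simps)
  also have "\<dots> \<le> 2 * (K * h ^ 4) + 1 * (proj_const \<alpha> B C2 \<eta> * (K * h ^ 4))"
  proof (rule add_mono)
    have a: "k * h1sq N (et n) \<le> K * h ^ 4" "l2sq N (et n) \<le> K * h ^ 4" using assms(2) by (auto simp: err_le_def)
    show "(1 + \<eta>) * (k * h1sq N (et n)) \<le> 2 * (K * h ^ 4)"
      using a(1) assms k0 by (rule_tac mult_mono) (auto simp: h1sq_nonneg)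
    show "k * (proj_const \<alpha> B C2 \<eta> * l2sq N (et n)) \<le> 1 * (proj_const \<alpha> B C2 \<eta> * (K * h ^ 4))"
      using a(2) k0 k1 CP0[OF assms(3)] by (intro mult_mono[OF k1 mult_left_mono]) (auto simp: l2sq_nonneg)
  qed
  finally show "k * h1sq N (er n) \<le> (2 + proj_const \<alpha> B C2 \<eta>) * K * h ^ 4" by (simp add: algebra_simps)
  show "l2sq N (er n) \<le> 16 * K * h ^ 4" using good_AA[OF assms(1)] assms(2) unfolding err_le_def by linarith
qed

text \<open>No pointwise bound on the new error is available yet. The inverse estimate bounds the
  squared averaged gradient of \<open>dn n\<close> by a multiple of \<epsilon>/h, so \<theta> times
  \<open>k\<close> is O(\<epsilon>) and can be absorbed. The constant grows, but in a way fixed in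
  advance and independent of the level.\<close>

lemma crude_step:
  assumes s: "small \<eta> \<epsilon>" and n: "n \<ge> 2" "real n * k \<le> T" and gd: "good \<eta> \<epsilon> (n - 1)" "good \<eta> \<epsilon> (n - 2)"
    and b: "err_le K (n - 1)" "err_le K (n - 2)"
  shows "err_le (crude_const \<alpha> B C2 \<eta> K) n"
proof -
  have e: "0 < \<eta>" "\<eta> \<le> 1/12" "\<eta> \<le> 1" "\<epsilon> > 0" using s by (auto simp: small_def)
  define \<theta> where "\<theta> = 36 * (real N)\<^sup>2 * (241 * \<epsilon> * h) / \<eta>"
  have th0: "\<theta> \<ge> 0" using e h0 by (simp add: \<theta>_def)
  have dneu: "neumann N (dn n)"
    unfolding dn_def Wn_def using neumann_er neumann_M by (simp add: neumann_def)
  have Q: "2 * norm (et n p) * gradsq N (avgA (dn n)) p \<le> \<eta> * gradsq N (avgA (dn n)) p + \<theta> * (norm (et n p))\<^sup>2" if p: "p \<in> inner_pts N" for p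
  proof -
    define G where "G = gradsq N (avgA (dn n)) p"
    define a where "a = norm (et n p)"
    have s0: "(sqrt (241 * \<epsilon> * h))\<^sup>2 = 241 * \<epsilon> * h" using e h0 by simp
    have G: "0 \<le> G" "G \<le> 36 * (real N)\<^sup>2 * (241 * \<epsilon> * h)"
    proof -
      show "0 \<le> G" unfolding G_def by (rule gradsq_nonneg)
      have "norm (dn n q) \<le> sqrt (241 * \<epsilon> * h)" if "q \<in> inner_pts N" for q
        using dn_small(1)[OF s n gd that] by (intro real_le_rsqrt)
      then show "G \<le> 36 * (real N)\<^sup>2 * (241 * \<epsilon> * h)"
        unfolding G_def using gradsq_avgA_sup[OF dneu N0 _ p, of "sqrt (241 * \<epsilon> * h)"] unfolding s0 by blast
    qed
    have "2 * a \<le> \<eta> + a\<^sup>2 / \<eta>"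
      using zero_le_power2[of "\<eta> - a"] e by (simp add: field_simps power2_eq_square)
    then have "2 * a * G \<le> (\<eta> + a\<^sup>2 / \<eta>) * G" using G(1) by (rule mult_right_mono)
    also have "\<dots> = \<eta> * G + a\<^sup>2 / \<eta> * G" by (simp add: algebra_simps)
    also have "a\<^sup>2 / \<eta> * G \<le> a\<^sup>2 / \<eta> * (36 * (real N)\<^sup>2 * (241 * \<epsilon> * h))" using G(2) e by (intro mult_left_mono) auto
    also have "\<dots> = \<theta> * a\<^sup>2" by (simp add: \<theta>_def)
    finally show ?thesis unfolding G_def a_def by simp
  qed
  define a where "a = l2sq N (et n)" define \<beta> where "\<beta> = k * h1sq N (et n)"
  define b1 where "b1 = l2sq N (er (n - 1))" define c1 where "c1 = l2sq N (er (n - 2))"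
  define b2 where "b2 = k * h1sq N (er (n - 1))" define c2 where "c2 = k * h1sq N (er (n - 2))"
  define X where "X = energy_const \<alpha> (2 * B) \<eta>" define Y where "Y = (res_const \<alpha> B C2 * h\<^sup>2)\<^sup>2"
  have nn: "a \<ge> 0" "\<beta> \<ge> 0" "b1 \<ge> 0" "c1 \<ge> 0" "b2 \<ge> 0" "c2 \<ge> 0" "Y \<ge> 0"
    using l2sq_nonneg h1sq_nonneg k0 by (auto simp: a_def \<beta>_def b1_def c1_def b2_def c2_def Y_def)
  have E: "a + l2sq N (\<lambda>p. 2 *\<^sub>R et n p - er (n - 1) p) \<le> b1 + l2sq N (\<lambda>p. 2 *\<^sub>R er (n - 1) p - er (n - 2) p)
    + (4 * (3/2 + 6 * \<eta> - \<alpha>) * \<beta> + 4 * (1 + (1 + 48 * \<alpha>) * \<eta>) * b2 + 4 * (1/2 + (1 + 12 * \<alpha>) * \<eta>) * c2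
      + 4 * (k * X) * (a + b1 + c1 + Y) + 4 * (k * \<alpha> * \<theta>) * a)"
    using error_energy[OF n e(1,3) dn_small(2)[OF s n gd] Q]
    unfolding a_def \<beta>_def b1_def c1_def b2_def c2_def X_def Y_def by (simp add: algebra_simps)
  have kX: "4 * (k * X) \<le> 1/4" using s unfolding small_def X_def by linarith
  \<comment> \<open>Here 36 * 241 = 8676, and 140000 exceeds 16 * 8676, which yields 1/16.\<close>
  have kth: "4 * (k * \<alpha> * \<theta>) \<le> 1/4"
  proof -
    have "k * \<theta> \<le> (C2 * h) * \<theta>" using kC2 th0 by (intro mult_right_mono) (auto simp: h_def)
    also have "\<dots> = (real N * h)\<^sup>2 * (36 * 241 * C2 * \<epsilon> / \<eta>)" by (simp add: \<theta>_def power2_eq_square)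
    also have "\<dots> = 8676 * C2 * \<epsilon> / \<eta>" by (simp add: Nh)
    finally have "\<alpha> * (k * \<theta>) \<le> \<alpha> * (8676 * C2 * \<epsilon> / \<eta>)" using al by (intro mult_left_mono) auto
    also have "\<dots> = 8676 * (C2 * \<alpha> * \<epsilon>) / \<eta>" by simp
    also have "\<dots> \<le> 8676 * (\<eta> / 140000) / \<eta>"
    proof -
      have "\<epsilon> \<le> \<eta> / (140000 * C2 * \<alpha>)" using s by (simp add: small_def)
      then have "C2 * \<alpha> * \<epsilon> \<le> C2 * \<alpha> * (\<eta> / (140000 * C2 * \<alpha>))" using al C2 by (intro mult_left_mono) auto
      also have "\<dots> = \<eta> / 140000" using al C2 by simp
      finally show ?thesis using e by (intro divide_right_mono mult_left_mono) auto
    qed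
    also have "\<dots> \<le> 1/16" using e by simp
    finally show ?thesis by (simp add: algebra_simps)
  qed
  \<comment> \<open>With \<alpha> > 3 and \<eta> \<le> 1/12 the bracket is at most 3/2 + 1/2 - 3 =
    -1.\<close>
  have t1: "4 * (3/2 + 6 * \<eta> - \<alpha>) * \<beta> \<le> (-4) * \<beta>" using al e nn by (intro mult_right_mono) auto
  have q1: "(1 + 48 * \<alpha>) * \<eta> \<le> (1 + 48 * \<alpha>) * 1" "(1 + 12 * \<alpha>) * \<eta> \<le> (1 + 12 * \<alpha>) * 1"
    using al e by (auto intro!: mult_left_mono)
  have t2: "4 * (1 + (1 + 48 * \<alpha>) * \<eta>) * b2 \<le> 4 * (2 + 48 * \<alpha>) * b2" using q1 nn by (intro mult_right_mono) auto
  have "4 * (1/2 + (1 + 12 * \<alpha>) * \<eta>) \<le> 4 * (2 + 48 * \<alpha>)" 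
  proof -
    define w where "w = (1 + 12 * \<alpha>) * \<eta>"
    have "w \<le> 1 + 12 * \<alpha>" using q1(2) by (simp add: w_def)
    then show ?thesis unfolding w_def[symmetric] using al by simp
  qed
  then have t3: "4 * (1/2 + (1 + 12 * \<alpha>) * \<eta>) * c2 \<le> 4 * (2 + 48 * \<alpha>) * c2" using nn by (intro mult_right_mono)
  have t4: "4 * (k * X) * (a + b1 + c1 + Y) \<le> 1/4 * (a + b1 + c1 + Y)" using kX nn by (intro mult_right_mono) auto
  have t5: "4 * (k * \<alpha> * \<theta>) * a \<le> 1/4 * a" using kth nn by (intro mult_right_mono) auto
  have t6: "l2sq N (\<lambda>p. 2 *\<^sub>R er (n - 1) p - er (n - 2) p) \<le> 8 * b1 + 2 * c1" unfolding b1_def c1_def by (rule l2sq_two_minus)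
  have F: "1/2 * a + 4 * \<beta> \<le> 37/4 * b1 + 9/4 * c1 + 4 * (2 + 48 * \<alpha>) * b2 + 4 * (2 + 48 * \<alpha>) * c2 + 1/4 * Y"
    using E t1 t2 t3 t4 t5 t6 l2sq_nonneg[of N "\<lambda>p. 2 *\<^sub>R et n p - er (n - 1) p"] by simp
  have B1: "b1 \<le> 16 * K * h ^ 4" "b2 \<le> (2 + proj_const \<alpha> B C2 \<eta>) * K * h ^ 4"
    unfolding b1_def b2_def using kBB_er[OF gd(1) b(1) e(1,3)] by auto
  have B2: "c1 \<le> 16 * K * h ^ 4" "c2 \<le> (2 + proj_const \<alpha> B C2 \<eta>) * K * h ^ 4"
    unfolding c1_def c2_def using kBB_er[OF gd(2) b(2) e(1,3)] by auto
  have u1: "4 * (2 + 48 * \<alpha>) * b2 \<le> 4 * (2 + 48 * \<alpha>) * ((2 + proj_const \<alpha> B C2 \<eta>) * K * h ^ 4)" using B1(2) al by (intro mult_left_mono) auto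
  have u2: "4 * (2 + 48 * \<alpha>) * c2 \<le> 4 * (2 + 48 * \<alpha>) * ((2 + proj_const \<alpha> B C2 \<eta>) * K * h ^ 4)" using B2(2) al by (intro mult_left_mono) auto
  have Yh: "Y = (res_const \<alpha> B C2)\<^sup>2 * h ^ 4" by (simp add: Y_def power_mult_distrib)
  have "1/2 * a + 4 * \<beta> \<le> 37/4 * (16 * K * h ^ 4) + 9/4 * (16 * K * h ^ 4)
      + 2 * (4 * (2 + 48 * \<alpha>) * ((2 + proj_const \<alpha> B C2 \<eta>) * K * h ^ 4)) + (res_const \<alpha> B C2)\<^sup>2 * h ^ 4"
    using F B1(1) B2(1) u1 u2 nn(7) unfolding Yh by linarith
  also have "\<dots> = crude_const \<alpha> B C2 \<eta> K * h ^ 4 / 2" unfolding crude_const_def by (simp add: algebra_simps)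
  finally show ?thesis unfolding err_le_def a_def[symmetric] \<beta>_def[symmetric] using nn by simp
qed

text \<open>\<open>err_le\<close> and \<open>sup_ok\<close> now make the new error pointwise small,
  so the quadratic term is absorbed with \<theta> = 0. The old gradients are expressed through
  \<open>et\<close> at the cost of \<open>1 + \<eta>\<close>, so the gradient weights stay
  sharp.\<close>

lemma refined_step:
  assumes s: "small \<eta> \<epsilon>" and n: "n \<ge> 2" "real n * k \<le> T" and gd: "good \<eta> \<epsilon> (n - 1)" "good \<eta> \<epsilon> (n - 2)"
    and b: "err_le K n" and ag: "sup_ok K \<epsilon>"
  defines "q \<equiv> 1 + (1 + 48 * \<alpha>) * \<eta>" and "r \<equiv> 1/2 + (1 + 12 * \<alpha>) * \<eta>"
  shows "l2sq N (et n) + l2sq N (\<lambda>p. 2 *\<^sub>R et n p - er (n - 1) p) + k * (4 * (\<alpha> - 3/2 - 6 * \<eta>)) * h1sq N (et n)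
    \<le> l2sq N (er (n - 1)) + l2sq N (\<lambda>p. 2 *\<^sub>R er (n - 1) p - er (n - 2) p)
     + k * (4 * q * (1 + \<eta>)) * h1sq N (et (n - 1)) + k * (4 * r * (1 + \<eta>)) * h1sq N (et (n - 2))
     + k * (64 * energy_const \<alpha> (2 * B) \<eta> * (1 + (res_const \<alpha> B C2)\<^sup>2) + 4 * (q + r) * proj_const \<alpha> B C2 \<eta>) * (l2sq N (et n) + l2sq N (et (n - 1)) + l2sq N (et (n - 2)) + h ^ 4)"
proof -
  have e: "0 < \<eta>" "\<eta> \<le> 1/12" "\<eta> \<le> 1" "\<epsilon> > 0" using s by (auto simp: small_def)
  have Q: "2 * norm (et n p) * gradsq N (avgA (dn n)) p \<le> \<eta> * gradsq N (avgA (dn n)) p + 0 * (norm (et n p))\<^sup>2" if p: "p \<in> inner_pts N" for p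
  proof -
    have "(norm (et n p))\<^sup>2 \<le> \<epsilon> * h" by (rule small_good(2)[OF s n(2) b ag p])
    also have "\<dots> \<le> (\<eta>/224)\<^sup>2 * 1" using s h0 h1 unfolding small_def by (intro mult_mono) auto
    finally have "(norm (et n p))\<^sup>2 \<le> (\<eta>/224)\<^sup>2" by simp
    then have "norm (et n p) \<le> \<eta>/224" by (rule power2_le_imp_le) (use e in simp)
    then have "2 * norm (et n p) \<le> \<eta>" using e by linarith
    then have "2 * norm (et n p) * gradsq N (avgA (dn n)) p \<le> \<eta> * gradsq N (avgA (dn n)) p"
      by (rule mult_right_mono) (rule gradsq_nonneg)
    then show ?thesis by simp
  qed
  define X where "X = energy_const \<alpha> (2 * B) \<eta>" define Z where "Z = (res_const \<alpha> B C2)\<^sup>2"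
  define a where "a = l2sq N (et n)" define a1 where "a1 = l2sq N (et (n - 1))" define a2 where "a2 = l2sq N (et (n - 2))"
  define \<beta> where "\<beta> = h1sq N (et n)" define \<beta>1 where "\<beta>1 = h1sq N (et (n - 1))" define \<beta>2 where "\<beta>2 = h1sq N (et (n - 2))"
  define cp where "cp = proj_const \<alpha> B C2 \<eta>"
  have nn: "a \<ge> 0" "a1 \<ge> 0" "a2 \<ge> 0" "X \<ge> 0" "Z \<ge> 0" "cp \<ge> 0" "q \<ge> 0" "r \<ge> 0" "h ^ 4 \<ge> 0"
    using l2sq_nonneg al B1 e h0 CP0[OF e(1)] by (auto simp: a_def a1_def a2_def X_def Z_def energy_const_def cp_def q_def r_def)
  have E: "a + l2sq N (\<lambda>p. 2 *\<^sub>R et n p - er (n - 1) p) \<le> l2sq N (er (n - 1)) + l2sq N (\<lambda>p. 2 *\<^sub>R er (n - 1) p - er (n - 2) p)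
    + 4 * k * ((3/2 + 6 * \<eta> - \<alpha>) * \<beta> + q * h1sq N (er (n - 1)) + r * h1sq N (er (n - 2))
        + X * (a + l2sq N (er (n - 1)) + l2sq N (er (n - 2)) + Z * h ^ 4))"
    using error_energy[OF n e(1,3) dn_small(2)[OF s n gd] Q]
    unfolding a_def \<beta>_def X_def Z_def q_def r_def by (simp add: power_mult_distrib)
  have i1: "q * h1sq N (er (n - 1)) \<le> q * ((1 + \<eta>) * \<beta>1 + cp * a1)"
    using good_BB[OF gd(1)] nn unfolding \<beta>1_def a1_def cp_def by (intro mult_left_mono) auto
  have i2: "r * h1sq N (er (n - 2)) \<le> r * ((1 + \<eta>) * \<beta>2 + cp * a2)"
    using good_BB[OF gd(2)] nn unfolding \<beta>2_def a2_def cp_def by (intro mult_left_mono) auto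
  have i3: "X * (a + l2sq N (er (n - 1)) + l2sq N (er (n - 2)) + Z * h ^ 4) \<le> 16 * (X * (1 + Z) * (a + a1 + a2 + h ^ 4))"
  proof -
    have "a + l2sq N (er (n - 1)) + l2sq N (er (n - 2)) + Z * h ^ 4 \<le> a + 16 * a1 + 16 * a2 + Z * h ^ 4"
      using good_AA[OF gd(1)] good_AA[OF gd(2)] unfolding a1_def a2_def by linarith
    also have "\<dots> \<le> 16 * ((1 + Z) * (a + a1 + a2 + h ^ 4))"
    proof -
      have "0 \<le> Z * a" "0 \<le> Z * a1" "0 \<le> Z * a2" "0 \<le> Z * h ^ 4" using nn by auto
      moreover have "16 * ((1 + Z) * (a + a1 + a2 + h ^ 4)) = 16 * a + 16 * a1 + 16 * a2 + 16 * h ^ 4 + 16 * (Z * a) + 16 * (Z * a1) + 16 * (Z * a2) + 16 * (Z * h ^ 4)"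
        by (simp add: algebra_simps)
      ultimately show ?thesis using nn by linarith
    qed
    finally have "X * (a + l2sq N (er (n - 1)) + l2sq N (er (n - 2)) + Z * h ^ 4) \<le> X * (16 * ((1 + Z) * (a + a1 + a2 + h ^ 4)))"
      using nn by (intro mult_left_mono) auto
    then show ?thesis by (simp add: algebra_simps)
  qed
  have i4: "q * (cp * a1) + r * (cp * a2) \<le> (q + r) * cp * (a + a1 + a2 + h ^ 4)"
  proof -
    have "q * (cp * a1) \<le> q * (cp * (a + a1 + a2 + h ^ 4))" "r * (cp * a2) \<le> r * (cp * (a + a1 + a2 + h ^ 4))"
      using nn by (auto intro!: mult_left_mono)
    then show ?thesis by (simp add: algebra_simps)
  qed
  have "(3/2 + 6 * \<eta> - \<alpha>) * \<beta> + q * h1sq N (er (n - 1)) + r * h1sq N (er (n - 2)) + X * (a + l2sq N (er (n - 1)) + l2sq N (er (n - 2)) + Z * h ^ 4)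
     \<le> (3/2 + 6 * \<eta> - \<alpha>) * \<beta> + q * (1 + \<eta>) * \<beta>1 + r * (1 + \<eta>) * \<beta>2 + ((q + r) * cp * (a + a1 + a2 + h ^ 4) + 16 * (X * (1 + Z) * (a + a1 + a2 + h ^ 4)))"
  proof -
    have "q * ((1 + \<eta>) * \<beta>1 + cp * a1) = q * (1 + \<eta>) * \<beta>1 + q * (cp * a1)"
      "r * ((1 + \<eta>) * \<beta>2 + cp * a2) = r * (1 + \<eta>) * \<beta>2 + r * (cp * a2)" by (simp_all add: algebra_simps)
    then show ?thesis using i1 i2 i3 i4 by linarith
  qed
  then have "4 * k * ((3/2 + 6 * \<eta> - \<alpha>) * \<beta> + q * h1sq N (er (n - 1)) + r * h1sq N (er (n - 2)) + X * (a + l2sq N (er (n - 1)) + l2sq N (er (n - 2)) + Z * h ^ 4))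
     \<le> 4 * k * ((3/2 + 6 * \<eta> - \<alpha>) * \<beta> + q * (1 + \<eta>) * \<beta>1 + r * (1 + \<eta>) * \<beta>2 + ((q + r) * cp * (a + a1 + a2 + h ^ 4) + 16 * (X * (1 + Z) * (a + a1 + a2 + h ^ 4))))"
    using k0 by (intro mult_left_mono) auto
  also have "\<dots> = - (k * (4 * (\<alpha> - 3/2 - 6 * \<eta>)) * \<beta>) + k * (4 * q * (1 + \<eta>)) * \<beta>1 + k * (4 * r * (1 + \<eta>)) * \<beta>2
      + k * (64 * X * (1 + Z) + 4 * (q + r) * cp) * (a + a1 + a2 + h ^ 4)"
    by (simp add: algebra_simps)
  finally show ?thesis using E
    unfolding a_def a1_def a2_def \<beta>_def \<beta>1_def \<beta>2_def X_def Z_def cp_def by linarith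
qed

end

lemma l2sq_minus_commute: "l2sq N (\<lambda>p. f p - g p) = l2sq N (\<lambda>p. g p - f p)"
  by (simp add: l2sq_def norm_minus_commute)

lemma h1sq_minus_commute: "h1sq N (\<lambda>p. f p - g p) = h1sq N (\<lambda>p. g p - f p)"
proof -
  have "norm (dd N d (\<lambda>p. f p - g p) q) = norm (dd N d (\<lambda>p. g p - f p) q)" for d q
    unfolding dd_linear by (rule norm_minus_commute)
  then show ?thesis by (simp add: h1sq_def gradsq_dd)
qed

lemma crude_const_ge:
  assumes "K \<ge> 0" "\<eta> > 0" "\<alpha> \<ge> 0" shows "K \<le> crude_const \<alpha> B C2 \<eta> K"
proof -
  define Y where "Y = 8 * (2 + 48 * \<alpha>) * (2 + proj_const \<alpha> B C2 \<eta>) * K"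
  have "0 \<le> Y" using assms CP0[OF assms(2), of \<alpha> B C2] by (simp add: Y_def)
  moreover define Z where "Z = (res_const \<alpha> B C2)\<^sup>2"
  moreover have "0 \<le> Z" by (simp add: Z_def)
  ultimately show ?thesis unfolding crude_const_def Y_def[symmetric] Z_def[symmetric] using assms(1) by simp
qed

section \<open>Closing the induction over the time levels\<close>

context run
begin

lemma sup_ok_mono: "sup_ok K \<epsilon> \<Longrightarrow> K' \<le> K \<Longrightarrow> sup_ok K' \<epsilon>"
  unfolding sup_ok_def using h0 by (meson mult_right_mono order_trans zero_le_power less_imp_le)

lemma err_le_mono: "err_le K n \<Longrightarrow> K \<le> K' \<Longrightarrow> err_le K' n"
  unfolding err_le_def using h0 by (meson mult_right_mono order_trans zero_le_power less_imp_le)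

lemma step_le: "j \<le> n \<Longrightarrow> real n * k \<le> T \<Longrightarrow> real j * k \<le> T"
  using k0 by (meson mult_right_mono of_nat_mono less_imp_le order_trans)

text \<open>The constants are fixed in an order that breaks the circle: \<open>Ks\<close> depends
  only on the starting data, \<open>T\<close> and the coefficients, \<open>K\<close> covers what a
  bound of \<Phi> by \<open>Ks * h ^ 4\<close> implies, and the pointwise bound is required for
  \<open>crude_const\<close> of \<open>K\<close>. Every level thus returns to \<open>K\<close>,
  whatever the number of steps.\<close>

lemma run_convergence:
  fixes \<eta> \<epsilon> K0 :: real
  defines "q \<equiv> 1 + (1 + 48 * \<alpha>) * \<eta>" and "r \<equiv> 1/2 + (1 + 12 * \<alpha>) * \<eta>"
  defines "Q \<equiv> 4 * q * (1 + \<eta>)" and "R \<equiv> 4 * r * (1 + \<eta>)" and "P \<equiv> 4 * (\<alpha> - 3/2 - 6 * \<eta>)"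
  defines "\<kappa> \<equiv> P - Q - R"
  defines "Cg \<equiv> 64 * energy_const \<alpha> (2 * B) \<eta> * (1 + (res_const \<alpha> B C2)\<^sup>2) + 4 * (q + r) * proj_const \<alpha> B C2 \<eta> + 16 * (40 + 4 * B\<^sup>2)"
  defines "K0' \<equiv> crude_const \<alpha> B C2 \<eta> K0"
  defines "K1 \<equiv> 176 * (K0 + K0')"
  defines "K2 \<equiv> K1 + (Q + R + \<kappa>) * K0' + R * K0"
  defines "Ks \<equiv> (K2 + 1) * exp (6 * Cg * T)"
  defines "K \<equiv> Ks * (1 + 1/\<kappa>) + K0 + K0'"
  assumes s: "small \<eta> \<epsilon>" and kap: "\<kappa> > 0" and K0: "K0 \<ge> 0"
    and init: "\<And>j. j < 2 \<Longrightarrow> l2sq N (er j) \<le> K0 * h ^ 4 \<and> h1sq N (er j) \<le> K0 * h ^ 4"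
    and ag: "sup_ok (crude_const \<alpha> B C2 \<eta> K) \<epsilon>" and kC: "k * Cg \<le> 1/4"
    and n: "2 \<le> n" "real n * k \<le> T"
  shows "l2sq N (et n) \<le> Ks * h ^ 4" and "k * (\<Sum>i\<in>{2..n}. h1sq N (et i)) \<le> Ks / \<kappa> * h ^ 4" and "l2sq N (er n) \<le> 16 * Ks * h ^ 4"
proof -
  have e: "0 < \<eta>" "\<eta> \<le> 1/12" "\<eta> \<le> 1" "\<epsilon> > 0" using s by (auto simp: small_def)
  have al0: "\<alpha> \<ge> 0" using al by simp
  have T0: "T \<ge> 0" using n k0 by (meson mult_nonneg_nonneg of_nat_0_le_iff less_imp_le order_trans)
  have cp: "proj_const \<alpha> B C2 \<eta> \<ge> 0" by (rule CP0[OF e(1)])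
  have X0: "energy_const \<alpha> (2 * B) \<eta> \<ge> 0" using al B1 e by (simp add: energy_const_def)
  have qr: "q \<ge> 0" "r \<ge> 0" "Q \<ge> 0" "R \<ge> 0" using al e by (auto simp: q_def r_def Q_def R_def)
  have Cg0: "Cg \<ge> 0" unfolding Cg_def using cp X0 qr by (intro add_nonneg_nonneg mult_nonneg_nonneg) auto
  have K0': "K0' \<ge> K0" "K0' \<ge> 0" using crude_const_ge[OF K0 e(1) al0, of B C2] K0 unfolding K0'_def by linarith+
  have K1: "K1 \<ge> 0" using K0 K0' by (simp add: K1_def)
  have K2: "K2 \<ge> K1" using qr kap K0 K0' unfolding K2_def by simp
  have Ks0: "Ks \<ge> 0" using K1 K2 by (simp add: Ks_def)
  have KK: "Ks \<le> K" "Ks / \<kappa> \<le> K" "K0 \<le> K" "K0' \<le> K" "0 \<le> K"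
    using Ks0 kap K0 K0' divide_nonneg_nonneg[OF Ks0, of \<kappa>] by (auto simp: K_def distrib_left)
  have h4: "h ^ 4 > 0" using h0 by simp
  have agK: "sup_ok K' \<epsilon>" if "K' \<le> K" for K'
    using sup_ok_mono[OF ag] that crude_const_ge[OF KK(5) e(1) al0, of B C2] order_trans by blast
  have kT: "real j * k \<le> T" if "j \<le> n" for j using step_le[OF that n(2)] .
  have b01: "err_le K0 j" if "j < 2" for j
  proof -
    have "k * h1sq N (er j) \<le> 1 * h1sq N (er j)" using k1 h1sq_nonneg by (intro mult_right_mono) auto
    then show ?thesis using init[OF that] that unfolding err_le_def et_def by auto
  qed
  have g01: "good \<eta> \<epsilon> j" if "j < 2" for j
    using small_good(1)[OF s kT b01[OF that] agK[OF KK(3)]] that n by simp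
  \<comment> \<open>Level 2 is reached by the crude estimate alone; \<open>K0'\<close> is its
    price.\<close>
  have b2: "err_le K0' 2" unfolding K0'_def
    by (rule crude_step[OF s]) (use g01 b01 kT[of 2] n in auto)
  have g2: "good \<eta> \<epsilon> 2" by (rule small_good(1)[OF s kT b2 agK[OF KK(4)]]) (use n in simp)
  define A where "A j = l2sq N (et j)" for j
  define \<beta> where "\<beta> j = h1sq N (et j)" for j
  \<comment> \<open>Below level 3 the energy is replaced by a floor. At level 3 of the recursion it
    has to dominate nine times \<open>l2sq N (er 2)\<close> plus twice \<open>l2sq N (er 1)\<close>;
    hence the 176 = 9 * 16 + 2 * 16 in \<open>K1\<close>.\<close>
  define G where "G j = (if j \<ge> 3 then l2sq N (et j) + l2sq N (\<lambda>p. 2 *\<^sub>R et j p - er (j - 1) p) else max (A j) (K1 * h ^ 4))" for j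
  define \<Phi> where "\<Phi> j = G j + k * (Q + R) * \<beta> j + k * R * \<beta> (j - 1) + k * \<kappa> * (\<Sum>i\<in>{2..j}. \<beta> i)" for j
  have b0: "\<beta> j \<ge> 0" for j unfolding \<beta>_def by (rule h1sq_nonneg)
  have A0: "A j \<ge> 0" for j unfolding A_def by (rule l2sq_nonneg)
  have AG: "A j \<le> G j" for j unfolding G_def A_def using l2sq_nonneg[of N "\<lambda>p. 2 *\<^sub>R et j p - er (j - 1) p"] by auto
  have K0K1: "K0 * h ^ 4 \<le> K1 * h ^ 4" "K0' * h ^ 4 \<le> K1 * h ^ 4"
    using K0 K0' h4 by (auto simp: K1_def intro!: mult_right_mono)
  have G2: "G 2 = K1 * h ^ 4" using b2 K0K1 unfolding G_def A_def err_le_def by simp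
  have AP: "A j \<le> \<Phi> j" and BP: "k * \<kappa> * (\<Sum>i\<in>{2..j}. \<beta> i) \<le> \<Phi> j" for j
  proof -
    have "0 \<le> k * (Q + R) * \<beta> j" "0 \<le> k * R * \<beta> (j - 1)" "0 \<le> k * \<kappa> * (\<Sum>i\<in>{2..j}. \<beta> i)"
      using k0 qr kap b0 by (auto intro!: mult_nonneg_nonneg sum_nonneg)
    then show "A j \<le> \<Phi> j" "k * \<kappa> * (\<Sum>i\<in>{2..j}. \<beta> i) \<le> \<Phi> j" using AG[of j] A0[of j] unfolding \<Phi>_def by linarith+
  qed
  have Phi2: "\<Phi> 2 \<le> K2 * h ^ 4" "A 1 \<le> \<Phi> 2" "0 \<le> \<Phi> 2"
  proof -
    have kb: "k * \<beta> 2 \<le> K0' * h ^ 4" "k * \<beta> 1 \<le> K0 * h ^ 4" using b2 b01[of 1] unfolding err_le_def \<beta>_def by auto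
    have "\<Phi> 2 = K1 * h ^ 4 + (Q + R + \<kappa>) * (k * \<beta> 2) + R * (k * \<beta> 1)" unfolding \<Phi>_def G2 by (simp add: algebra_simps)
    also have "\<dots> \<le> K1 * h ^ 4 + (Q + R + \<kappa>) * (K0' * h ^ 4) + R * (K0 * h ^ 4)"
      using kb qr kap K1 by (intro add_mono mult_left_mono) auto
    also have "\<dots> = K2 * h ^ 4" by (simp add: K2_def algebra_simps)
    finally show "\<Phi> 2 \<le> K2 * h ^ 4" .
    have "0 \<le> k * (Q + R) * \<beta> 2" "0 \<le> k * R * \<beta> (2 - 1)" "0 \<le> k * \<kappa> * (\<Sum>i\<in>{2..2}. \<beta> i)"
      using k0 qr kap b0 by (auto intro!: mult_nonneg_nonneg)
    then have "K1 * h ^ 4 \<le> \<Phi> 2" unfolding \<Phi>_def G2 by linarith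
    moreover have "A 1 \<le> K0 * h ^ 4" using b01[of 1] unfolding err_le_def A_def by simp
    ultimately show "A 1 \<le> \<Phi> 2" using K0K1 by linarith
    show "0 \<le> \<Phi> 2" using AP[of 2] A0[of 2] by linarith
  qed
  have Kst: "\<Phi> j \<le> Ks * h ^ 4" if "\<Phi> j + h ^ 4 \<le> (\<Phi> 2 + h ^ 4) * exp (6 * (k * Cg) * real j)" "j \<le> n" for j
  proof -
    have "6 * (k * Cg) * real j = 6 * Cg * (real j * k)" by simp
    also have "\<dots> \<le> 6 * Cg * T" using kT[OF that(2)] Cg0 by (intro mult_left_mono) auto
    finally have "exp (6 * (k * Cg) * real j) \<le> exp (6 * Cg * T)" by simp
    then have "(\<Phi> 2 + h ^ 4) * exp (6 * (k * Cg) * real j) \<le> (K2 * h ^ 4 + h ^ 4) * exp (6 * Cg * T)"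
      using Phi2 h4 by (intro mult_mono) auto
    also have "\<dots> = Ks * h ^ 4" by (simp add: Ks_def algebra_simps)
    finally show ?thesis using that(1) h4 by linarith
  qed
  have bK: "err_le K j" if j: "2 \<le> j" "\<Phi> j \<le> Ks * h ^ 4" for j
  proof -
    have 1: "A j \<le> K * h ^ 4" using AP[of j] j(2) mult_right_mono[OF KK(1) less_imp_le[OF h4]] by linarith
    have "\<beta> j \<le> (\<Sum>i\<in>{2..j}. \<beta> i)" using j(1) b0 by (intro member_le_sum) auto
    then have "k * \<kappa> * \<beta> j \<le> k * \<kappa> * (\<Sum>i\<in>{2..j}. \<beta> i)" using k0 kap by (intro mult_left_mono) auto
    then have "k * \<kappa> * \<beta> j \<le> Ks * h ^ 4" using BP[of j] j(2) by linarith
    then have "k * \<beta> j \<le> Ks / \<kappa> * h ^ 4" using kap by (simp add: field_simps)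
    then have "k * \<beta> j \<le> K * h ^ 4" using mult_right_mono[OF KK(2) less_imp_le[OF h4]] by linarith
    then show ?thesis using 1 unfolding err_le_def A_def \<beta>_def by simp
  qed
  have epsk: "16 * \<epsilon> * h \<le> k"
  proof -
    have "16 * \<epsilon> * h \<le> C1 * h" using s h0 unfolding small_def by (intro mult_right_mono) auto
    then show ?thesis using kC1 by (simp add: h_def)
  qed
  have gs: "36 * \<alpha> * B\<^sup>2 * h \<le> 1" using s unfolding small_def by linarith
  have main: "\<Phi> l + h ^ 4 \<le> (\<Phi> 2 + h ^ 4) * exp (6 * (k * Cg) * real l)" if l: "2 \<le> l" "l \<le> n" for l
    unfolding \<Phi>_def
  proof (rule gronwall_two_step[where A=A and P=P and L=n, OF b0 AG less_imp_le[OF k0] Cg0 kC qr(3,4) less_imp_le[OF kap] less_imp_le[OF h4]])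
    show "P = Q + R + \<kappa>" by (simp add: \<kappa>_def)
    show "A 1 \<le> G 2 + k * (Q + R) * \<beta> 2 + k * R * \<beta> (2 - 1) + k * \<kappa> * sum \<beta> {2..2}" using Phi2(2) unfolding \<Phi>_def .
    show "0 \<le> G 2 + k * (Q + R) * \<beta> 2 + k * R * \<beta> (2 - 1) + k * \<kappa> * sum \<beta> {2..2}" using Phi2(3) unfolding \<Phi>_def .
    show "2 \<le> l" "l \<le> n" by fact+
    fix l assume l: "3 \<le> l" "l \<le> n"
      and IH: "\<And>j. 2 \<le> j \<Longrightarrow> j < l \<Longrightarrow> G j + k * (Q + R) * \<beta> j + k * R * \<beta> (j - 1) + k * \<kappa> * sum \<beta> {2..j} + h ^ 4
          \<le> (G 2 + k * (Q + R) * \<beta> 2 + k * R * \<beta> (2 - 1) + k * \<kappa> * sum \<beta> {2..2} + h ^ 4) * exp (6 * (k * Cg) * real j)"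
    have PK: "\<Phi> j \<le> Ks * h ^ 4" if "2 \<le> j" "j < l" for j
      using Kst[of j] IH[OF that] that l unfolding \<Phi>_def by simp
    have bd: "err_le K j" if "j < l" for j
      using bK[of j] PK[of j] err_le_mono[OF b01[of j] KK(3)] that by (cases "j < 2") auto
    have gd: "good \<eta> \<epsilon> j" if "j < l" for j
      using small_good(1)[OF s kT bd[OF that] agK[OF order_refl]] that l by simp
    \<comment> \<open>The crude step reaches level \<open>l\<close> only with the larger constant.
      This suffices for its maximum norm, and the sharp recursion then restores
      \<open>K\<close>.\<close>
    have bl: "err_le (crude_const \<alpha> B C2 \<eta> K) l"
      by (rule crude_step[OF s]) (use l gd bd kT in auto)
    have rs: "l2sq N (et l) + l2sq N (\<lambda>p. 2 *\<^sub>R et l p - er (l - 1) p) + k * P * \<beta> l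
      \<le> l2sq N (er (l - 1)) + l2sq N (\<lambda>p. 2 *\<^sub>R er (l - 1) p - er (l - 2) p) + k * Q * \<beta> (l - 1) + k * R * \<beta> (l - 2)
       + k * (64 * energy_const \<alpha> (2 * B) \<eta> * (1 + (res_const \<alpha> B C2)\<^sup>2) + 4 * (q + r) * proj_const \<alpha> B C2 \<eta>) * (A l + A (l - 1) + A (l - 2) + h ^ 4)"
      unfolding P_def Q_def R_def q_def r_def A_def \<beta>_def
      by (rule refined_step[OF s _ kT _ _ bl ag]) (use l gd in auto)
    have E: "l2sq N (er (l - 1)) + l2sq N (\<lambda>p. 2 *\<^sub>R er (l - 1) p - er (l - 2) p) \<le> G (l - 1) + k * (16 * (40 + 4 * B\<^sup>2)) * (A l + A (l - 1) + A (l - 2) + h ^ 4)"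
    proof (cases "l = 3")
      case True
      have "l2sq N (er 2) \<le> 16 * K0' * h ^ 4" using kBB_er(2)[OF g2 b2 e(1,3)] .
      moreover have "l2sq N (er 1) \<le> 16 * K0 * h ^ 4" using kBB_er(2)[OF g01 b01 e(1,3), of 1] by simp
      moreover have "l2sq N (\<lambda>p. 2 *\<^sub>R er 2 p - er 1 p) \<le> 8 * l2sq N (er 2) + 2 * l2sq N (er 1)" by (rule l2sq_two_minus)
      moreover have "9 * (16 * K0' * h ^ 4) + 2 * (16 * K0 * h ^ 4) \<le> K1 * h ^ 4"
      proof -
        have "9 * (16 * K0') + 2 * (16 * K0) \<le> K1" using K0 K0' unfolding K1_def by simp
        then have "(9 * (16 * K0') + 2 * (16 * K0)) * h ^ 4 \<le> K1 * h ^ 4" using h4 by (intro mult_right_mono) auto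
        then show ?thesis by (simp add: algebra_simps)
      qed
      moreover have "0 \<le> k * (16 * (40 + 4 * B\<^sup>2)) * (A l + A (l - 1) + A (l - 2) + h ^ 4)"
        using k0 A0 h4 by (intro mult_nonneg_nonneg add_nonneg_nonneg) auto
      ultimately show ?thesis using True G2 by simp
    next
      case False
      have l4: "3 \<le> l - 1" using l False by simp
      have l2: "l - 1 - 1 = l - 2" by simp
      have pe: "l2sq N (er (l - 1)) + l2sq N (\<lambda>p. 2 *\<^sub>R er (l - 1) p - er (l - 2) p)
        \<le> l2sq N (et (l - 1)) + l2sq N (\<lambda>p. 2 *\<^sub>R et (l - 1) p - er (l - 2) p) + (40 + 4 * B\<^sup>2) * k * (l2sq N (er (l - 1)) + l2sq N (er (l - 2)))"
        using projected_energy[OF l4 kT gd _ epsk gs] gd[of "l - 2"] l unfolding l2 by simp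
      have "l2sq N (er (l - 1)) + l2sq N (er (l - 2)) \<le> 16 * (A l + A (l - 1) + A (l - 2) + h ^ 4)"
      proof -
        have "l2sq N (er (l - 1)) \<le> 16 * A (l - 1)" "l2sq N (er (l - 2)) \<le> 16 * A (l - 2)"
          unfolding A_def using l by (intro good_AA[OF gd]; simp)+
        then show ?thesis using A0[of l] h4 unfolding distrib_left by linarith
      qed
      then have "(40 + 4 * B\<^sup>2) * k * (l2sq N (er (l - 1)) + l2sq N (er (l - 2))) \<le> (40 + 4 * B\<^sup>2) * k * (16 * (A l + A (l - 1) + A (l - 2) + h ^ 4))"
        using k0 by (intro mult_left_mono) auto
      then have "(40 + 4 * B\<^sup>2) * k * (l2sq N (er (l - 1)) + l2sq N (er (l - 2))) \<le> k * (16 * (40 + 4 * B\<^sup>2)) * (A l + A (l - 1) + A (l - 2) + h ^ 4)"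
        by (simp only: mult_ac)
      then show ?thesis using pe l4 unfolding G_def l2 by simp
    qed
    have "G l = l2sq N (et l) + l2sq N (\<lambda>p. 2 *\<^sub>R et l p - er (l - 1) p)" using l by (simp add: G_def)
    moreover have "k * Cg * (A l + A (l - 1) + A (l - 2) + h ^ 4)
      = k * (64 * energy_const \<alpha> (2 * B) \<eta> * (1 + (res_const \<alpha> B C2)\<^sup>2) + 4 * (q + r) * proj_const \<alpha> B C2 \<eta>) * (A l + A (l - 1) + A (l - 2) + h ^ 4)
       + k * (16 * (40 + 4 * B\<^sup>2)) * (A l + A (l - 1) + A (l - 2) + h ^ 4)"
      unfolding Cg_def by (simp add: distrib_left distrib_right)
    ultimately show "G l + k * P * \<beta> l \<le> G (l - 1) + k * Q * \<beta> (l - 1) + k * R * \<beta> (l - 2) + k * Cg * (A l + A (l - 1) + A (l - 2) + h ^ 4)"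
      using rs E by linarith
  qed
  have Pn: "\<Phi> n \<le> Ks * h ^ 4" by (rule Kst[OF main]) (use n in auto)
  show a: "l2sq N (et n) \<le> Ks * h ^ 4" using AP[of n] Pn unfolding A_def by linarith
  have "k * \<kappa> * (\<Sum>i\<in>{2..n}. \<beta> i) \<le> Ks * h ^ 4" using BP[of n] Pn by linarith
  then show "k * (\<Sum>i\<in>{2..n}. h1sq N (et i)) \<le> Ks / \<kappa> * h ^ 4" unfolding \<beta>_def using kap by (simp add: field_simps)
  have "good \<eta> \<epsilon> n" by (rule small_good(1)[OF s n(2) bK[OF n(1) Pn] agK[OF order_refl]])
  then have "l2sq N (er n) \<le> 16 * l2sq N (et n)" by (rule good_AA)
  then show "l2sq N (er n) \<le> 16 * Ks * h ^ 4" using a by linarith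
qed

text \<open>The final bound concerns \<open>M n\<close>, whereas \<open>et\<close> is measured from
  \<open>V n\<close>; they differ by the length correction, whose difference quotients are
  O(h^2).\<close>

lemma h1sq_unnormalised:
  assumes n: "n \<ge> 2" "real n * k \<le> T"
  shows "h1sq N (\<lambda>p. M n p - mt n p) \<le> 2 * h1sq N (et n) + 6 * (res_const \<alpha> B C2)\<^sup>2 * h ^ 4"
proof -
  have "h1sq N (\<lambda>p. M n p - mt n p) = h1sq N (\<lambda>p. mt n p - M n p)" by (rule h1sq_minus_commute)
  also have "(\<lambda>p. mt n p - M n p) = (\<lambda>p. et n p + gam n p *\<^sub>R M n p)"
    using n by (auto simp: et_def V_def fun_eq_iff algebra_simps)
  also have "h1sq N (\<lambda>p. et n p + gam n p *\<^sub>R M n p) \<le> gmean N (\<lambda>p. 2 * gradsq N (et n) p + 6 * (res_const \<alpha> B C2)\<^sup>2 * h ^ 4)"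
    unfolding h1sq_def
  proof (rule gmean_mono)
    fix p assume p: "p \<in> inner_pts N"
    have "(norm (dd N d (\<lambda>p. et n p + gam n p *\<^sub>R M n p) p))\<^sup>2 \<le> 2 * (norm (dd N d (et n) p))\<^sup>2 + 2 * ((res_const \<alpha> B C2)\<^sup>2 * h ^ 4)" for d
    proof -
      define x where "x = dd N d (et n) p" define y where "y = dd N d (\<lambda>p. gam n p *\<^sub>R M n p) p"
      have "norm y \<le> \<alpha> * C2 * (72 * B\<^sup>2 + 36 * B ^ 3) * h\<^sup>2" unfolding y_def by (rule dd_gamM[OF n(2) p])
      also have "\<dots> \<le> res_const \<alpha> B C2 * h\<^sup>2" by (rule mult_right_mono[OF res_const_parts(3)]) simp
      finally have "(norm y)\<^sup>2 \<le> (res_const \<alpha> B C2 * h\<^sup>2)\<^sup>2" by (rule power_mono) simp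
      then have y: "(norm y)\<^sup>2 \<le> (res_const \<alpha> B C2)\<^sup>2 * h ^ 4" by (simp add: power_mult_distrib)
      have "0 \<le> (norm (x - y))\<^sup>2" by simp
      then have "(norm (x + y))\<^sup>2 \<le> 2 * (norm x)\<^sup>2 + 2 * (norm y)\<^sup>2"
        unfolding power2_norm_eq_inner by (simp add: inner_diff_left inner_diff_right inner_add_left inner_add_right inner_commute[of y x])
      moreover have "dd N d (\<lambda>p. et n p + gam n p *\<^sub>R M n p) p = x + y" unfolding x_def y_def by (rule dd_linear)
      ultimately show ?thesis using y by (simp add: x_def)
    qed
    from this[of 1] this[of 2] this[of 3]
    show "gradsq N (\<lambda>p. et n p + gam n p *\<^sub>R M n p) p \<le> 2 * gradsq N (et n) p + 6 * (res_const \<alpha> B C2)\<^sup>2 * h ^ 4"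
      unfolding gradsq_dd sum_3 by simp
  qed
  also have "\<dots> = 2 * h1sq N (et n) + 6 * (res_const \<alpha> B C2)\<^sup>2 * h ^ 4"
    unfolding gmean_add gmean_cmult gmean_const[OF N0] h1sq_def ..
  finally show ?thesis .
qed

lemma gradient_sum_bound:
  assumes n: "2 \<le> n" "real n * k \<le> T" and K0: "h1sq N (er 1) \<le> K0 * h ^ 4"
    and S: "k * (\<Sum>i\<in>{2..n}. h1sq N (et i)) \<le> S * h ^ 4"
  shows "k * (\<Sum>p\<in>{1..n}. (h1semi N (\<lambda>q. M p q - mt p q))\<^sup>2) \<le> (K0 + 2 * S + 6 * (res_const \<alpha> B C2)\<^sup>2 * T) * h ^ 4"
proof -
  have kT: "real j * k \<le> T" if "j \<le> n" for j using step_le[OF that n(2)] .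
  define Z where "Z = 6 * (res_const \<alpha> B C2)\<^sup>2 * h ^ 4"
  have Z0: "Z \<ge> 0" using h0 by (simp add: Z_def)
  have sq: "(h1semi N f)\<^sup>2 = h1sq N f" for f by (simp add: h1semi_BB h1sq_nonneg)
  \<comment> \<open>This convention reduces the first term of the sum to the given starting
    error.\<close>
  have "mt 1 = m 1" using sch by (simp add: scheme_def)
  then have one: "h1sq N (\<lambda>q. M 1 q - mt 1 q) = h1sq N (er 1)"
    unfolding er_def[abs_def] by (simp only: h1sq_minus_commute[of N "M 1"])
  have "{1..n} = insert 1 {2..n}" using n by auto
  then have "(\<Sum>p\<in>{1..n}. (h1semi N (\<lambda>q. M p q - mt p q))\<^sup>2) = h1sq N (er 1) + (\<Sum>p\<in>{2..n}. h1sq N (\<lambda>q. M p q - mt p q))"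
    by (simp add: sq one[unfolded One_nat_def])
  also have "\<dots> \<le> h1sq N (er 1) + (\<Sum>p\<in>{2..n}. 2 * h1sq N (et p) + Z)"
    unfolding Z_def by (intro add_left_mono sum_mono h1sq_unnormalised) (auto intro: kT)
  also have "\<dots> = h1sq N (er 1) + 2 * (\<Sum>p\<in>{2..n}. h1sq N (et p)) + real (n - 1) * Z"
    by (simp add: sum.distrib sum_distrib_left)
  finally have "k * (\<Sum>p\<in>{1..n}. (h1semi N (\<lambda>q. M p q - mt p q))\<^sup>2) \<le> k * (h1sq N (er 1) + 2 * (\<Sum>p\<in>{2..n}. h1sq N (et p)) + real (n - 1) * Z)"
    using k0 by (intro mult_left_mono) auto
  also have "\<dots> = k * h1sq N (er 1) + 2 * (k * (\<Sum>p\<in>{2..n}. h1sq N (et p))) + real (n - 1) * k * Z" by (simp add: algebra_simps)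
  \<comment> \<open>The correction \<open>Z\<close> occurs \<open>n - 1\<close> times, and
    \<open>real (n - 1) * k\<close> is at most \<open>T\<close>.\<close>
  also have "\<dots> \<le> K0 * h ^ 4 + 2 * (S * h ^ 4) + T * Z"
  proof (intro add_mono mult_left_mono mult_right_mono S kT)
    have "k * h1sq N (er 1) \<le> 1 * h1sq N (er 1)" using k1 h1sq_nonneg by (intro mult_right_mono) auto
    then show "k * h1sq N (er 1) \<le> K0 * h ^ 4" using K0 by simp
  qed (use Z0 in auto)
  finally show ?thesis by (simp add: Z_def algebra_simps)
qed

end

section \<open>Choice of the constants and conclusion\<close>

text \<open>At \<eta> = 0 the surplus is 4 (\<alpha> - 3). The terms in \<eta> amount to at most (46
  + 480 \<alpha>) \<eta>, using \<eta> \<le> 1 in the quadratic ones, and the chosen \<eta> keeps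
  this below 2 (\<alpha> - 3).\<close>

lemma damping_margin:
  fixes \<alpha> :: real
  assumes al: "\<alpha> > 3"
  defines "\<eta> \<equiv> (\<alpha> - 3) / (24 + 240 * \<alpha>)"
  shows "0 < \<eta>" "\<eta> \<le> 1/12"
    "4 * (\<alpha> - 3/2 - 6 * \<eta>) - 4 * (1 + (1 + 48 * \<alpha>) * \<eta>) * (1 + \<eta>) - 4 * (1/2 + (1 + 12 * \<alpha>) * \<eta>) * (1 + \<eta>) > 0"
proof -
  show e: "0 < \<eta>" "\<eta> \<le> 1/12" using al by (auto simp: \<eta>_def divide_le_eq)
  have m: "(24 + 240 * \<alpha>) * \<eta> = \<alpha> - 3" using al by (simp add: \<eta>_def)
  have "(2 + 60 * \<alpha>) * \<eta> * \<eta> \<le> (2 + 60 * \<alpha>) * \<eta> * 1" using e al by (intro mult_left_mono) auto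
  then show "4 * (\<alpha> - 3/2 - 6 * \<eta>) - 4 * (1 + (1 + 48 * \<alpha>) * \<eta>) * (1 + \<eta>) - 4 * (1/2 + (1 + 12 * \<alpha>) * \<eta>) * (1 + \<eta>) > 0"
    using m e mult_pos_pos[OF _ e(1), of \<alpha>] al by (simp add: algebra_simps)
qed

theorem mainTheorem1:
  fixes \<alpha> T C0 C1 C2 :: real and me :: "real^3 \<Rightarrow> real \<Rightarrow> real^3"
  assumes "T > 0" and "\<alpha> > 3" and "LL_exact \<alpha> T me"
    and "C1 > 0" and "C2 > 0"
  shows "\<exists>C>0. \<exists>\<delta>>0. \<forall>(N::nat) (k::real) m mt.
           (N > 0 \<and> k > 0 \<and> 1 / real N < \<delta> \<and> k < \<delta> \<and>
            C1 * (1 / real N) \<le> k \<and> k \<le> C2 * (1 / real N) \<and>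
            scheme \<alpha> N k m mt \<and>
            (\<forall>p\<in>{0, 1::nat}.
               l2norm N (\<lambda>q. interp N (\<lambda>x. me x (real p * k)) q - m p q)
               + h1semi N (\<lambda>q. interp N (\<lambda>x. me x (real p * k)) q - m p q)
               \<le> C0 * (k\<^sup>2 + (1 / real N)\<^sup>2)))
           \<longrightarrow> (\<forall>n::nat. 2 \<le> n \<and> n \<le> nat \<lfloor>T / k\<rfloor> \<longrightarrow>
                 l2norm N (\<lambda>q. interp N (\<lambda>x. me x (real n * k)) q - m n q)
                 + sqrt (k * (\<Sum>p\<in>{1..n}.
                     (h1semi N (\<lambda>q. interp N (\<lambda>x. me x (real p * k)) q - mt p q))\<^sup>2))
                 \<le> C * (k\<^sup>2 + (1 / real N)\<^sup>2))"
proof -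
  obtain B ft g and H :: "3 \<Rightarrow> 3 \<Rightarrow> real^3 \<Rightarrow> real \<Rightarrow> real^3" where ex: "exact_solution \<alpha> T B me ft g H"
    using LL_exact_imp_exact_solution[OF assms(1,3)] by blast
  have B1: "B \<ge> 1" using ex by (simp add: exact_solution_def)
  define \<eta> where "\<eta> = (\<alpha> - 3) / (24 + 240 * \<alpha>)"
  note eta = damping_margin[OF assms(2), folded \<eta>_def]
  define \<epsilon> where "\<epsilon> = min ((\<eta>/224)\<^sup>2) (min (C1/16) (\<eta> / (140000 * C2 * \<alpha>)))"
  have eps: "\<epsilon> > 0" "\<epsilon> \<le> (\<eta>/224)\<^sup>2" "\<epsilon> \<le> C1/16" "\<epsilon> \<le> \<eta> / (140000 * C2 * \<alpha>)"
    using eta assms by (auto simp: \<epsilon>_def)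
  define q where "q = 1 + (1 + 48 * \<alpha>) * \<eta>" define r where "r = 1/2 + (1 + 12 * \<alpha>) * \<eta>"
  define Q where "Q = 4 * q * (1 + \<eta>)" define R where "R = 4 * r * (1 + \<eta>)" define P where "P = 4 * (\<alpha> - 3/2 - 6 * \<eta>)"
  define \<kappa> where "\<kappa> = P - Q - R"
  have kap: "\<kappa> > 0" using eta(3) unfolding \<kappa>_def P_def Q_def R_def q_def r_def .
  define X where "X = energy_const \<alpha> (2 * B) \<eta>"
  define Cg where "Cg = 64 * X * (1 + (res_const \<alpha> B C2)\<^sup>2) + 4 * (q + r) * proj_const \<alpha> B C2 \<eta> + 16 * (40 + 4 * B\<^sup>2)"
  \<comment> \<open>From \<open>k \<le> C2 * h\<close> the sum of \<open>k\<^sup>2\<close> and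
    \<open>h\<^sup>2\<close> is at most \<open>(C2\<^sup>2 + 1) * h\<^sup>2\<close>; the absolute
    value covers a negative \<open>C0\<close>.\<close>
  define c0 where "c0 = \<bar>C0\<bar> * (C2\<^sup>2 + 1)"
  define K0 where "K0 = c0\<^sup>2"
  define K0' where "K0' = crude_const \<alpha> B C2 \<eta> K0"
  define K1 where "K1 = 176 * (K0 + K0')"
  define K2 where "K2 = K1 + (Q + R + \<kappa>) * K0' + R * K0"
  define Ks where "Ks = (K2 + 1) * exp (6 * Cg * T)"
  define K where "K = Ks * (1 + 1/\<kappa>) + K0 + K0'"
  note cdefs = q_def r_def Q_def R_def P_def \<kappa>_def X_def Cg_def K0'_def K1_def K2_def Ks_def K_def
  have al0: "\<alpha> \<ge> 0" using assms by simp
  have qr: "q \<ge> 0" "r \<ge> 0" "Q \<ge> 0" "R \<ge> 0" using al0 eta by (auto simp: q_def r_def Q_def R_def)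
  have X0: "X \<ge> 0" using al0 B1 eta by (simp add: X_def energy_const_def)
  have Cg0: "Cg \<ge> 0" unfolding Cg_def using CP0[OF eta(1)] X0 qr by (intro add_nonneg_nonneg mult_nonneg_nonneg) auto
  have K0: "K0 \<ge> 0" by (simp add: K0_def)
  have K0': "K0' \<ge> 0" using crude_const_ge[OF K0 eta(1) al0, of B C2] K0 unfolding K0'_def by linarith
  have "K2 \<ge> 0" unfolding K2_def K1_def using K0 K0' qr kap by simp
  then have Ks0: "Ks > 0" by (simp add: Ks_def)
  have K: "K > 0" unfolding K_def using Ks0 K0 K0' kap by (intro add_pos_nonneg mult_pos_pos) auto
  then have Kf0: "crude_const \<alpha> B C2 \<eta> K > 0" using crude_const_ge[OF less_imp_le[OF K] eta(1) al0, of B C2] by linarith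
  \<comment> \<open>\<open>K\<close> is final at this point, so the mesh threshold for the maximum
    norm can be chosen from it without circularity.\<close>
  obtain \<delta>a where da: "\<delta>a > 0" and ag: "\<And>N k f. N > 0 \<and> 1 / real N < \<delta>a \<and> C1 * (1 / real N) \<le> k \<and> l2sq N f \<le> crude_const \<alpha> B C2 \<eta> K * (1 / real N) ^ 4
      \<and> k * h1sq N f \<le> crude_const \<alpha> B C2 \<eta> K * (1 / real N) ^ 4 \<Longrightarrow> (\<forall>p\<in>inner_pts N. (norm (f p))\<^sup>2 \<le> \<epsilon> * (1 / real N))"
    using agmon_small[OF eps(1) Kf0 assms(4)] by meson
  \<comment> \<open>The six entries serve in turn \<open>agmon_small\<close>, the bounds
    \<open>N \<ge> 2\<close> and \<open>k \<le> 1\<close>, the length correction, the extrapolation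
    error, and the absorptions with \<open>energy_const\<close> and \<open>Cg\<close>.\<close>
  define \<delta> where "\<delta> = Min {\<delta>a, 1/2, \<eta> / 224 / (36 * \<alpha> * B\<^sup>2), \<epsilon> / (3 * B\<^sup>2 * C2), 1 / (16 * X + 1), 1 / (4 * Cg + 1)}"
  have dpos: "\<delta> > 0" unfolding \<delta>_def using da eta assms B1 eps X0 Cg0
    by (subst Min_gr_iff) (auto intro!: divide_pos_pos mult_pos_pos)
  have dle: "\<delta> \<le> \<delta>a" "\<delta> \<le> 1/2" "\<delta> \<le> \<eta> / 224 / (36 * \<alpha> * B\<^sup>2)" "\<delta> \<le> \<epsilon> / (3 * B\<^sup>2 * C2)" "\<delta> \<le> 1 / (16 * X + 1)" "\<delta> \<le> 1 / (4 * Cg + 1)"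
    unfolding \<delta>_def by (intro Min_le; simp)+
  define S0 where "S0 = K0 + 2 * (Ks / \<kappa>) + 6 * (res_const \<alpha> B C2)\<^sup>2 * T"
  have S0: "S0 \<ge> 0" unfolding S0_def using K0 Ks0 kap assms(1) by simp
  \<comment> \<open>The 4 is the square root of the 16 that normalisation costs in
    \<open>l2sq\<close>.\<close>
  define C where "C = 4 * sqrt Ks + sqrt S0"
  have C: "C > 0" unfolding C_def using Ks0 S0 by (simp add: add_pos_nonneg)
  show ?thesis
  proof (rule exI[of _ C], rule conjI[OF C], rule exI[of _ \<delta>], rule conjI[OF dpos], intro allI impI, goal_cases)
    case (1 N k m mt n)
    then have N: "N > 0" and k: "k > 0" and hd: "1 / real N < \<delta>" and kd: "k < \<delta>"
      and kC1: "C1 * (1 / real N) \<le> k" and kC2: "k \<le> C2 * (1 / real N)" and sch: "scheme \<alpha> N k m mt"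
      and init: "\<And>p. p \<in> {0, 1::nat} \<Longrightarrow> l2norm N (\<lambda>q. interp N (\<lambda>x. me x (real p * k)) q - m p q)
               + h1semi N (\<lambda>q. interp N (\<lambda>x. me x (real p * k)) q - m p q) \<le> C0 * (k\<^sup>2 + (1 / real N)\<^sup>2)"
      and n: "2 \<le> n" "n \<le> nat \<lfloor>T / k\<rfloor>" by auto
    have N2: "N \<ge> 2"
    proof -
      have "1 / real N < 1 / 2" using hd dle(2) by linarith
      then have "2 < real N" using N by (simp add: field_simps)
      then show ?thesis by linarith
    qed
    have k1: "k \<le> 1" using kd dle(2) by linarith
    interpret run \<alpha> T B me ft g H C1 C2 N k m mt
      by unfold_locales (use ex assms N2 k k1 kC1 kC2 sch in auto)
    have nT: "real n * k \<le> T"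
    proof -
      have "real n \<le> real (nat \<lfloor>T / k\<rfloor>)" using n by simp
      also have "\<dots> \<le> T / k" using assms(1) k by (intro of_nat_floor) simp
      finally show ?thesis using k by (simp add: field_simps)
    qed
    have sm: "small \<eta> \<epsilon>"
      unfolding small_def
    proof (intro conjI eta eps)
      have "h \<le> \<eta> / 224 / (36 * \<alpha> * B\<^sup>2)" using hd dle(3) by (simp add: h_def)
      then show "36 * \<alpha> * B\<^sup>2 * h \<le> \<eta> / 224" using assms(2) B1 by (simp add: field_simps)
      have "k \<le> \<epsilon> / (3 * B\<^sup>2 * C2)" using kd dle(4) by simp
      then show "3 * B\<^sup>2 * C2 * k \<le> \<epsilon>" using assms(5) B1 by (simp add: field_simps)
      have "k \<le> 1 / (16 * X + 1)" using kd dle(5) by simp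
      then have "k * (16 * X + 1) \<le> 1" using X0 by (simp add: field_simps)
      then show "16 * k * energy_const \<alpha> (2 * B) \<eta> \<le> 1" using k unfolding X_def by (simp add: algebra_simps)
    qed
    have kC: "k * Cg \<le> 1/4"
    proof -
      have "k \<le> 1 / (4 * Cg + 1)" using kd dle(6) by simp
      then have "k * (4 * Cg + 1) \<le> 1" using Cg0 by (simp add: field_simps)
      then show ?thesis using k by (simp add: algebra_simps)
    qed
    have agK: "sup_ok (crude_const \<alpha> B C2 \<eta> K) \<epsilon>"
      unfolding sup_ok_def h_def using ag N hd dle(1) kC1 by force
    have kh: "k\<^sup>2 + h\<^sup>2 \<le> (C2\<^sup>2 + 1) * h\<^sup>2" using k2 by (simp add: algebra_simps)
    have ini: "l2sq N (er j) \<le> K0 * h ^ 4 \<and> h1sq N (er j) \<le> K0 * h ^ 4" if j: "j < 2" for j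
    proof -
      have "j \<in> {0, 1}" using j by auto
      then have "sqrt (l2sq N (er j)) + sqrt (h1sq N (er j)) \<le> C0 * (k\<^sup>2 + h\<^sup>2)"
        using init[of j] unfolding l2norm_AA h1semi_BB er_def[abs_def] M_def h_def
        by (simp add: l2sq_minus_commute[of N "m j"] h1sq_minus_commute[of N "m j"])
      also have "\<dots> \<le> \<bar>C0\<bar> * ((C2\<^sup>2 + 1) * h\<^sup>2)" using kh by (intro mult_mono) auto
      finally have le: "sqrt (l2sq N (er j)) + sqrt (h1sq N (er j)) \<le> c0 * h\<^sup>2" by (simp add: c0_def)
      have nn: "0 \<le> sqrt (l2sq N (er j))" "0 \<le> sqrt (h1sq N (er j))" by (simp_all add: l2sq_nonneg h1sq_nonneg)
      have "(sqrt (l2sq N (er j)))\<^sup>2 \<le> (c0 * h\<^sup>2)\<^sup>2" "(sqrt (h1sq N (er j)))\<^sup>2 \<le> (c0 * h\<^sup>2)\<^sup>2"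
        using le nn by (intro power_mono; linarith)+
      then show ?thesis by (simp add: l2sq_nonneg h1sq_nonneg K0_def power_mult_distrib)
    qed
    note rc0 = run_convergence[OF sm kap[unfolded cdefs] K0 ini agK[unfolded cdefs] kC[unfolded cdefs] n(1) nT]
    have rc: "k * (\<Sum>i\<in>{2..n}. h1sq N (et i)) \<le> Ks / \<kappa> * h ^ 4" "l2sq N (er n) \<le> 16 * Ks * h ^ 4"
      unfolding cdefs by (rule rc0(2), assumption) (rule rc0(3), assumption)
    have a: "l2norm N (\<lambda>q. interp N (\<lambda>x. me x (real n * k)) q - m n q) \<le> 4 * sqrt Ks * h\<^sup>2"
    proof -
      have "l2norm N (\<lambda>q. interp N (\<lambda>x. me x (real n * k)) q - m n q) = sqrt (l2sq N (er n))"
        unfolding l2norm_AA er_def[abs_def] M_def by (simp add: l2sq_minus_commute[of N "m n"])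
      also have "\<dots> \<le> sqrt (16 * Ks * h ^ 4)" using rc(2) by simp
      also have "\<dots> = sqrt ((4 * h\<^sup>2)\<^sup>2 * Ks)" by (simp add: power_mult_distrib algebra_simps)
      also have "\<dots> = \<bar>4 * h\<^sup>2\<bar> * sqrt Ks" by (simp only: real_sqrt_mult real_sqrt_abs)
      also have "\<dots> = 4 * sqrt Ks * h\<^sup>2" by simp
      finally show ?thesis .
    qed
    have b: "sqrt (k * (\<Sum>p\<in>{1..n}. (h1semi N (\<lambda>q. interp N (\<lambda>x. me x (real p * k)) q - mt p q))\<^sup>2)) \<le> sqrt S0 * h\<^sup>2"
    proof -
      have "k * (\<Sum>p\<in>{1..n}. (h1semi N (\<lambda>q. M p q - mt p q))\<^sup>2) \<le> S0 * h ^ 4"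
        unfolding S0_def by (rule gradient_sum_bound[OF n(1) nT _ rc(1)]) (use ini[of 1] in simp)
      then have "sqrt (k * (\<Sum>p\<in>{1..n}. (h1semi N (\<lambda>q. M p q - mt p q))\<^sup>2)) \<le> sqrt ((h\<^sup>2)\<^sup>2 * S0)"
        by (simp add: mult.commute)
      also have "\<dots> = \<bar>h\<^sup>2\<bar> * sqrt S0" by (simp only: real_sqrt_mult real_sqrt_abs)
      also have "\<dots> = sqrt S0 * h\<^sup>2" by simp
      finally show ?thesis unfolding M_def .
    qed
    have "C * h\<^sup>2 \<le> C * (k\<^sup>2 + h\<^sup>2)" using C by (intro mult_left_mono) auto
    then show ?case using a b unfolding h_def C_def by (simp add: distrib_right)
  qed
qed

end
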